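(* Let $P,Q:\mathbb{Z}\to\mathbb{Z}$ be two functions such that $P$ or $Q$ equals the function $m\mapsto\phi(|m|)$ or the function $m\mapsto\pi(|m|)$, where $\phi$ is Euler's totient function and $\pi$ is the prime counting function. Then for any $\epsilon\in(0,1)$ there is a constant $C_\epsilon$ such that the operator $$B_{P,Q}^{\mathrm{dis}}(f,g)(n)=\sum_{m\in\mathbb{Z}\setminus\{0\}} f(n-P(m))\,g(n-Q(m))\,\frac{1}{m},\qquad n\in\mathbb{Z},$$ satisfies $$\|B_{P,Q}^{\mathrm{dis}}(f,g)\|_{l^{1+\epsilon}}\le C_{\epsilon}\,\|f\|_{l^2}\,\|g\|_{l^2}\qquad\text{for any } f,g\in l^2.$$
   Context: Here $l^p=l^p(\mathbb{Z})$ denotes the usual space of complex-valued functions on $\mathbb{Z}$ with its usual norm. For a positive integer $n$, $\phi(n)$ is the number of positive integers $\le n$ coprime to $n$, and $\pi(n)$ is the number of primes $\le n$. The values of $P$ and $Q$ at $m=0$ play no role, since the sum defining the operator omits $m=0$. When only one of $P,Q$ is assumed to be one of the two listed functions, the other is an arbitrary function $\mathbb{Z}\to\mathbb{Z}$. The constant $C_\epsilon$ depends only on $\epsilon$. *)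

theory Defs
  imports "HOL-Analysis.Analysis" "HOL-Number_Theory.Totient"
begin

definition lp_space :: "real \<Rightarrow> (int \<Rightarrow> complex) set" where
  "lp_space p = {f. (\<lambda>n. norm (f n) powr p) summable_on UNIV}"

(* Meaningful only on lp_space p: a divergent infsum is 0. *)
definition lp_norm :: "real \<Rightarrow> (int \<Rightarrow> complex) \<Rightarrow> real" where
  "lp_norm p f = (\<Sum>\<^sub>\<infinity>n. norm (f n) powr p) powr (1 / p)"

definition prime_counting :: "nat \<Rightarrow> nat" where
  "prime_counting n = card {p. prime p \<and> p \<le> n}"

(* Only arguments m \<noteq> 0 are constrained, since only those enter the sum below. *)
definition totient_or_prime_counting :: "(int \<Rightarrow> int) \<Rightarrow> bool" where
  "totient_or_prime_counting P \<longleftrightarrow>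
     (\<forall>m. m \<noteq> 0 \<longrightarrow> P m = int (totient (nat \<bar>m\<bar>))) \<or>
     (\<forall>m. m \<noteq> 0 \<longrightarrow> P m = int (prime_counting (nat \<bar>m\<bar>)))"

definition B_dis_summand ::
  "(int \<Rightarrow> int) \<Rightarrow> (int \<Rightarrow> int) \<Rightarrow> (int \<Rightarrow> complex) \<Rightarrow> (int \<Rightarrow> complex) \<Rightarrow> int \<Rightarrow> int \<Rightarrow> complex" where
  "B_dis_summand P Q f g n m = f (n - P m) * g (n - Q m) * (1 / of_int m)"

(* An unordered sum: it has the intended value only where the summand is summable,
   so summability has to be asserted separately. *)
definition B_dis ::
  "(int \<Rightarrow> int) \<Rightarrow> (int \<Rightarrow> int) \<Rightarrow> (int \<Rightarrow> complex) \<Rightarrow> (int \<Rightarrow> complex) \<Rightarrow> int \<Rightarrow> complex" where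
  "B_dis P Q f g n = (\<Sum>\<^sub>\<infinity>m\<in>UNIV - {0}. B_dis_summand P Q f g n m)"

end

(* Cut the sum over m into dyadic blocks 2^j <= |m| < 2^(j+1) and normalise f and g in l^2. On each
   block the l^1 norm is bounded by Cauchy-Schwarz, and the sup norm by sqrt (2 N_j / 2^j), where N_j
   is the largest number of m in the block with one common value P m. Interpolation gives summable
   l^(1+eps) norms as soon as N_j <= C_A 2^j / (j+1)^A for every A.

   For the totient: if m has a prime power component p^e > y, then m is determined by phi m, e and
   m / p^e; numbers with few prime factors and only small components are rare; numbers with r prime
   factors have at least 2^r divisors, hence are rare too.

   For the prime counting function a fibre is a prime gap, so a log-power saving over the trivial bound
   is needed. On Re s > 1 the k-th derivative of -zeta'/zeta - zeta is the Dirichlet series of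
   (mangoldt n - 1) (- ln n)^k, and it grows at most linearly in Im s, by the 3-4-1 inequality and
   Cauchy's estimates. Averaging it against a Gaussian localises this series to n near e^u, and the
   factor (ln n)^k supplies the saving. *)
theory Submission
  imports Defs "HOL-Complex_Analysis.Complex_Analysis" "HOL-Number_Theory.Prime_Powers"
    "HOL-Probability.Characteristic_Functions" "HOL-Real_Asymp.Real_Asymp"
begin

text \<open>Only one of the two maps is under control, so the sup bound on a block uses the fibres
  of that map alone and bounds the other factor by 1. Interpolation raises the saving to the power
  \<epsilon>/2, so no fixed A serves all \<epsilon>: A has to grow like 1/\<epsilon>. The averages
  are taken at Re s = 1 + 1/u and no contour is shifted. For Gaussian width w, averaging the k-th
  derivative gives O(1/w) with a constant independent of u, whereas the integers near e^u alone
  contribute at least a multiple of u^k w. If the window is free of primes, the sum over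
  \<open>mangoldt\<close> is bounded, so u^k w^2 is bounded, and k is free. Subtracting zeta serves
  twice: it cancels the pole at 1, so that all derivatives stay bounded there, and it supplies the
  coefficients -1 against which missing primes are weighed. Linear growth for every k requires that
  near Re s = 1 only an arbitrarily small power of Im s is lost. Therefore all bounds for zeta carry
  a parameter \<eta>, which is fixed at the end in terms of k.\<close>

section \<open>Dirichlet series\<close>

text \<open>The term \<open>n = 0\<close> vanishes because \<open>0 powr z = 0\<close>.\<close>

definition dirichlet :: "(nat \<Rightarrow> real) \<Rightarrow> complex \<Rightarrow> complex" where
  "dirichlet a s = (\<Sum>n. of_real (a n) * of_nat n powr (-s))"

text \<open>Convergence is required at all exponents above 1 at once, so that the class is closed
  under multiplying coefficients by ln n, that is under differentiation.\<close>

definition dirichlet_abs_conv :: "(nat \<Rightarrow> real) \<Rightarrow> bool" where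
  "dirichlet_abs_conv a \<longleftrightarrow> (\<forall>\<sigma>>1. summable (\<lambda>n. \<bar>a n\<bar> * real n powr (-\<sigma>)))"

lemma norm_of_nat_powr: "norm ((of_nat n :: complex) powr s) = real n powr Re s"
proof (cases "n = 0")
  case False
  then show ?thesis
    using norm_powr_real_powr[of "of_nat n" s] by simp
qed simp

lemma dirichlet_summable:
  assumes "dirichlet_abs_conv a" "Re s > 1"
  shows "summable (\<lambda>n. norm (of_real (a n) * (of_nat n :: complex) powr (-s)))"
  using assms by (simp add: dirichlet_abs_conv_def norm_mult norm_of_nat_powr)

lemma dirichlet_sums:
  assumes "dirichlet_abs_conv a" "Re s > 1"
  shows "(\<lambda>n. of_real (a n) * (of_nat n :: complex) powr (-s)) sums dirichlet a s"
  unfolding dirichlet_def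
  by (rule summable_sums[OF summable_norm_cancel[OF dirichlet_summable[OF assms]]])

lemma ln_le_powr:
  assumes "\<delta> > 0" shows "ln (real n) \<le> real n powr \<delta> / \<delta>"
proof (cases "n = 0")
  case False
  then show ?thesis using ln_powr_bound[of "real n" \<delta>] assms by simp
qed simp

lemma dirichlet_abs_conv_comparison:
  assumes "dirichlet_abs_conv a" "\<And>n. \<bar>b n\<bar> \<le> C * \<bar>a n\<bar>"
  shows "dirichlet_abs_conv b"
  unfolding dirichlet_abs_conv_def
proof (intro allI impI)
  fix \<sigma> :: real assume "\<sigma> > 1"
  then have "summable (\<lambda>n. C * (\<bar>a n\<bar> * real n powr (-\<sigma>)))"
    using assms(1) by (intro summable_mult) (auto simp: dirichlet_abs_conv_def)
  then show "summable (\<lambda>n. \<bar>b n\<bar> * real n powr (-\<sigma>))"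
    by (rule summable_comparison_test')
       (use assms(2) in \<open>auto simp: mult.assoc[symmetric] intro!: mult_right_mono\<close>)
qed

text \<open>A logarithm costs at most n^\<delta> / \<delta>, and half of the room \<sigma> - 1 pays
  for it.\<close>

lemma dirichlet_abs_conv_ln:
  assumes "dirichlet_abs_conv a"
  shows "dirichlet_abs_conv (\<lambda>n. ln (real n) * a n)"
  unfolding dirichlet_abs_conv_def
proof (intro allI impI)
  fix \<sigma> :: real assume \<sigma>: "\<sigma> > 1"
  define \<delta> where "\<delta> = (\<sigma> - 1) / 2"
  have \<delta>: "\<delta> > 0" "\<sigma> - \<delta> > 1" using \<sigma> by (auto simp: \<delta>_def field_simps)
  have "summable (\<lambda>n. (1/\<delta>) * (\<bar>a n\<bar> * real n powr (-(\<sigma>-\<delta>))))"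
    using assms \<delta> by (intro summable_mult) (auto simp: dirichlet_abs_conv_def)
  then show "summable (\<lambda>n. \<bar>ln (real n) * a n\<bar> * real n powr (-\<sigma>))"
  proof (rule summable_comparison_test')
    fix n :: nat assume "n \<ge> 0"
    have "\<bar>ln (real n)\<bar> \<le> real n powr \<delta> / \<delta>"
      using ln_le_powr[OF \<delta>(1), of n] by (cases "n = 0") auto
    then have "\<bar>ln (real n)\<bar> * (\<bar>a n\<bar> * real n powr (-\<sigma>)) \<le> (real n powr \<delta> / \<delta>) * (\<bar>a n\<bar> * real n powr (-\<sigma>))"
      by (intro mult_right_mono) auto
    also have "\<dots> = (1/\<delta>) * (\<bar>a n\<bar> * real n powr (-(\<sigma>-\<delta>)))"
      by (simp add: powr_add[symmetric])
    finally show "norm (\<bar>ln (real n) * a n\<bar> * real n powr (-\<sigma>)) \<le> (1/\<delta>) * (\<bar>a n\<bar> * real n powr (-(\<sigma>-\<delta>)))"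
      by (simp add: abs_mult mult_ac)
  qed
qed

lemma dirichlet_abs_conv_one: "dirichlet_abs_conv (\<lambda>_. 1)"
  by (auto simp: dirichlet_abs_conv_def summable_real_powr_iff)

lemma dirichlet_abs_conv_power_ln:
  assumes "dirichlet_abs_conv a"
  shows "dirichlet_abs_conv (\<lambda>n. ln (real n) ^ k * a n)"
proof (induction k)
  case 0 then show ?case using assms by simp
next
  case (Suc k)
  from dirichlet_abs_conv_ln[OF this] show ?case by (simp add: mult.assoc)
qed

lemma open_Re_gt: "open {s. Re s > c}"
  by (rule open_halfspace_Re_gt)

text \<open>Termwise differentiation by the Weierstrass test: on a ball around x that stays to the
  right of \<sigma> = (1 + Re x) / 2, the terms are dominated by their norms at \<sigma>.\<close>

lemma dirichlet_has_field_derivative: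
  assumes "dirichlet_abs_conv a" "Re s > 1"
  shows "(dirichlet a has_field_derivative dirichlet (\<lambda>n. - ln (real n) * a n) s) (at s)"
proof -
  define f where "f = (\<lambda>n s. of_real (a n) * (of_nat n :: complex) powr (-s))"
  define f' where "f' = (\<lambda>n s. of_real (- ln (real n) * a n) * (of_nat n :: complex) powr (-s))"
  let ?S = "{s. Re s > 1}"
  have der: "(f n has_field_derivative f' n s) (at s)" if "s \<in> ?S" for n s
  proof (cases "n = 0")
    case False
    have "((\<lambda>s. (of_nat n :: complex) powr (-s)) has_field_derivative
            Ln (of_nat n) * of_nat n powr (-s) * (-1)) (at s)"
      by (rule DERIV_chain2[OF has_field_derivative_powr_right]) (use False in \<open>auto intro!: derivative_eq_intros\<close>)
    from DERIV_cmult[OF this, of "of_real (a n)"] show ?thesis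
      unfolding f_def f'_def using False by (simp add: Ln_of_nat mult_ac)
  qed (auto simp: f_def f'_def)
  have "\<exists>g g'. \<forall>x \<in> ?S. ((\<lambda>n. f n x) sums g x) \<and> ((\<lambda>n. f' n x) sums g' x) \<and> (g has_field_derivative g' x) (at x)"
  proof (rule series_and_derivative_comparison_complex[where f = f and f' = f' and S = ?S])
    show "open ?S" by (rule open_Re_gt)
    show "(f n has_field_derivative f' n x) (at x)" if "x \<in> ?S" for n x by (rule der[OF that])
    fix x assume "x \<in> ?S"
    then have x: "Re x > 1" by simp
    define \<sigma> where "\<sigma> = (1 + Re x) / 2"
    have \<sigma>: "\<sigma> > 1" "\<sigma> < Re x" using x by (auto simp: \<sigma>_def)
    define h where "h = (\<lambda>n. complex_of_real (\<bar>a n\<bar> * real n powr (-\<sigma>)))"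
    have "summable h"
      unfolding h_def summable_complex_of_real using assms(1) \<sigma> by (auto simp: dirichlet_abs_conv_def)
    moreover have "range h \<subseteq> \<real>\<^sub>\<ge>\<^sub>0" by (auto simp: h_def)
    moreover have "cmod (f n y) \<le> cmod (h n)" if "y \<in> ball x (Re x - \<sigma>) \<inter> ?S" for n y
    proof -
      have "\<bar>Re (x - y)\<bar> < Re x - \<sigma>" using that abs_Re_le_cmod[of "x-y"]
        by (auto simp: dist_norm)
      then have "Re y > \<sigma>" by simp
      then have "real n powr (-Re y) \<le> real n powr (-\<sigma>)"
        by (cases "n = 0") (auto intro!: powr_mono)
      then show ?thesis
        by (auto simp: f_def h_def norm_mult norm_of_nat_powr abs_mult intro!: mult_left_mono)
    qed
    ultimately show "\<exists>d h. 0 < d \<and> summable h \<and> range h \<subseteq> \<real>\<^sub>\<ge>\<^sub>0 \<and> (\<forall>\<^sub>F n in sequentially. \<forall>y\<in>ball x d \<inter> ?S. cmod(f n y) \<le> cmod (h n))"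
      using \<sigma> by (intro exI[of _ "Re x - \<sigma>"] exI[of _ h]) auto
  qed
  then obtain g g' where gg: "\<And>x. Re x > 1 \<Longrightarrow> (\<lambda>n. f n x) sums g x"
      "\<And>x. Re x > 1 \<Longrightarrow> (\<lambda>n. f' n x) sums g' x"
      "\<And>x. Re x > 1 \<Longrightarrow> (g has_field_derivative g' x) (at x)" by auto
  have eq: "g x = dirichlet a x" "g' x = dirichlet (\<lambda>n. - ln (real n) * a n) x" if "Re x > 1" for x
    using gg(1,2)[OF that] by (auto simp: sums_iff dirichlet_def f_def f'_def)
  have "(g has_field_derivative dirichlet (\<lambda>n. - ln (real n) * a n) s) (at s)"
    using gg(3)[OF assms(2)] eq assms(2) by simp
  then show ?thesis
    by (rule has_field_derivative_transform_within_open[OF _ open_Re_gt[of 1]]) (use assms eq in auto)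
qed

lemma dirichlet_higher_deriv:
  assumes "dirichlet_abs_conv a" "Re s > 1"
  shows "(deriv ^^ k) (dirichlet a) s = dirichlet (\<lambda>n. (- ln (real n)) ^ k * a n) s"
  using assms(2)
proof (induction k arbitrary: s)
  case (Suc k)
  have c: "dirichlet_abs_conv (\<lambda>n. (- ln (real n)) ^ k * a n)"
    by (rule dirichlet_abs_conv_comparison[OF dirichlet_abs_conv_power_ln[OF assms(1), of k], of _ 1])
       (simp add: abs_mult power_abs)
  have "((deriv ^^ k) (dirichlet a) has_field_derivative
          dirichlet (\<lambda>n. - ln (real n) * ((- ln (real n)) ^ k * a n)) s) (at s)"
    by (rule has_field_derivative_transform_within_open[OF dirichlet_has_field_derivative[OF c Suc.prems] open_Re_gt[of 1]])
       (use Suc in auto)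
  then show ?case by (auto dest!: DERIV_imp_deriv simp: mult.assoc)
qed simp

lemma dirichlet_diff:
  assumes "dirichlet_abs_conv a" "dirichlet_abs_conv b" "Re s > 1"
  shows "dirichlet (\<lambda>n. a n - b n) s = dirichlet a s - dirichlet b s"
  using sums_diff[OF dirichlet_sums[OF assms(1,3)] dirichlet_sums[OF assms(2,3)]]
  by (simp add: sums_iff dirichlet_def algebra_simps)

lemma dirichlet_abs_conv_mangoldt: "dirichlet_abs_conv mangoldt"
proof (rule dirichlet_abs_conv_comparison[OF dirichlet_abs_conv_ln[OF dirichlet_abs_conv_one]])
  fix n :: nat
  show "\<bar>mangoldt n\<bar> \<le> 1 * \<bar>ln (real n) * 1\<bar>"
    using mangoldt_le[of n] by (cases "n = 0") (auto intro: order_trans[OF _ abs_ge_self])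
qed

lemma dirichlet_has_sum:
  assumes "dirichlet_abs_conv a" "Re s > 1"
  shows "((\<lambda>n. of_real (a n) * (of_nat n :: complex) powr (-s)) has_sum dirichlet a s) {1..}"
proof -
  have "((\<lambda>n. of_real (a n) * (of_nat n :: complex) powr (-s)) has_sum dirichlet a s) UNIV"
    by (rule norm_summable_imp_has_sum[OF dirichlet_summable[OF assms] dirichlet_sums[OF assms]])
  then show ?thesis
    by (rule has_sum_cong_neutral[THEN iffD1, rotated -1]) (auto simp: not_le)
qed

section \<open>Multiplication of Dirichlet series and the convolution identity for
  \<open>mangoldt\<close>\<close>

lemma has_sum_product_abs:
  fixes x y :: "nat \<Rightarrow> complex"
  assumes "(x has_sum X) A" "(y has_sum Y) B"
    and "(\<lambda>i. norm (x i)) summable_on A" "(\<lambda>i. norm (y i)) summable_on B"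
  shows "((\<lambda>(i,j). x i * y j) has_sum (X * Y)) (A \<times> B)"
proof (rule has_sum_SigmaI)
  show "((\<lambda>j. case (i, j) of (i, j) \<Rightarrow> x i * y j) has_sum x i * Y) B" for i
    using has_sum_cmult_right[OF assms(2)] by simp
  show "((\<lambda>i. x i * Y) has_sum X * Y) A"
    by (rule has_sum_cmult_left[OF assms(1)])
  have "(\<lambda>(i,j). norm (x i) * norm (y j)) summable_on (A \<times> B)"
  proof (rule summable_on_SigmaI)
    show "((\<lambda>j. case (i, j) of (i, j) \<Rightarrow> norm (x i) * norm (y j)) has_sum norm (x i) * infsum (\<lambda>j. norm (y j)) B) B" for i
      using has_sum_cmult_right[OF has_sum_infsum[OF assms(4)]] by simp
    show "(\<lambda>i. norm (x i) * infsum (\<lambda>j. norm (y j)) B) summable_on A"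
      by (rule summable_on_cmult_left[OF assms(3)])
  qed auto
  then have "(\<lambda>p. norm (case p of (i,j) \<Rightarrow> x i * y j)) summable_on (A \<times> B)"
    by (simp add: case_prod_unfold norm_mult)
  then show "(\<lambda>(i,j). x i * y j) summable_on (A \<times> B)"
    by (rule abs_summable_summable)
qed

lemma dirichlet_summable_on:
  assumes "dirichlet_abs_conv a" "Re s > 1"
  shows "(\<lambda>n. norm (of_real (a n) * (of_nat n :: complex) powr (-s))) summable_on A"
  by (rule summable_on_subset_banach[where A = UNIV])
     (use dirichlet_summable[OF assms] in \<open>auto intro!: summable_nonneg_imp_summable_on\<close>)

text \<open>Expanding the product gives a double sum over (d, e); collecting it by n = d e leaves
  the divisor sum of \<open>mangoldt\<close>, which is ln n.\<close>

lemma dirichlet_mangoldt_mult_zeta: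
  assumes s: "Re s > 1"
  shows "dirichlet mangoldt s * dirichlet (\<lambda>_. 1) s = dirichlet (\<lambda>n. ln (real n)) s"
proof -
  define L where "L = dirichlet mangoldt s * dirichlet (\<lambda>_. 1) s"
  define u where "u = (\<lambda>n. (of_nat n :: complex) powr (-s))"
  have cl: "dirichlet_abs_conv (\<lambda>n. ln (real n))"
    using dirichlet_abs_conv_ln[OF dirichlet_abs_conv_one] by simp
  have "((\<lambda>(i,j). of_real (mangoldt i) * u i * (of_real 1 * u j)) has_sum L) ({1..} \<times> {1..})"
    unfolding u_def L_def
    by (intro has_sum_product_abs dirichlet_has_sum dirichlet_summable_on dirichlet_abs_conv_mangoldt
          dirichlet_abs_conv_one s)
  moreover have "((\<lambda>(i,j). of_real (mangoldt i) * u i * (of_real 1 * u j)) has_sum L) ({1..} \<times> {1..}) \<longleftrightarrow>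
     ((\<lambda>(n,d). of_real (mangoldt d) * u n) has_sum L) (SIGMA n:{1..}. {d. d dvd n})"
    by (rule has_sum_reindex_bij_witness[where j = "\<lambda>(d,e). (d * e, d)" and i = "\<lambda>(n,d). (d, n div d)"])
       (auto simp: u_def powr_times_real dvd_div_mult_self Suc_le_eq elim!: dvdE)
  ultimately have "((\<lambda>(n,d). of_real (mangoldt d) * u n) has_sum L) (SIGMA n:{1..}. {d. d dvd n})"
    by simp
  then have "((\<lambda>n. of_real (ln (real n)) * u n) has_sum L) {1..}"
  proof (rule has_sum_Sigma')
    fix n :: nat assume n: "n \<in> {1..}"
    then have "finite {d. d dvd n}" by auto
    moreover have "(\<Sum>d | d dvd n. of_real (mangoldt d) * u n) = of_real (ln (real n)) * u n"
      using mangoldt_sum[of n, where ?'a = complex] n by (simp add: sum_distrib_right[symmetric])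
    ultimately show "((\<lambda>d. case (n, d) of (n, d) \<Rightarrow> of_real (mangoldt d) * u n) has_sum of_real (ln (real n)) * u n) {d. d dvd n}"
      by (auto intro!: has_sum_finiteI)
  qed
  moreover have "((\<lambda>n. of_real (ln (real n)) * u n) has_sum dirichlet (\<lambda>n. ln (real n)) s) {1..}"
    unfolding u_def by (rule dirichlet_has_sum[OF cl s])
  ultimately show ?thesis unfolding L_def by (rule has_sum_unique)
qed

section \<open>Estimates for the single terms of the continuation of zeta\<close>

text \<open>(s - 1) times the difference of n^-s and the integral of x^-s over [n, n + 1], with the
  integral evaluated. At s = 1 it is 0 for n \<ge> 1.\<close>

definition zeta_term :: "nat \<Rightarrow> complex \<Rightarrow> complex" where
  "zeta_term n s = (s - 1) * of_nat n powr (-s) - of_nat n powr (1 - s) + of_nat (Suc n) powr (1 - s)"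

text \<open>Mean value inequality for z powr -s along the real segment from n to x, embedded in the
  plane as \<open>?S\<close>; the bound for the derivative is largest at the left end.\<close>

lemma norm_powr_diff_le:
  fixes s :: complex
  assumes n: "n \<ge> 1" and x: "real n \<le> x" and s: "Re s \<ge> 0"
  shows "norm (of_nat n powr (-s) - of_real x powr (-s)) \<le> norm s * real n powr (- Re s - 1) * (x - n)"
proof -
  let ?S = "complex_of_real ` {real n..x}"
  have "norm ((\<lambda>z. z powr (-s)) (of_real (real n)) - (\<lambda>z. z powr (-s)) (of_real x))
          \<le> (norm s * real n powr (- Re s - 1)) * norm (complex_of_real (real n) - of_real x)"
  proof (rule field_differentiable_bound[where S = ?S])
    show "convex ?S"
      by (intro convex_linear_image convex_real_interval) (auto simp: linear_iff scaleR_conv_of_real)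
    show "complex_of_real (real n) \<in> ?S" "complex_of_real x \<in> ?S" by (rule imageI, use x in simp)+
    fix z assume "z \<in> ?S"
    then obtain y where y: "z = of_real y" "real n \<le> y" "y \<le> x" by auto
    have "y > 0" using y n by simp
    show "((\<lambda>z. z powr (-s)) has_field_derivative (-s) * z powr (-s - 1)) (at z within ?S)"
      unfolding y(1) by (rule has_field_derivative_at_within[OF has_field_derivative_powr])
        (use \<open>y > 0\<close> in \<open>auto simp: complex_nonpos_Reals_iff\<close>)
    have "norm (z powr (-s - 1)) = y powr (- Re s - 1)"
      using norm_powr_real_powr[of z "-s-1"] \<open>y > 0\<close> y by simp
    also have "\<dots> \<le> real n powr (- Re s - 1)"
      using y n s by (intro powr_mono2') auto
    finally show "norm ((-s) * z powr (-s - 1)) \<le> norm s * real n powr (- Re s - 1)"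
      by (simp add: norm_mult mult_left_mono)
  qed
  moreover have "norm (complex_of_real (real n) - of_real x) = x - n"
    using x by (metis abs_of_nonpos diff_le_0_iff_le minus_diff_eq norm_of_real of_real_diff)
  ultimately show ?thesis by simp
qed

text \<open>Interpolates between the trivial bound 2 n^(-Re s) and the mean value bound (|s| / n)
  n^(-Re s), because the minimum of 1 and t is at most t^\<theta>. This limits the growth in s to
  |s|^\<theta>.\<close>

lemma norm_powr_diff_le':
  fixes s :: complex
  assumes n: "n \<ge> 1" and x: "real n \<le> x" "x \<le> real n + 1" and s: "Re s \<ge> 0" and \<theta>: "0 \<le> \<theta>" "\<theta> \<le> 1"
  shows "norm (of_nat n powr (-s) - of_real x powr (-s)) \<le> 2 * norm s powr \<theta> * real n powr (- Re s - \<theta>)"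
proof (cases "norm s \<le> n")
  case True
  have "norm (of_nat n powr (-s) - of_real x powr (-s)) \<le> norm s * real n powr (- Re s - 1) * 1"
    by (rule order_trans[OF norm_powr_diff_le[OF n x(1) s]]) (use x in \<open>intro mult_left_mono; simp\<close>)
  also have "\<dots> = (norm s / n) * real n powr (- Re s)"
    using n by (simp add: powr_diff)
  also have "norm s / n \<le> (norm s / n) powr \<theta>"
    using powr_mono'[of \<theta> 1 "norm s / n"] True n \<theta> by (cases "s = 0") auto
  also have "(norm s / n) powr \<theta> * real n powr (- Re s) = norm s powr \<theta> * real n powr (- Re s - \<theta>)"
    using n by (simp add: powr_divide powr_diff)
  also have "\<dots> \<le> 2 * norm s powr \<theta> * real n powr (- Re s - \<theta>)"
    by (simp add: mult_right_mono)
  finally show ?thesis by (auto simp: mult_right_mono)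
next
  case False
  have "norm (of_nat n powr (-s) - of_real x powr (-s)) \<le> real n powr (- Re s) + x powr (- Re s)"
    by (rule order_trans[OF norm_triangle_ineq4])
       (use n x norm_powr_real_powr[of "of_real x" "-s"] in \<open>auto simp: norm_of_nat_powr\<close>)
  also have "x powr (- Re s) \<le> real n powr (- Re s)"
    using x n s by (intro powr_mono2') auto
  also have "real n powr (- Re s) + real n powr (- Re s) = 2 * 1 * real n powr (- Re s)" by simp
  also have "\<dots> \<le> 2 * (norm s / n) powr \<theta> * real n powr (- Re s)"
    using False n \<theta> by (intro mult_right_mono mult_left_mono ge_one_powr_ge_zero) (auto simp: field_simps)
  also have "\<dots> = 2 * norm s powr \<theta> * real n powr (- Re s - \<theta>)"
    using n by (simp add: powr_divide powr_diff)
  finally show ?thesis by simp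
qed

text \<open>As a function of the upper end z of the integral, \<open>h\<close> is 0 at n, equals
  \<open>zeta_term n s\<close> at n + 1 and has derivative (s - 1) (n^-s - z^-s), so one more mean
  value argument suffices.\<close>

lemma norm_zeta_term_le:
  assumes n: "n \<ge> 1" and s: "Re s \<ge> 0" and \<theta>: "0 \<le> \<theta>" "\<theta> \<le> 1"
  shows "norm (zeta_term n s) \<le> 2 * norm (s - 1) * norm s powr \<theta> * real n powr (- Re s - \<theta>)"
proof -
  define h where "h = (\<lambda>z. (s - 1) * of_nat n powr (-s) * (z - of_nat n) - of_nat n powr (1 - s) + z powr (1 - s))"
  let ?S = "complex_of_real ` {real n..real n + 1}"
  have h0: "h (of_real (real n)) = 0" by (simp add: h_def)
  have h1: "h (of_real (real n + 1)) = zeta_term n s"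
    by (simp add: h_def zeta_term_def add.commute)
  have "norm (h (of_real (real n + 1)) - h (of_real (real n)))
         \<le> (2 * norm (s - 1) * norm s powr \<theta> * real n powr (- Re s - \<theta>)) * norm (complex_of_real (real n + 1) - of_real (real n))"
  proof (rule field_differentiable_bound[where S = ?S])
    show "convex ?S"
      by (intro convex_linear_image convex_real_interval) (auto simp: linear_iff scaleR_conv_of_real)
    show "complex_of_real (real n) \<in> ?S" "complex_of_real (real n + 1) \<in> ?S" by (rule imageI, simp)+
    fix z assume "z \<in> ?S"
    then obtain y where y: "z = of_real y" "real n \<le> y" "y \<le> real n + 1" by auto
    have "y > 0" using y n by simp
    have "(h has_field_derivative (s - 1) * of_nat n powr (-s) + (1 - s) * z powr (1 - s - 1)) (at z within ?S)"
      unfolding h_def y(1)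
      by (rule derivative_eq_intros refl has_field_derivative_at_within[OF has_field_derivative_powr] | simp)+
         (use \<open>y > 0\<close> in \<open>auto simp: complex_nonpos_Reals_iff\<close>)
    then show "(h has_field_derivative (s - 1) * (of_nat n powr (-s) - z powr (-s))) (at z within ?S)"
      by (simp add: algebra_simps)
    show "norm ((s - 1) * (of_nat n powr (-s) - z powr (-s))) \<le> 2 * norm (s - 1) * norm s powr \<theta> * real n powr (- Re s - \<theta>)"
      unfolding norm_mult y(1)
      using mult_left_mono[OF norm_powr_diff_le'[OF n y(2,3) s \<theta>], of "norm (s - 1)"] by (simp add: mult_ac)
  qed
  also have "norm (complex_of_real (real n + 1) - of_real (real n)) = 1" by simp
  finally show ?thesis by (simp only: h0 h1 diff_0_right mult_1_right)
qed

section \<open>Zeta near the line Re s = 1\<close>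

text \<open>This is \<open>(s - 1) * zeta s\<close>: multiplying the terms \<open>n powr -s - integral {n..n+1} (\<lambda>x. x powr -s)\<close>
  by \<open>s - 1\<close> makes them entire, so that no singularity has to be removed.\<close>

definition reg_zeta :: "complex \<Rightarrow> complex" where
  "reg_zeta s = 1 + (\<Sum>n. zeta_term (Suc n) s)"

lemma summable_Suc_powr:
  assumes "\<sigma> > 1"
  shows "summable (\<lambda>n. real (Suc n) powr (-\<sigma>))"
proof -
  have "summable (\<lambda>n. real n powr (-\<sigma>))"
    using assms by (simp add: summable_real_powr_iff)
  then show ?thesis by (rule summable_Suc_iff[THEN iffD2])
qed

text \<open>With \<theta> = 2 \<eta> the decay exponent Re s + 2 \<eta> is at least 1 + \<eta>:
  summability to the left of Re s = 1 is bought with the factor |s|^(2 \<eta>).\<close>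

lemma norm_zeta_term_Suc_le:
  assumes "\<eta> > 0" "\<eta> \<le> 1/2" "Re s \<ge> 1 - \<eta>"
  shows "norm (zeta_term (Suc n) s) \<le> 2 * norm (s - 1) * norm s powr (2 * \<eta>) * real (Suc n) powr (- (1 + \<eta>))"
proof -
  have "norm (zeta_term (Suc n) s) \<le> 2 * norm (s - 1) * norm s powr (2 * \<eta>) * real (Suc n) powr (- Re s - 2 * \<eta>)"
    using assms by (intro norm_zeta_term_le) auto
  also have "\<dots> \<le> 2 * norm (s - 1) * norm s powr (2 * \<eta>) * real (Suc n) powr (- (1 + \<eta>))"
    using assms by (intro mult_left_mono powr_mono) auto
  finally show ?thesis .
qed

lemma zeta_term_sums:
  assumes "Re s > 1/2"
  shows "(\<lambda>n. zeta_term (Suc n) s) sums (reg_zeta s - 1)"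
proof -
  have "summable (\<lambda>n. zeta_term (Suc n) s)"
  proof (rule summable_comparison_test')
    show "summable (\<lambda>n. 2 * norm (s - 1) * norm s powr (2 * (1/2)) * real (Suc n) powr (- (1 + 1/2)))"
      by (intro summable_mult summable_Suc_powr) auto
  qed (use norm_zeta_term_Suc_le[of "1/2" s] assms in auto)
  then show ?thesis by (simp add: reg_zeta_def summable_sums)
qed

lemma reg_zeta_growth:
  assumes "\<eta> > 0" "\<eta> \<le> 1/4"
  shows "\<exists>C>0. \<forall>s. Re s \<ge> 1 - \<eta> \<longrightarrow> norm (reg_zeta s) \<le> 1 + C * norm (s - 1) * norm s powr (2 * \<eta>)"
proof -
  define S where "S = (\<Sum>n. real (Suc n) powr (- (1 + \<eta>)))"
  have sm: "summable (\<lambda>n. real (Suc n) powr (- (1 + \<eta>)))"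
    using assms by (intro summable_Suc_powr) auto
  have "S > 0" unfolding S_def by (rule suminf_pos[OF sm]) auto
  show ?thesis
  proof (intro exI[of _ "2 * S"] conjI allI impI)
    fix s assume s: "Re s \<ge> 1 - \<eta>"
    have 1: "Re s > 1/2" using s assms by simp
    have "norm (reg_zeta s - 1) = norm (\<Sum>n. zeta_term (Suc n) s)" by (simp add: reg_zeta_def)
    also have "\<dots> \<le> (\<Sum>n. 2 * norm (s - 1) * norm s powr (2 * \<eta>) * real (Suc n) powr (- (1 + \<eta>)))"
      by (rule norm_suminf_le[OF norm_zeta_term_Suc_le]) (use assms s sm in \<open>auto intro!: summable_mult\<close>)
    also have "\<dots> = 2 * S * norm (s - 1) * norm s powr (2 * \<eta>)"
      using suminf_mult[OF sm, of "2 * norm (s - 1) * norm s powr (2 * \<eta>)"] by (simp add: S_def mult_ac)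
    finally show "norm (reg_zeta s) \<le> 1 + 2 * S * norm (s - 1) * norm s powr (2 * \<eta>)"
      using norm_triangle_ineq[of "reg_zeta s - 1" 1] by simp
  qed (use \<open>S > 0\<close> in auto)
qed

lemma zeta_term_holomorphic: "n \<ge> 1 \<Longrightarrow> zeta_term n holomorphic_on S"
  unfolding zeta_term_def by (auto intro!: holomorphic_intros)

text \<open>M-test on balls of radius 1: in the term bound for \<eta> = 1/2, replacing |y| and |y -
  1| by R and R + 1 gives a majorant independent of y.\<close>

lemma reg_zeta_holomorphic: "reg_zeta holomorphic_on {s. Re s > 1/2}"
proof -
  let ?S = "{s. Re s > 1/2}"
  obtain g where g: "\<forall>x \<in> ?S. ((\<lambda>n. zeta_term (Suc n) x) sums g x) \<and> g field_differentiable (at x)"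
  proof (rule series_differentiable_comparison_complex[where S = ?S and f = "\<lambda>n. zeta_term (Suc n)"])
    show "open ?S" by (rule open_Re_gt)
    show "zeta_term (Suc n) field_differentiable at x" for n x
      using zeta_term_holomorphic[of "Suc n" UNIV] by (simp add: holomorphic_on_def)
    fix x assume "x \<in> ?S"
    define R where "R = norm x + 1"
    define h where "h = (\<lambda>n. complex_of_real (2 * (R + 1) * R powr (2 * (1/2)) * real (Suc n) powr (- (1 + 1/2))))"
    have "summable h" unfolding h_def summable_complex_of_real
      by (intro summable_mult summable_Suc_powr) auto
    moreover have "range h \<subseteq> \<real>\<^sub>\<ge>\<^sub>0" by (auto simp: h_def R_def)
    moreover have "cmod (zeta_term (Suc n) y) \<le> cmod (h n)" if "y \<in> ball x 1 \<inter> ?S" for n y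
    proof -
      have y: "norm y \<le> R" "norm (y - 1) \<le> R + 1" using that norm_triangle_ineq2[of y x] norm_triangle_ineq4[of y 1]
        by (auto simp: R_def dist_norm norm_minus_commute)
      have "cmod (zeta_term (Suc n) y) \<le> 2 * norm (y - 1) * norm y powr (2 * (1/2)) * real (Suc n) powr (- (1 + 1/2))"
        using that by (intro norm_zeta_term_Suc_le) auto
      also have "\<dots> \<le> 2 * (R + 1) * R powr (2 * (1/2)) * real (Suc n) powr (- (1 + 1/2))"
        using y by (intro mult_right_mono mult_mono powr_mono2) (auto simp: R_def)
      also have "\<dots> \<le> cmod (h n)" unfolding h_def norm_of_real by (rule abs_ge_self)
      finally show ?thesis .
    qed
    ultimately show "\<exists>d h. 0 < d \<and> summable h \<and> range h \<subseteq> \<real>\<^sub>\<ge>\<^sub>0 \<and> (\<forall>\<^sub>F n in sequentially. \<forall>y\<in>ball x d \<inter> ?S. cmod (zeta_term (Suc n) y) \<le> cmod (h n))"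
      by (intro exI[of _ 1] exI[of _ h]) auto
  qed
  then have "(\<lambda>s. 1 + g s) holomorphic_on ?S"
    by (intro holomorphic_intros) (auto simp: holomorphic_on_def intro: field_differentiable_at_within)
  then show ?thesis
  proof (rule holomorphic_transform)
    fix x assume "x \<in> ?S"
    then show "1 + g x = reg_zeta x" using g by (auto simp: reg_zeta_def sums_iff)
  qed
qed

lemma reg_zeta_1 [simp]: "reg_zeta 1 = 1"
  by (simp add: reg_zeta_def zeta_term_def del: of_nat_Suc)

text \<open>The integral parts telescope, with n^(1 - s) tending to 0 as Re s > 1; their sum -1
  cancels the summand 1 in \<open>reg_zeta\<close>.\<close>

lemma reg_zeta_eq:
  assumes s: "Re s > 1"
  shows "reg_zeta s = (s - 1) * dirichlet (\<lambda>_. 1) s"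
proof -
  let ?f = "\<lambda>n. (of_nat n :: complex) powr (1 - s)"
  have "(\<lambda>n. of_real 1 * (of_nat n :: complex) powr (-s)) sums dirichlet (\<lambda>_. 1) s"
    by (rule dirichlet_sums[OF dirichlet_abs_conv_one s])
  then have "(\<lambda>n. (of_nat n :: complex) powr (-s)) sums dirichlet (\<lambda>_. 1) s" by simp
  then have "(\<lambda>n. (of_nat (Suc n) :: complex) powr (-s)) sums dirichlet (\<lambda>_. 1) s"
    by (subst sums_Suc_iff) simp
  then have 1: "(\<lambda>n. (s - 1) * (of_nat (Suc n) :: complex) powr (-s)) sums ((s - 1) * dirichlet (\<lambda>_. 1) s)"
    by (rule sums_mult)
  have "(\<lambda>n. norm (?f n)) \<longlonglongrightarrow> 0"
    unfolding norm_of_nat_powr using s by simp real_asymp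
  then have "?f \<longlonglongrightarrow> 0" by (rule tendsto_norm_zero_cancel)
  then have "(\<lambda>n. ?f (Suc n)) \<longlonglongrightarrow> 0" by (rule LIMSEQ_Suc)
  from telescope_sums[OF this]
  have 2: "(\<lambda>n. ?f (Suc (Suc n)) - ?f (Suc n)) sums (0 - ?f (Suc 0))" .
  from sums_add[OF 1 2]
  have "(\<lambda>n. zeta_term (Suc n) s) sums ((s - 1) * dirichlet (\<lambda>_. 1) s - 1)"
    by (simp add: zeta_term_def algebra_simps)
  with zeta_term_sums[of s] s show ?thesis by (auto dest: sums_unique2)
qed

section \<open>The logarithm of zeta and the 3-4-1 inequality\<close>

abbreviation zeta_series :: "complex \<Rightarrow> complex" where
  "zeta_series \<equiv> dirichlet (\<lambda>_. 1)"

text \<open>The coefficients of log zeta: 1/k at a prime power p^k, and 0 elsewhere.\<close>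

definition log_zeta_coeff :: "nat \<Rightarrow> real" where
  "log_zeta_coeff n = mangoldt n / ln (real n)"

lemma log_zeta_coeff_nonneg: "log_zeta_coeff n \<ge> 0"
  by (cases "n = 0") (auto simp: log_zeta_coeff_def mangoldt_nonneg)

lemma ln_mult_log_zeta_coeff: "ln (real n) * log_zeta_coeff n = mangoldt n"
proof -
  consider "n = 0" | "n = 1" | "n > 1" by linarith
  then show ?thesis by cases (auto simp: log_zeta_coeff_def)
qed

lemma dirichlet_abs_conv_log_zeta_coeff: "dirichlet_abs_conv log_zeta_coeff"
proof (rule dirichlet_abs_conv_comparison[OF dirichlet_abs_conv_one])
  fix n :: nat
  have "\<bar>log_zeta_coeff n\<bar> \<le> 1"
  proof (cases "n > 1")
    case True
    then show ?thesis using mangoldt_le[of n] by (simp add: log_zeta_coeff_def)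
  next
    case False
    then have "n = 0 \<or> n = 1" by auto
    then show ?thesis by (auto simp: log_zeta_coeff_def)
  qed
  then show "\<bar>log_zeta_coeff n\<bar> \<le> 1 * \<bar>1\<bar>" by simp
qed

lemma zeta_series_has_field_derivative:
  assumes "Re s > 1"
  shows "(zeta_series has_field_derivative - (dirichlet mangoldt s * zeta_series s)) (at s)"
proof -
  have "dirichlet (\<lambda>n. - ln (real n) * 1) s = - dirichlet (\<lambda>n. ln (real n)) s"
    using sums_minus[OF dirichlet_sums[of "\<lambda>n. ln (real n)" s]] dirichlet_abs_conv_ln[OF dirichlet_abs_conv_one] assms
    by (simp add: sums_iff dirichlet_def)
  with dirichlet_has_field_derivative[OF dirichlet_abs_conv_one assms] dirichlet_mangoldt_mult_zeta[OF assms]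
  show ?thesis by simp
qed

text \<open>The quotient of zeta by the exponential has derivative zero, since both have minus the
  series of \<open>mangoldt\<close> as logarithmic derivative. Nonvanishing for Re s > 1 is thus
  obtained without an Euler product.\<close>

lemma zeta_series_eq_exp:
  "\<exists>c. c \<noteq> 0 \<and> (\<forall>s. Re s > 1 \<longrightarrow> zeta_series s = c * exp (dirichlet log_zeta_coeff s))"
proof -
  let ?E = "dirichlet log_zeta_coeff" and ?S = "{s. Re s > 1}"
  have dE: "(?E has_field_derivative - dirichlet mangoldt s) (at s)" if "Re s > 1" for s
  proof -
    have "dirichlet (\<lambda>n. - ln (real n) * log_zeta_coeff n) s = - dirichlet mangoldt s"
      using sums_minus[OF dirichlet_sums[OF dirichlet_abs_conv_mangoldt that]]
      by (simp add: sums_iff dirichlet_def ln_mult_log_zeta_coeff)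
    with dirichlet_has_field_derivative[OF dirichlet_abs_conv_log_zeta_coeff that] show ?thesis by simp
  qed
  have "\<exists>c. \<forall>s\<in>?S. zeta_series s * exp (- ?E s) = c"
  proof (rule has_field_derivative_zero_constant)
    show "convex ?S" by (rule convex_halfspace_Re_gt)
    fix s assume s: "s \<in> ?S"
    have "((\<lambda>s. zeta_series s * exp (- ?E s)) has_field_derivative
            - (dirichlet mangoldt s * zeta_series s) * exp (- ?E s)
            + exp (- ?E s) * (- (- dirichlet mangoldt s)) * zeta_series s) (at s)"
      using s by (intro DERIV_mult zeta_series_has_field_derivative DERIV_chain2[OF DERIV_exp] DERIV_minus dE) auto
    then show "((\<lambda>s. zeta_series s * exp (- ?E s)) has_field_derivative 0) (at s within ?S)"
      by (simp add: has_field_derivative_at_within algebra_simps)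
  qed
  then obtain c where c: "\<And>s. Re s > 1 \<Longrightarrow> zeta_series s * exp (- ?E s) = c" by auto
  have eq: "zeta_series s = c * exp (?E s)" if "Re s > 1" for s
    using c[OF that] by (auto simp: exp_minus field_simps)
  \<comment> \<open>At s = 2 the real parts of the terms are nonnegative, and the term n = 1 is
    positive.\<close>
  have "c \<noteq> 0"
  proof
    assume "c = 0"
    then have "zeta_series 2 = 0" using eq[of 2] by simp
    with dirichlet_sums[OF dirichlet_abs_conv_one, of 2]
    have "(\<lambda>n. of_real 1 * (of_nat n :: complex) powr (-2)) sums 0" by simp
    from sums_Re[OF this]
    have "(\<lambda>n. Re ((of_nat n :: complex) powr (-2))) sums 0" by simp
    moreover have "Re ((of_nat n :: complex) powr (-2)) = real n powr (-2)" for n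
      using powr_of_real[of "real n" "-2"] by simp
    ultimately have "(\<lambda>n. real n powr (-2)) sums 0" by simp
    moreover from this have "0 < (\<Sum>n. real n powr (-2))"
      by (intro suminf_pos2[where i = 1]) (auto simp: sums_iff)
    ultimately show False by (simp add: sums_iff)
  qed
  then show ?thesis using eq by auto
qed

lemma three_four_one_cos: "3 + 4 * cos x + cos (2 * x) \<ge> (0::real)"
proof -
  have "3 + 4 * cos x + cos (2 * x) = 2 * (1 + cos x)\<^sup>2"
    unfolding cos_double_cos by (simp add: power2_eq_square algebra_simps)
  then show ?thesis by simp
qed

lemma Re_dirichlet_sums:
  assumes "dirichlet_abs_conv a" "\<sigma> > 1"
  shows "(\<lambda>n. a n * real n powr (-\<sigma>) * cos (t * ln (real n))) sums Re (dirichlet a (Complex \<sigma> t))"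
proof -
  have "(\<lambda>n. Re (of_real (a n) * (of_nat n :: complex) powr (- Complex \<sigma> t))) sums Re (dirichlet a (Complex \<sigma> t))"
    by (intro sums_Re dirichlet_sums assms) (use assms in simp)
  moreover have "Re (of_real (a n) * (of_nat n :: complex) powr (- Complex \<sigma> t)) = a n * real n powr (-\<sigma>) * cos (t * ln (real n))" for n
    by (cases "n = 0") (auto simp: powr_def Ln_of_nat Re_exp)
  ultimately show ?thesis by (simp only:)
qed

text \<open>The coefficients of log zeta are nonnegative, so the trigonometric inequality applies
  term by term to the real parts of the logarithms. Each of the 3 + 4 + 1 factors contributes one
  |c|, hence the constant |c|^8.\<close>

lemma zeta_three_four_one:
  "\<exists>c>0. \<forall>\<sigma> t. \<sigma> > 1 \<longrightarrow> c \<le> norm (zeta_series (of_real \<sigma>)) ^ 3 * norm (zeta_series (Complex \<sigma> t)) ^ 4 * norm (zeta_series (Complex \<sigma> (2 * t)))"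
proof -
  obtain c where c: "c \<noteq> 0" "\<And>s. Re s > 1 \<Longrightarrow> zeta_series s = c * exp (dirichlet log_zeta_coeff s)"
    using zeta_series_eq_exp by auto
  show ?thesis
  proof (intro exI[of _ "norm c ^ 8"] conjI allI impI)
    show "norm c ^ 8 > 0" using c by simp
    fix \<sigma> t :: real assume \<sigma>: "\<sigma> > 1"
    let ?E = "\<lambda>t. Re (dirichlet log_zeta_coeff (Complex \<sigma> t))"
    have n: "norm (zeta_series (Complex \<sigma> t)) = norm c * exp (?E t)" for t
      using c(2)[of "Complex \<sigma> t"] \<sigma> by (simp add: norm_mult)
    have "(\<lambda>n. 3 * (log_zeta_coeff n * real n powr (-\<sigma>) * cos (0 * ln (real n)))
           + 4 * (log_zeta_coeff n * real n powr (-\<sigma>) * cos (t * ln (real n)))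
           + log_zeta_coeff n * real n powr (-\<sigma>) * cos (2 * t * ln (real n))) sums (3 * ?E 0 + 4 * ?E t + ?E (2 * t))"
      by (intro sums_add sums_mult Re_dirichlet_sums dirichlet_abs_conv_log_zeta_coeff \<sigma>)
    moreover have "3 * (log_zeta_coeff n * real n powr (-\<sigma>) * cos (0 * ln (real n)))
           + 4 * (log_zeta_coeff n * real n powr (-\<sigma>) * cos (t * ln (real n)))
           + log_zeta_coeff n * real n powr (-\<sigma>) * cos (2 * t * ln (real n)) \<ge> 0" for n
    proof -
      have "0 \<le> (log_zeta_coeff n * real n powr (-\<sigma>)) * (3 + 4 * cos (t * ln (real n)) + cos (2 * (t * ln (real n))))"
        by (intro mult_nonneg_nonneg log_zeta_coeff_nonneg three_four_one_cos) auto
      then show ?thesis by (simp add: algebra_simps)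
    qed
    ultimately have "0 \<le> 3 * ?E 0 + 4 * ?E t + ?E (2 * t)"
      by (rule sums_le[OF _ sums_zero, rotated])
    then have "norm c ^ 8 * 1 \<le> norm c ^ 8 * exp (3 * ?E 0 + 4 * ?E t + ?E (2 * t))"
      by (intro mult_left_mono) auto
    also have "\<dots> = (norm c * exp (?E 0)) ^ 3 * (norm c * exp (?E t)) ^ 4 * (norm c * exp (?E (2 * t)))"
    proof -
      have "exp (3 * ?E 0) = exp (?E 0) ^ 3" "exp (4 * ?E t) = exp (?E t) ^ 4"
        by (simp_all add: exp_of_nat_mult[symmetric])
      then show ?thesis by (simp add: exp_add power_mult_distrib eval_nat_numeral)
    qed
    also have "\<dots> = norm (zeta_series (of_real \<sigma>)) ^ 3 * norm (zeta_series (Complex \<sigma> t)) ^ 4 * norm (zeta_series (Complex \<sigma> (2 * t)))"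
      by (simp only: n[symmetric] complex_of_real_def)
    finally show "norm c ^ 8 \<le> norm (zeta_series (of_real \<sigma>)) ^ 3 * norm (zeta_series (Complex \<sigma> t)) ^ 4 * norm (zeta_series (Complex \<sigma> (2 * t)))"
      by simp
  qed
qed

section \<open>Upper and lower bounds for \<open>reg_zeta\<close> near the line Re s = 1\<close>

text \<open>Away from the real axis and for bounded Re s, both |s| and |s - 1| are at most a
  multiple of |Im s|, and the constant 1 is at most a multiple of its power, so the growth bound
  becomes a pure power of |Im s|.\<close>

lemma reg_zeta_le:
  assumes "\<eta> > 0" "\<eta> \<le> 1/4" "t1 > 0"
  shows "\<exists>C>0. \<forall>s. 1 - \<eta> \<le> Re s \<longrightarrow> Re s \<le> 3 \<longrightarrow> t1 \<le> \<bar>Im s\<bar> \<longrightarrow> norm (reg_zeta s) \<le> C * \<bar>Im s\<bar> powr (1 + 2 * \<eta>)"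
proof -
  obtain C where C: "C > 0" "\<And>s. Re s \<ge> 1 - \<eta> \<Longrightarrow> norm (reg_zeta s) \<le> 1 + C * norm (s - 1) * norm s powr (2 * \<eta>)"
    using reg_zeta_growth[OF assms(1,2)] by auto
  \<comment> \<open>The least constant with 3 + T \<le> K T for all T \<ge> t1.\<close>
  define K where "K = 3 / t1 + 1"
  have K: "K > 0" using assms by (simp add: K_def add_pos_pos)
  define D where "D = t1 powr (- (1 + 2 * \<eta>)) + C * K * K powr (2 * \<eta>)"
  show ?thesis
  proof (intro exI[of _ D] conjI allI impI)
    show "D > 0" unfolding D_def using assms C K by (intro add_pos_pos) auto
    fix s assume s: "1 - \<eta> \<le> Re s" "Re s \<le> 3" "t1 \<le> \<bar>Im s\<bar>"
    define T where "T = \<bar>Im s\<bar>"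
    have T: "T \<ge> t1" "T > 0" using s assms by (auto simp: T_def)
    have KT: "3 + T \<le> K * T" using T assms by (simp add: K_def field_simps)
    have n1: "norm s \<le> K * T" using cmod_le[of s] s assms KT by (simp add: T_def)
    have n2: "norm (s - 1) \<le> K * T" using cmod_le[of "s - 1"] s assms KT by (simp add: T_def)
    have "1 = t1 powr (- (1 + 2 * \<eta>)) * t1 powr (1 + 2 * \<eta>)" using assms by (simp flip: powr_add)
    also have "\<dots> \<le> t1 powr (- (1 + 2 * \<eta>)) * T powr (1 + 2 * \<eta>)"
      using T assms by (intro mult_left_mono powr_mono2) auto
    finally have a: "1 \<le> t1 powr (- (1 + 2 * \<eta>)) * T powr (1 + 2 * \<eta>)" .
    have "C * norm (s - 1) * norm s powr (2 * \<eta>) \<le> C * (K * T) * (K * T) powr (2 * \<eta>)"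
      using n1 n2 C K T assms by (intro mult_mono powr_mono2) auto
    also have "\<dots> = C * K * K powr (2 * \<eta>) * T powr (1 + 2 * \<eta>)"
      using K T by (simp add: powr_mult powr_add)
    finally have "norm (reg_zeta s) \<le> t1 powr (- (1 + 2 * \<eta>)) * T powr (1 + 2 * \<eta>) + C * K * K powr (2 * \<eta>) * T powr (1 + 2 * \<eta>)"
      using C(2)[OF s(1)] a by linarith
    then show "norm (reg_zeta s) \<le> D * \<bar>Im s\<bar> powr (1 + 2 * \<eta>)"
      by (simp add: D_def T_def algebra_simps)
  qed
qed

text \<open>Cauchy's estimate on a circle that stays in the region of \<open>reg_zeta_le\<close> for
  t1 / 2; on it |Im x| is at most 2 |Im s|.\<close>

lemma reg_zeta_deriv_le:
  assumes "\<eta> > 0" "\<eta> \<le> 1/4" "t1 > 0"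
  shows "\<exists>C>0. \<forall>s. 1 - \<eta> / 2 \<le> Re s \<longrightarrow> Re s \<le> 2 \<longrightarrow> t1 \<le> \<bar>Im s\<bar> \<longrightarrow> norm (deriv reg_zeta s) \<le> C * \<bar>Im s\<bar> powr (1 + 2 * \<eta>)"
proof -
  obtain C where C: "C > 0" "\<And>s. 1 - \<eta> \<le> Re s \<Longrightarrow> Re s \<le> 3 \<Longrightarrow> t1 / 2 \<le> \<bar>Im s\<bar> \<Longrightarrow> norm (reg_zeta s) \<le> C * \<bar>Im s\<bar> powr (1 + 2 * \<eta>)"
    using reg_zeta_le[OF assms(1,2), of "t1 / 2"] assms(3) by auto
  define \<rho> where "\<rho> = min (\<eta> / 2) (t1 / 2)"
  have \<rho>: "\<rho> > 0" "\<rho> \<le> \<eta> / 2" "\<rho> \<le> t1 / 2" using assms by (auto simp: \<rho>_def)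
  show ?thesis
  proof (intro exI[of _ "C * 2 powr (1 + 2 * \<eta>) / \<rho>"] conjI allI impI)
    show "C * 2 powr (1 + 2 * \<eta>) / \<rho> > 0" using C \<rho> by simp
    fix s assume s: "1 - \<eta> / 2 \<le> Re s" "Re s \<le> 2" "t1 \<le> \<bar>Im s\<bar>"
    have near: "1 - \<eta> \<le> Re x \<and> Re x \<le> 3 \<and> t1 / 2 \<le> \<bar>Im x\<bar> \<and> \<bar>Im x\<bar> \<le> 2 * \<bar>Im s\<bar>" if "norm (s - x) \<le> \<rho>" for x
    proof -
      have "\<bar>Re (s - x)\<bar> \<le> \<rho>" "\<bar>Im (s - x)\<bar> \<le> \<rho>"
        using that abs_Re_le_cmod[of "s - x"] abs_Im_le_cmod[of "s - x"] by linarith+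
      then show ?thesis using s \<rho> assms by auto
    qed
    have "cball s \<rho> \<subseteq> {s. Re s > 1/2}" using near assms by (force simp: dist_norm)
    then have hol: "reg_zeta holomorphic_on cball s \<rho>" using reg_zeta_holomorphic holomorphic_on_subset by blast
    have "norm ((deriv ^^ 1) reg_zeta s) \<le> fact 1 * (C * (2 * \<bar>Im s\<bar>) powr (1 + 2 * \<eta>)) / \<rho> ^ 1"
    proof (rule Cauchy_inequality)
      show "reg_zeta holomorphic_on ball s \<rho>" using hol holomorphic_on_subset by auto
      show "continuous_on (cball s \<rho>) reg_zeta" using hol by (rule holomorphic_on_imp_continuous_on)
      fix x assume "norm (s - x) = \<rho>"
      then have x: "1 - \<eta> \<le> Re x" "Re x \<le> 3" "t1 / 2 \<le> \<bar>Im x\<bar>" "\<bar>Im x\<bar> \<le> 2 * \<bar>Im s\<bar>" using near[of x] by auto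
      have "norm (reg_zeta x) \<le> C * \<bar>Im x\<bar> powr (1 + 2 * \<eta>)" by (rule C(2)[OF x(1-3)])
      also have "\<dots> \<le> C * (2 * \<bar>Im s\<bar>) powr (1 + 2 * \<eta>)"
        using C x assms by (intro mult_left_mono powr_mono2) auto
      finally show "norm (reg_zeta x) \<le> C * (2 * \<bar>Im s\<bar>) powr (1 + 2 * \<eta>)" .
    qed (use \<rho> in auto)
    then show "norm (deriv reg_zeta s) \<le> C * 2 powr (1 + 2 * \<eta>) / \<rho> * \<bar>Im s\<bar> powr (1 + 2 * \<eta>)"
      by (simp add: powr_mult)
  qed
qed

text \<open>The 3-4-1 inequality solved for the middle factor. With zeta(\<sigma>) = O(1 / (\<sigma>
  - 1)) and zeta(\<sigma> + 2it) = O(T^(2 \<eta>)), the fourth root leaves (\<sigma> - 1)^(3/4)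
  T^(-\<eta>/2); passing from zeta to \<open>reg_zeta\<close> gains |s - 1| \<ge> T.\<close>

lemma reg_zeta_lower_right:
  assumes "\<eta> > 0" "\<eta> \<le> 1/4" "t1 > 0"
  shows "\<exists>c>0. \<forall>s. 1 < Re s \<longrightarrow> Re s \<le> 2 \<longrightarrow> t1 \<le> \<bar>Im s\<bar> \<longrightarrow>
           c * (Re s - 1) powr (3/4) * \<bar>Im s\<bar> powr (1 - \<eta> / 2) \<le> norm (reg_zeta s)"
proof -
  obtain c0 where c0: "c0 > 0" "\<And>\<sigma> t. \<sigma> > 1 \<Longrightarrow> c0 \<le> norm (zeta_series (of_real \<sigma>)) ^ 3 * norm (zeta_series (Complex \<sigma> t)) ^ 4 * norm (zeta_series (Complex \<sigma> (2 * t)))"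
    using zeta_three_four_one by auto
  obtain C where C: "C > 0" "\<And>s. Re s \<ge> 1 - \<eta> \<Longrightarrow> norm (reg_zeta s) \<le> 1 + C * norm (s - 1) * norm s powr (2 * \<eta>)"
    using reg_zeta_growth[OF assms(1,2)] by auto
  obtain D where D: "D > 0" "\<And>s. 1 - \<eta> \<le> Re s \<Longrightarrow> Re s \<le> 3 \<Longrightarrow> t1 \<le> \<bar>Im s\<bar> \<Longrightarrow> norm (reg_zeta s) \<le> D * \<bar>Im s\<bar> powr (1 + 2 * \<eta>)"
    using reg_zeta_le[OF assms] by auto
  define E where "E = 1 + C * 2 powr (2 * \<eta>)"
  have E: "E > 0" using C by (simp add: E_def add_pos_pos)
  define G where "G = E ^ 3 * (D * 2 powr (2 * \<eta>))"
  have G: "G > 0" using E D by (simp add: G_def)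
  define c where "c = (c0 / G) powr (1/4)"
  have c: "c > 0" "c ^ 4 = c0 / G" using c0 G by (auto simp: c_def powr_power)
  show ?thesis
  proof (intro exI[of _ c] conjI allI impI c(1))
    fix s assume s: "1 < Re s" "Re s \<le> 2" "t1 \<le> \<bar>Im s\<bar>"
    define \<sigma> t where "\<sigma> = Re s" "t = Im s"
    define T where "T = \<bar>t\<bar>"
    have st: "s = Complex \<sigma> t" "\<sigma> > 1" "\<sigma> \<le> 2" "T \<ge> t1" "T > 0" using s assms by (auto simp: \<sigma>_t_def T_def)
    have "norm (reg_zeta (of_real \<sigma>)) \<le> 1 + C * norm (complex_of_real \<sigma> - 1) * norm (complex_of_real \<sigma>) powr (2 * \<eta>)"
      using C(2)[of "of_real \<sigma>"] st assms by simp
    also have "norm (complex_of_real \<sigma> - 1) = \<sigma> - 1"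
      using st by (metis abs_of_pos diff_gt_0_iff_gt norm_of_real of_real_1 of_real_diff)
    also have "1 + C * (\<sigma> - 1) * norm (complex_of_real \<sigma>) powr (2 * \<eta>) \<le> 1 + C * 1 * 2 powr (2 * \<eta>)"
      using st C assms by (intro add_left_mono mult_mono powr_mono2) auto
    finally have z1: "norm (reg_zeta (of_real \<sigma>)) \<le> E" by (simp add: E_def)
    have "norm (reg_zeta (of_real \<sigma>)) = (\<sigma> - 1) * norm (zeta_series (of_real \<sigma>))"
      using reg_zeta_eq[of "of_real \<sigma>"] st \<open>norm (complex_of_real \<sigma> - 1) = \<sigma> - 1\<close> by (simp add: norm_mult)
    with z1 have z1': "norm (zeta_series (of_real \<sigma>)) \<le> E / (\<sigma> - 1)" using st by (simp add: field_simps)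
    have "norm (reg_zeta (Complex \<sigma> (2 * t))) \<le> D * (2 * T) powr (1 + 2 * \<eta>)"
      using D(2)[of "Complex \<sigma> (2 * t)"] st assms by (auto simp: T_def abs_mult)
    moreover have "2 * T * norm (zeta_series (Complex \<sigma> (2 * t))) \<le> norm (reg_zeta (Complex \<sigma> (2 * t)))"
      using reg_zeta_eq[of "Complex \<sigma> (2 * t)"] st abs_Im_le_cmod[of "Complex \<sigma> (2 * t) - 1"]
      by (auto simp: norm_mult T_def abs_mult intro!: mult_right_mono)
    moreover have "D * (2 * T) powr (1 + 2 * \<eta>) = 2 * T * (D * (2 * T) powr (2 * \<eta>))"
      using st by (simp add: powr_add)
    ultimately have "2 * T * norm (zeta_series (Complex \<sigma> (2 * t))) \<le> 2 * T * (D * (2 * T) powr (2 * \<eta>))"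
      by linarith
    then have "norm (zeta_series (Complex \<sigma> (2 * t))) \<le> D * (2 * T) powr (2 * \<eta>)"
      by (rule mult_left_le_imp_le) (use st in simp)
    then have z3: "norm (zeta_series (Complex \<sigma> (2 * t))) \<le> D * 2 powr (2 * \<eta>) * T powr (2 * \<eta>)"
      using st by (simp add: powr_mult)
    have z2: "T * norm (zeta_series s) \<le> norm (reg_zeta s)"
      using reg_zeta_eq[of s] st abs_Im_le_cmod[of "s - 1"]
      by (auto simp: norm_mult T_def abs_mult intro!: mult_right_mono)
    have "c0 \<le> norm (zeta_series (of_real \<sigma>)) ^ 3 * norm (zeta_series s) ^ 4 * norm (zeta_series (Complex \<sigma> (2 * t)))"
      using c0(2)[OF st(2), of t] st(1) by simp
    also have "\<dots> \<le> (E / (\<sigma> - 1)) ^ 3 * norm (zeta_series s) ^ 4 * (D * 2 powr (2 * \<eta>) * T powr (2 * \<eta>))"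
      using z1' z3 E st by (intro mult_mono power_mono) auto
    also have "\<dots> = G * norm (zeta_series s) ^ 4 * T powr (2 * \<eta>) / (\<sigma> - 1) ^ 3"
      by (simp add: G_def power_divide)
    finally have *: "c0 * (\<sigma> - 1) ^ 3 \<le> G * norm (zeta_series s) ^ 4 * T powr (2 * \<eta>)"
      using st by (simp add: field_simps)
    have "(c * (\<sigma> - 1) powr (3/4) * T powr (1 - \<eta> / 2)) ^ 4 = c0 / G * (\<sigma> - 1) ^ 3 * T powr (4 - 2 * \<eta>)"
      using st by (simp add: power_mult_distrib c powr_power algebra_simps)
    also have "\<dots> = (c0 * (\<sigma> - 1) ^ 3) * T powr (4 - 2 * \<eta>) / G" by simp
    also have "\<dots> \<le> (G * norm (zeta_series s) ^ 4 * T powr (2 * \<eta>)) * T powr (4 - 2 * \<eta>) / G"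
      using * G by (intro divide_right_mono mult_right_mono) auto
    also have "\<dots> = norm (zeta_series s) ^ 4 * T powr (2 * \<eta> + (4 - 2 * \<eta>))"
      unfolding powr_add using G by simp
    also have "\<dots> = (T * norm (zeta_series s)) ^ 4" using st by (simp add: power_mult_distrib)
    also have "\<dots> \<le> norm (reg_zeta s) ^ 4" using z2 st by (intro power_mono) auto
    finally have "c * (\<sigma> - 1) powr (3/4) * T powr (1 - \<eta> / 2) \<le> norm (reg_zeta s)"
      by (subst (asm) power_mono_iff) (use c(1) in auto)
    then show "c * (Re s - 1) powr (3/4) * \<bar>Im s\<bar> powr (1 - \<eta> / 2) \<le> norm (reg_zeta s)"
      by (simp add: \<sigma>_t_def T_def)
  qed
qed

text \<open>The exponent 10 balances two quantities. On Re s = 1 + \<tau> with \<tau> of order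
  T^(-10 \<eta>) the lower bound has order T^(-7.5 \<eta>) T^(1 - \<eta>/2), and the derivative
  bound times the distance has order T^(1 + 2 \<eta>) T^(-10 \<eta>). Both are T^(1 - 8 \<eta>), so
  only the constants have to be compared.\<close>

lemma reg_zeta_lower:
  assumes "\<eta> > 0" "\<eta> \<le> 1/4" "t1 > 0"
  shows "\<exists>\<kappa> c. \<kappa> > 0 \<and> c > 0 \<and> (\<forall>s. 1 - \<kappa> * \<bar>Im s\<bar> powr (- 10 * \<eta>) \<le> Re s \<longrightarrow> Re s \<le> 2 \<longrightarrow> t1 \<le> \<bar>Im s\<bar> \<longrightarrow>
           c * \<bar>Im s\<bar> powr (1 - 8 * \<eta>) \<le> norm (reg_zeta s))"
proof -
  obtain c2 where c2: "c2 > 0" "\<And>s. 1 < Re s \<Longrightarrow> Re s \<le> 2 \<Longrightarrow> t1 \<le> \<bar>Im s\<bar> \<Longrightarrow>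
           c2 * (Re s - 1) powr (3/4) * \<bar>Im s\<bar> powr (1 - \<eta> / 2) \<le> norm (reg_zeta s)"
    using reg_zeta_lower_right[OF assms] by auto
  obtain D where D: "D > 0" "\<And>s. 1 - \<eta> / 2 \<le> Re s \<Longrightarrow> Re s \<le> 2 \<Longrightarrow> t1 \<le> \<bar>Im s\<bar> \<Longrightarrow> norm (deriv reg_zeta s) \<le> D * \<bar>Im s\<bar> powr (1 + 2 * \<eta>)"
    using reg_zeta_deriv_le[OF assms] by auto
  \<comment> \<open>\<kappa> is so small that going left from the line Re s = 1 + \<tau>, \<tau> = \<kappa> |Im s|^(-10 \<eta>), by at most 2 \<tau>
    costs at most half of the lower bound valid on that line.\<close>
  define \<kappa> where "\<kappa> = min (\<eta> / 2 * t1 powr (10 * \<eta>)) ((c2 / (4 * D)) ^ 4)"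
  have \<kappa>: "\<kappa> > 0" "\<kappa> \<le> \<eta> / 2 * t1 powr (10 * \<eta>)" "\<kappa> \<le> (c2 / (4 * D)) ^ 4"
    using assms c2 D by (auto simp: \<kappa>_def)
  have "\<kappa> powr (1/4) \<le> ((c2 / (4 * D)) ^ 4) powr (1/4)"
    using \<kappa> by (intro powr_mono2) auto
  also have "\<dots> = c2 / (4 * D)" using c2 D by (simp add: powr_powr flip: powr_numeral)
  finally have k4: "\<kappa> powr (1/4) * (4 * D) \<le> c2" using D by (simp add: field_simps)
  have "2 * D * \<kappa> = \<kappa> powr (3/4) * (\<kappa> powr (1/4) * (4 * D)) / 2"
    using \<kappa> by (simp flip: powr_add mult.assoc)
  also have "\<dots> \<le> \<kappa> powr (3/4) * c2 / 2" using k4 by (intro divide_right_mono mult_left_mono) auto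
  finally have k5: "2 * D * \<kappa> \<le> c2 * \<kappa> powr (3/4) / 2" by (simp add: mult.commute)
  show ?thesis
  proof (rule exI[of _ \<kappa>], rule exI[of _ "c2 * \<kappa> powr (3/4) / 2"], intro conjI allI impI)
    fix s assume s: "1 - \<kappa> * \<bar>Im s\<bar> powr (- 10 * \<eta>) \<le> Re s" "Re s \<le> 2" "t1 \<le> \<bar>Im s\<bar>"
    define T where "T = \<bar>Im s\<bar>"
    have T: "T \<ge> t1" "T > 0" using s assms by (auto simp: T_def)
    define \<tau> where "\<tau> = \<kappa> * T powr (- 10 * \<eta>)"
    have \<tau>: "\<tau> > 0" using \<kappa> T by (simp add: \<tau>_def)
    have "\<tau> \<le> (\<eta> / 2 * t1 powr (10 * \<eta>)) * t1 powr (- 10 * \<eta>)"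
      unfolding \<tau>_def using \<kappa> T assms by (intro mult_mono powr_mono2') auto
    also have "\<dots> = \<eta> / 2" using assms by (simp add: mult.assoc flip: powr_add)
    finally have \<tau>2: "\<tau> \<le> \<eta> / 2" .
    have t1: "c2 * \<tau> powr (3/4) * T powr (1 - \<eta> / 2) = c2 * \<kappa> powr (3/4) * T powr (1 - 8 * \<eta>)"
    proof -
      have "\<tau> powr (3/4) = \<kappa> powr (3/4) * T powr (- 10 * \<eta> * (3/4))"
        unfolding \<tau>_def using \<kappa> T by (simp add: powr_mult powr_powr)
      then have "c2 * \<tau> powr (3/4) * T powr (1 - \<eta> / 2) = c2 * \<kappa> powr (3/4) * (T powr (- 10 * \<eta> * (3/4)) * T powr (1 - \<eta> / 2))"
        by simp
      also have "T powr (- 10 * \<eta> * (3/4)) * T powr (1 - \<eta> / 2) = T powr (1 - 8 * \<eta>)"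
      proof -
        have "- 10 * \<eta> * (3/4) + (1 - \<eta> / 2) = 1 - 8 * \<eta>" by (simp add: field_simps)
        then show ?thesis by (simp only: powr_add[symmetric])
      qed
      finally show ?thesis .
    qed
    have "c2 * \<kappa> powr (3/4) / 2 * T powr (1 - 8 * \<eta>) \<le> norm (reg_zeta s)"
    proof (cases "Re s \<ge> 1 + \<tau>")
      case True
      have "c2 * \<kappa> powr (3/4) / 2 * T powr (1 - 8 * \<eta>) \<le> c2 * \<tau> powr (3/4) * T powr (1 - \<eta> / 2)"
        unfolding t1 using c2 by simp
      also have "\<dots> \<le> c2 * (Re s - 1) powr (3/4) * T powr (1 - \<eta> / 2)"
        using True \<tau> c2(1) by (intro mult_right_mono mult_left_mono powr_mono2) auto
      also have "\<dots> \<le> norm (reg_zeta s)" using c2(2)[of s] True \<tau> s by (simp add: T_def)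
      finally show ?thesis .
    next
      case False
      define s1 where "s1 = Complex (1 + \<tau>) (Im s)"
      have l1: "c2 * \<kappa> powr (3/4) * T powr (1 - 8 * \<eta>) \<le> norm (reg_zeta s1)"
        unfolding t1[symmetric] using c2(2)[of s1] \<tau> \<tau>2 assms s by (simp add: s1_def T_def)
      \<comment> \<open>A horizontal segment, written as an intersection of half-planes to make its
        convexity immediate.\<close>
      let ?S = "{z. 1 - \<eta> / 2 \<le> Re z} \<inter> {z. Re z \<le> 2} \<inter> ({z. Im s \<le> Im z} \<inter> {z. Im z \<le> Im s})"
      have "norm (reg_zeta s - reg_zeta s1) \<le> D * T powr (1 + 2 * \<eta>) * norm (s - s1)"
      proof (rule field_differentiable_bound[where S = ?S and f' = "deriv reg_zeta"])
        show "convex ?S" by (intro convex_Int convex_halfspace_Re_ge convex_halfspace_Re_le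
              convex_halfspace_Im_ge convex_halfspace_Im_le)
        show "s \<in> ?S" "s1 \<in> ?S" using s \<tau> \<tau>2 assms by (auto simp: s1_def \<tau>_def T_def)
        fix z assume z: "z \<in> ?S"
        then have "Re z > 1/2" using assms by simp
        then show "(reg_zeta has_field_derivative deriv reg_zeta z) (at z within ?S)"
          using holomorphic_derivI[OF reg_zeta_holomorphic open_Re_gt] has_field_derivative_at_within by auto
        show "norm (deriv reg_zeta z) \<le> D * T powr (1 + 2 * \<eta>)" 
        proof -
          have "Im z = Im s" using z by auto
          then show ?thesis using D(2)[of z] z s by (simp add: T_def)
        qed
      qed
      also have "norm (s - s1) \<le> 2 * \<tau>"
      proof -
        have "s - s1 = of_real (Re s - (1 + \<tau>))" by (simp add: complex_eq_iff s1_def)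
        then have "norm (s - s1) = \<bar>Re s - (1 + \<tau>)\<bar>" by (simp only: norm_of_real)
        then show ?thesis using s False by (simp add: \<tau>_def T_def)
      qed
      also have "D * T powr (1 + 2 * \<eta>) * (2 * \<tau>) = 2 * D * \<kappa> * (T powr (1 + 2 * \<eta>) * T powr (- 10 * \<eta>))"
        by (simp add: \<tau>_def)
      also have "T powr (1 + 2 * \<eta>) * T powr (- 10 * \<eta>) = T powr (1 - 8 * \<eta>)"
        by (simp flip: powr_add)
      also have "2 * D * \<kappa> * T powr (1 - 8 * \<eta>) \<le> c2 * \<kappa> powr (3/4) / 2 * T powr (1 - 8 * \<eta>)"
        using k5 by (intro mult_right_mono) auto
      finally have "norm (reg_zeta s - reg_zeta s1) \<le> c2 * \<kappa> powr (3/4) / 2 * T powr (1 - 8 * \<eta>)"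
        using D by (simp add: mult_left_mono)
      with l1 norm_triangle_ineq2[of "reg_zeta s1" "reg_zeta s"] show ?thesis
        by (simp add: norm_minus_commute)
    qed
    then show "c2 * \<kappa> powr (3/4) / 2 * \<bar>Im s\<bar> powr (1 - 8 * \<eta>) \<le> norm (reg_zeta s)" by (simp add: T_def)
  qed (use \<kappa> c2 in auto)
qed

text \<open>Off the real axis the quantitative bound applies with t1 = |Im s|. On the axis the value
  at 1 is 1, and to the right of 1 zeta is a nonzero multiple of an exponential.\<close>

lemma reg_zeta_nonzero:
  assumes "1 \<le> Re s" "Re s \<le> 2"
  shows "reg_zeta s \<noteq> 0"
proof (cases "Im s = 0")
  case False
  obtain \<kappa> c where *: "\<kappa> > 0" "c > 0" "\<And>s'. 1 - \<kappa> * \<bar>Im s'\<bar> powr (- 10 * (1/4)) \<le> Re s' \<Longrightarrow> Re s' \<le> 2 \<Longrightarrow> \<bar>Im s\<bar> \<le> \<bar>Im s'\<bar> \<Longrightarrow>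
           c * \<bar>Im s'\<bar> powr (1 - 8 * (1/4)) \<le> norm (reg_zeta s')"
    using reg_zeta_lower[of "1/4" "\<bar>Im s\<bar>"] False by auto
  have "c * \<bar>Im s\<bar> powr (1 - 8 * (1/4)) \<le> norm (reg_zeta s)"
    by (rule *(3)) (use assms *(1) in \<open>auto intro: order_trans[of _ 1]\<close>)
  moreover have "c * \<bar>Im s\<bar> powr (1 - 8 * (1/4)) > 0"
    using *(2) False by (intro mult_pos_pos) auto
  ultimately have "norm (reg_zeta s) > 0" by linarith
  then show ?thesis by auto
next
  case True
  show ?thesis
  proof (cases "Re s = 1")
    case eq: True
    then have "s = 1" using True by (simp add: complex_eq_iff)
    then show ?thesis by simp
  next
    case False
    then have s: "Re s > 1" using assms by simp
    obtain c where "c \<noteq> 0" "zeta_series s = c * exp (dirichlet log_zeta_coeff s)"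
      using zeta_series_eq_exp s by blast
    then show ?thesis using reg_zeta_eq[OF s] s by auto
  qed
qed

section \<open>The continued logarithmic derivative and its higher derivatives\<close>

text \<open>This is zeta s - 1 / (s - 1) with the removable singularity at 1 filled in, as
  \<open>reg_zeta 1 = 1\<close>.\<close>

definition zeta_pole_rest :: "complex \<Rightarrow> complex" where
  "zeta_pole_rest s = (if s = 1 then deriv reg_zeta 1 else (reg_zeta s - reg_zeta 1) / (s - 1))"

text \<open>The continuation of \<open>- zeta' / zeta - zeta\<close>, whose poles at 1 cancel.\<close>

definition mangoldt_rest :: "complex \<Rightarrow> complex" where
  "mangoldt_rest s = - deriv reg_zeta s / reg_zeta s - zeta_pole_rest s"

definition zeta_region :: "complex set" where
  "zeta_region = {s. Re s > 1/2} \<inter> reg_zeta -` (- {0})"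

lemma open_zeta_region: "open zeta_region"
  unfolding zeta_region_def
  by (rule continuous_open_preimage[OF holomorphic_on_imp_continuous_on[OF reg_zeta_holomorphic] open_Re_gt]) auto

lemma mangoldt_rest_holomorphic: "mangoldt_rest holomorphic_on zeta_region"
proof -
  have sub: "zeta_region \<subseteq> {s. Re s > 1/2}" by (auto simp: zeta_region_def)
  have "zeta_pole_rest holomorphic_on {s. Re s > 1/2}"
    unfolding zeta_pole_rest_def by (rule pole_lemma_open[OF reg_zeta_holomorphic open_Re_gt])
  moreover have "deriv reg_zeta holomorphic_on {s. Re s > 1/2}"
    by (rule holomorphic_deriv[OF reg_zeta_holomorphic open_Re_gt])
  ultimately have "deriv reg_zeta holomorphic_on zeta_region" "zeta_pole_rest holomorphic_on zeta_region"
    "reg_zeta holomorphic_on zeta_region"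
    using reg_zeta_holomorphic by (auto intro: holomorphic_on_subset[OF _ sub])
  then show ?thesis
    unfolding mangoldt_rest_def
    by (intro holomorphic_on_diff holomorphic_on_divide holomorphic_on_minus) (auto simp: zeta_region_def)
qed

text \<open>Since \<open>reg_zeta\<close> is (s - 1) zeta, its logarithmic derivative contains 1 /
  (s - 1), which cancels the same term in \<open>zeta_pole_rest\<close>.\<close>

lemma mangoldt_rest_eq:
  assumes s: "Re s > 1"
  shows "mangoldt_rest s = dirichlet (\<lambda>n. mangoldt n - 1) s"
proof -
  obtain c where "c \<noteq> 0" "zeta_series s = c * exp (dirichlet log_zeta_coeff s)"
    using zeta_series_eq_exp s by blast
  then have nz: "zeta_series s \<noteq> 0" by auto
  have s1: "s \<noteq> 1" using s by auto
  have "((\<lambda>s. (s - 1) * zeta_series s) has_field_derivative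
          (1 * zeta_series s + (- (dirichlet mangoldt s * zeta_series s)) * (s - 1))) (at s)"
    by (intro DERIV_mult zeta_series_has_field_derivative s) (auto intro!: derivative_eq_intros)
  then have "(reg_zeta has_field_derivative
          (1 * zeta_series s + (- (dirichlet mangoldt s * zeta_series s)) * (s - 1))) (at s)"
    by (rule has_field_derivative_transform_within_open[OF _ open_Re_gt[of 1]]) (use s reg_zeta_eq in auto)
  then have d: "deriv reg_zeta s = zeta_series s - dirichlet mangoldt s * zeta_series s * (s - 1)"
    by (auto dest!: DERIV_imp_deriv)
  have "deriv reg_zeta s / reg_zeta s = 1 / (s - 1) - dirichlet mangoldt s"
    using nz s1 by (simp add: d reg_zeta_eq[OF s] diff_divide_distrib)
  moreover have "zeta_pole_rest s = zeta_series s - 1 / (s - 1)"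
    using s1 by (simp add: zeta_pole_rest_def reg_zeta_eq[OF s] diff_divide_distrib)
  ultimately have "mangoldt_rest s = dirichlet mangoldt s - zeta_series s"
    by (simp add: mangoldt_rest_def)
  then show ?thesis
    using dirichlet_diff[OF dirichlet_abs_conv_mangoldt dirichlet_abs_conv_one s] by simp
qed

lemma dirichlet_abs_conv_mangoldt_minus_one: "dirichlet_abs_conv (\<lambda>n. mangoldt n - 1)"
  unfolding dirichlet_abs_conv_def
proof (intro allI impI)
  fix \<sigma> :: real assume "\<sigma> > 1"
  then have "summable (\<lambda>n. \<bar>mangoldt n\<bar> * real n powr (-\<sigma>) + \<bar>1\<bar> * real n powr (-\<sigma>))"
    using dirichlet_abs_conv_mangoldt dirichlet_abs_conv_one unfolding dirichlet_abs_conv_def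
    by (intro summable_add) auto
  then show "summable (\<lambda>n. \<bar>mangoldt n - 1\<bar> * real n powr (-\<sigma>))"
  proof (rule summable_comparison_test')
    fix n :: nat
    have "\<bar>mangoldt n - 1\<bar> \<le> \<bar>mangoldt n\<bar> + \<bar>1 :: real\<bar>" using mangoldt_nonneg[of n] by simp
    then show "norm (\<bar>mangoldt n - 1\<bar> * real n powr (-\<sigma>)) \<le> \<bar>mangoldt n\<bar> * real n powr (-\<sigma>) + \<bar>1\<bar> * real n powr (-\<sigma>)"
      unfolding distrib_right[symmetric] by (simp add: abs_mult mult_right_mono)
  qed
qed

lemma deriv_mangoldt_rest_eq:
  assumes s: "Re s > 1"
  shows "(deriv ^^ k) mangoldt_rest s = dirichlet (\<lambda>n. (- ln (real n)) ^ k * (mangoldt n - 1)) s"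
proof -
  note c = dirichlet_abs_conv_mangoldt_minus_one
  have "(deriv ^^ k) mangoldt_rest s = (deriv ^^ k) (dirichlet (\<lambda>n. mangoldt n - 1)) s"
  proof (rule higher_deriv_transform_within_open[OF _ _ open_Re_gt[of 1]])
    show "dirichlet (\<lambda>n. mangoldt n - 1) holomorphic_on {s. Re s > 1}"
      using dirichlet_has_field_derivative[OF c] unfolding holomorphic_on_open[OF open_Re_gt] by auto
    then show "mangoldt_rest holomorphic_on {s. Re s > 1}"
      by (rule holomorphic_transform) (simp add: mangoldt_rest_eq)
  qed (use s mangoldt_rest_eq in auto)
  then show ?thesis using dirichlet_higher_deriv[OF c s] by simp
qed

text \<open>T^(1 + 2 \<eta>) for the derivative over T^(1 - 8 \<eta>) for the denominator gives
  T^(10 \<eta>). The bound is stated on a whole disc around s so that Cauchy's estimate can be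
  applied there.\<close>

lemma mangoldt_rest_high:
  assumes "\<eta> > 0" "\<eta> \<le> 1/10"
  shows "\<exists>B \<rho>. B > 0 \<and> \<rho> > 0 \<and> (\<forall>s z. 1 \<le> Re s \<longrightarrow> Re s \<le> 3/2 \<longrightarrow> 2 \<le> \<bar>Im s\<bar> \<longrightarrow>
           norm (s - z) \<le> \<rho> * \<bar>Im s\<bar> powr (- 10 * \<eta>) \<longrightarrow>
           z \<in> zeta_region \<and> norm (mangoldt_rest z) \<le> B * \<bar>Im s\<bar> powr (10 * \<eta>))"
proof -
  have e4: "\<eta> \<le> 1/4" using assms by simp
  obtain \<kappa> c where low: "\<kappa> > 0" "c > 0" "\<And>s. 1 - \<kappa> * \<bar>Im s\<bar> powr (- 10 * \<eta>) \<le> Re s \<Longrightarrow> Re s \<le> 2 \<Longrightarrow> 1 \<le> \<bar>Im s\<bar> \<Longrightarrow>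
           c * \<bar>Im s\<bar> powr (1 - 8 * \<eta>) \<le> norm (reg_zeta s)"
    using reg_zeta_lower[OF assms(1) e4, of 1] by auto
  obtain D where D: "D > 0" "\<And>s. 1 - \<eta> / 2 \<le> Re s \<Longrightarrow> Re s \<le> 2 \<Longrightarrow> 1 \<le> \<bar>Im s\<bar> \<Longrightarrow> norm (deriv reg_zeta s) \<le> D * \<bar>Im s\<bar> powr (1 + 2 * \<eta>)"
    using reg_zeta_deriv_le[OF assms(1) e4, of 1] by auto
  obtain E where E: "E > 0" "\<And>s. 1 - \<eta> \<le> Re s \<Longrightarrow> Re s \<le> 3 \<Longrightarrow> 1 \<le> \<bar>Im s\<bar> \<Longrightarrow> norm (reg_zeta s) \<le> E * \<bar>Im s\<bar> powr (1 + 2 * \<eta>)"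
    using reg_zeta_le[OF assms(1) e4, of 1] by auto
  \<comment> \<open>The factor 1/2 on \<kappa> allows for |Im z| up to 2 |Im s|: since 10 \<eta>
    \<le> 1, the admissible distance shrinks at most by 2. The term \<eta> / 2 keeps z where the
    derivative bound holds.\<close>
  define \<rho> where "\<rho> = min (\<kappa> / 2) (\<eta> / 2)"
  have \<rho>: "\<rho> > 0" "\<rho> \<le> \<kappa> / 2" "\<rho> \<le> \<eta> / 2" using low assms by (auto simp: \<rho>_def)
  show ?thesis
  proof (rule exI[of _ "2 * (D / c + E + 1)"], rule exI[of _ \<rho>], intro conjI allI impI)
    fix s z :: complex
    assume s: "1 \<le> Re s" "Re s \<le> 3/2" "2 \<le> \<bar>Im s\<bar>" and z: "norm (s - z) \<le> \<rho> * \<bar>Im s\<bar> powr (- 10 * \<eta>)"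
    define T where "T = \<bar>Im s\<bar>"
    define Y where "Y = \<bar>Im z\<bar>"
    have T: "T \<ge> 2" using s by (simp add: T_def)
    have "T powr (- 10 * \<eta>) \<le> 1" using powr_mono[of "- 10 * \<eta>" 0 T] T assms by simp
    then have r: "\<rho> * T powr (- 10 * \<eta>) \<le> \<rho>" using \<rho> by (simp add: mult_left_le)
    have dz: "\<bar>Re (s - z)\<bar> \<le> \<rho> * T powr (- 10 * \<eta>)" "\<bar>Im (s - z)\<bar> \<le> \<rho> * T powr (- 10 * \<eta>)"
      using z abs_Re_le_cmod[of "s - z"] abs_Im_le_cmod[of "s - z"] unfolding T_def by linarith+
    have "\<bar>Im (s - z)\<bar> \<le> 1" using dz(2) r \<rho>(3) assms by linarith
    then have Y: "1 \<le> Y" "Y \<le> 2 * T" using T by (auto simp: T_def Y_def)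
    have "\<bar>Re (s - z)\<bar> \<le> \<eta> / 2" using dz(1) r \<rho>(3) by linarith
    then have "Re (s - z) \<le> \<eta> / 2 \<and> - Re (s - z) \<le> \<eta> / 2" by (simp only: abs_le_iff)
    then have "Re s - Re z \<le> \<eta> / 2" "Re z - Re s \<le> \<eta> / 2" by simp_all
    then have Rz: "1 - \<eta> / 2 \<le> Re z" "Re z \<le> 2" using assms s by linarith+
    have "\<rho> * T powr (- 10 * \<eta>) \<le> \<kappa> * Y powr (- 10 * \<eta>)"
    proof -
      have "(1/2) * T powr (- 10 * \<eta>) = 2 powr (- 1) * T powr (- 10 * \<eta>)" by simp
      also have "\<dots> \<le> 2 powr (- 10 * \<eta>) * T powr (- 10 * \<eta>)"
        using assms by (intro mult_right_mono powr_mono) auto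
      also have "\<dots> = (2 * T) powr (- 10 * \<eta>)" using T by (simp add: powr_mult)
      also have "\<dots> \<le> Y powr (- 10 * \<eta>)" using Y assms by (intro powr_mono2') auto
      finally have "\<kappa> * ((1/2) * T powr (- 10 * \<eta>)) \<le> \<kappa> * Y powr (- 10 * \<eta>)"
        using low by (intro mult_left_mono) auto
      moreover have "\<rho> * T powr (- 10 * \<eta>) \<le> \<kappa> / 2 * T powr (- 10 * \<eta>)"
        using \<rho> by (intro mult_right_mono) auto
      ultimately show ?thesis by simp
    qed
    then have lz: "c * Y powr (1 - 8 * \<eta>) \<le> norm (reg_zeta z)"
      unfolding Y_def by (intro low(3)) (use dz(1) s Rz Y in \<open>auto simp: Y_def\<close>)
    have pos: "c * Y powr (1 - 8 * \<eta>) > 0" using low Y by simp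
    have zn: "reg_zeta z \<noteq> 0" using lz pos by auto
    show "z \<in> zeta_region" using zn Rz assms by (auto simp: zeta_region_def)
    have YT: "Y powr (10 * \<eta>) \<le> 2 * T powr (10 * \<eta>)"
    proof -
      have "Y powr (10 * \<eta>) \<le> (2 * T) powr (10 * \<eta>)" using Y assms by (intro powr_mono2) auto
      also have "\<dots> = 2 powr (10 * \<eta>) * T powr (10 * \<eta>)" using T by (simp add: powr_mult)
      also have "\<dots> \<le> 2 powr 1 * T powr (10 * \<eta>)" using assms by (intro mult_right_mono powr_mono) auto
      finally show ?thesis by simp
    qed
    have "norm (deriv reg_zeta z / reg_zeta z) \<le> D * Y powr (1 + 2 * \<eta>) / (c * Y powr (1 - 8 * \<eta>))"
      unfolding norm_divide by (intro frac_le lz pos) (use D Rz Y in \<open>auto simp: Y_def\<close>)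
    also have "\<dots> = D / c * (Y powr (1 + 2 * \<eta>) / Y powr (1 - 8 * \<eta>))" by simp
    also have "Y powr (1 + 2 * \<eta>) / Y powr (1 - 8 * \<eta>) = Y powr (10 * \<eta>)"
      by (simp flip: powr_diff)
    finally have 1: "norm (deriv reg_zeta z / reg_zeta z) \<le> D / c * Y powr (10 * \<eta>)" .
    have "z \<noteq> 1" using Y by (auto simp: Y_def)
    have "Y \<le> norm (z - 1)" using abs_Im_le_cmod[of "z - 1"] by (simp add: Y_def)
    have "norm (reg_zeta z - 1) \<le> E * Y powr (1 + 2 * \<eta>) + 1"
      using norm_triangle_ineq4[of "reg_zeta z" 1] E(2)[of z] Rz Y assms by (simp add: Y_def)
    moreover have "1 \<le> Y powr (1 + 2 * \<eta>)" using Y assms by (intro ge_one_powr_ge_zero) auto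
    ultimately have "norm (reg_zeta z - 1) \<le> (E + 1) * Y powr (1 + 2 * \<eta>)" by (simp add: algebra_simps)
    then have "norm (zeta_pole_rest z) \<le> (E + 1) * Y powr (1 + 2 * \<eta>) / Y"
      unfolding zeta_pole_rest_def using \<open>z \<noteq> 1\<close> \<open>Y \<le> norm (z - 1)\<close> Y E
      by (auto simp: norm_divide intro!: frac_le)
    also have "\<dots> = (E + 1) * Y powr (2 * \<eta>)" using Y by (simp add: powr_add)
    also have "\<dots> \<le> (E + 1) * Y powr (10 * \<eta>)" using Y E assms by (intro mult_left_mono powr_mono) auto
    finally have 2: "norm (zeta_pole_rest z) \<le> (E + 1) * Y powr (10 * \<eta>)" .
    have "norm (mangoldt_rest z) \<le> norm (deriv reg_zeta z / reg_zeta z) + norm (zeta_pole_rest z)"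
      unfolding mangoldt_rest_def using norm_triangle_ineq4[of "- (deriv reg_zeta z / reg_zeta z)" "zeta_pole_rest z"] by simp
    also have "\<dots> \<le> (D / c + E + 1) * Y powr (10 * \<eta>)" using 1 2 by (simp add: algebra_simps)
    also have "\<dots> \<le> (D / c + E + 1) * (2 * T powr (10 * \<eta>))"
      using YT D E low by (intro mult_left_mono) (auto intro!: add_nonneg_nonneg divide_nonneg_nonneg)
    finally show "norm (mangoldt_rest z) \<le> 2 * (D / c + E + 1) * \<bar>Im s\<bar> powr (10 * \<eta>)"
      unfolding T_def by (simp only: mult_ac)
  next
    show "2 * (D / c + E + 1) > 0" using D E low by (simp add: add_pos_pos)
  qed (use \<rho> in auto)
qed

text \<open>Cauchy's estimate for the k-th derivative on discs of radius of order T^(-10 \<eta>)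
  costs T^(10 \<eta> (k + 1)), and the choice of \<eta> makes this exponent 1. Heights up to 2 are
  covered by compactness; the rectangle may touch Re s = 1 because the pole is cancelled and
  \<open>reg_zeta\<close> has no zero there.\<close>

theorem deriv_mangoldt_rest_bound:
  "\<exists>C>0. \<forall>s. 1 < Re s \<longrightarrow> Re s \<le> 3/2 \<longrightarrow> norm ((deriv ^^ k) mangoldt_rest s) \<le> C * (1 + \<bar>Im s\<bar>)"
proof -
  define \<eta> where "\<eta> = 1 / (10 * (real k + 1))"
  have \<eta>: "\<eta> > 0" "\<eta> \<le> 1/10" by (auto simp: \<eta>_def field_simps)
  obtain B \<rho> where B: "B > 0" "\<rho> > 0" "\<And>s z. 1 \<le> Re s \<Longrightarrow> Re s \<le> 3/2 \<Longrightarrow> 2 \<le> \<bar>Im s\<bar> \<Longrightarrow>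
           norm (s - z) \<le> \<rho> * \<bar>Im s\<bar> powr (- 10 * \<eta>) \<Longrightarrow>
           z \<in> zeta_region \<and> norm (mangoldt_rest z) \<le> B * \<bar>Im s\<bar> powr (10 * \<eta>)"
    using mangoldt_rest_high[OF \<eta>] by blast
  let ?K = "cbox (Complex 1 (-2)) (Complex (3/2) 2)"
  have "?K \<subseteq> zeta_region"
    using reg_zeta_nonzero by (force simp: zeta_region_def in_cbox_complex_iff)
  moreover have "(deriv ^^ k) mangoldt_rest holomorphic_on zeta_region"
    by (rule holomorphic_higher_deriv[OF mangoldt_rest_holomorphic open_zeta_region])
  ultimately have "continuous_on ?K ((deriv ^^ k) mangoldt_rest)"
    using holomorphic_on_imp_continuous_on continuous_on_subset by blast
  then have "compact ((deriv ^^ k) mangoldt_rest ` ?K)" by (rule compact_continuous_image) (rule compact_cbox)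
  then obtain A where A: "\<And>s. s \<in> ?K \<Longrightarrow> norm ((deriv ^^ k) mangoldt_rest s) \<le> A"
    using compact_imp_bounded[THEN bounded_pos[THEN iffD1]] by (metis imageI)
  define C where "C = max \<bar>A\<bar> (fact k * B / \<rho> ^ k)"
  have C: "C > 0" "C \<ge> \<bar>A\<bar>" "C \<ge> fact k * B / \<rho> ^ k" using B by (auto simp: C_def less_max_iff_disj)
  show ?thesis
  proof (intro exI[of _ C] conjI allI impI C(1))
    fix s assume s: "1 < Re s" "Re s \<le> 3/2"
    show "norm ((deriv ^^ k) mangoldt_rest s) \<le> C * (1 + \<bar>Im s\<bar>)"
    proof (cases "\<bar>Im s\<bar> \<le> 2")
      case True
      then have "norm ((deriv ^^ k) mangoldt_rest s) \<le> A" using s by (intro A) (auto simp: in_cbox_complex_iff)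
      also have "\<dots> \<le> C * 1" using C by simp
      also have "\<dots> \<le> C * (1 + \<bar>Im s\<bar>)" using C by (intro mult_left_mono) auto
      finally show ?thesis .
    next
      case False
      define T where "T = \<bar>Im s\<bar>"
      have T: "T > 2" using False by (simp add: T_def)
      define r where "r = \<rho> * T powr (- 10 * \<eta>)"
      have r: "r > 0" using B T by (simp add: r_def)
      have near: "z \<in> zeta_region" "norm (mangoldt_rest z) \<le> B * T powr (10 * \<eta>)" if "norm (s - z) \<le> r" for z
        using B(3)[of s z] s that T by (auto simp: T_def r_def)
      have "cball s r \<subseteq> zeta_region" using near(1) by (auto simp: dist_norm)
      then have hol: "mangoldt_rest holomorphic_on cball s r"
        using mangoldt_rest_holomorphic holomorphic_on_subset by blast
      have "norm ((deriv ^^ k) mangoldt_rest s) \<le> fact k * (B * T powr (10 * \<eta>)) / r ^ k"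
        by (rule Cauchy_inequality[OF holomorphic_on_subset[OF hol] holomorphic_on_imp_continuous_on[OF hol] r near(2)]) auto
      also have "r ^ k = \<rho> ^ k * T powr (- 10 * \<eta> * real k)"
        using T by (simp add: r_def power_mult_distrib powr_power mult_ac)
      also have "fact k * (B * T powr (10 * \<eta>)) / (\<rho> ^ k * T powr (- 10 * \<eta> * real k))
          = fact k * B / \<rho> ^ k * (T powr (10 * \<eta>) / T powr (- 10 * \<eta> * real k))" by simp
      also have "T powr (10 * \<eta>) / T powr (- 10 * \<eta> * real k) = T powr (10 * \<eta> * (real k + 1))"
        by (simp flip: powr_diff add: algebra_simps)
      also have "10 * \<eta> * (real k + 1) = 1" by (simp add: \<eta>_def field_simps add_pos_pos)
      also have "fact k * B / \<rho> ^ k * T powr 1 \<le> C * T" using C T by (intro mult_mono) auto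
      also have "\<dots> \<le> C * (1 + \<bar>Im s\<bar>)" using C by (simp add: T_def)
      finally show ?thesis .
    qed
  qed
qed

section \<open>Prime gaps\<close>

text \<open>The characteristic function of the normal distribution turns the mean of (e^u / n)^(i x
  / w) into a Gaussian in (ln n - u) / w. Sum and integral commute because the norms of the terms
  are summable and do not depend on x.\<close>

lemma gaussian_average_dirichlet:
  assumes a: "dirichlet_abs_conv a" and \<sigma>: "\<sigma> > 1" and w: "w > 0"
  shows "(\<lambda>n. complex_of_real (a n * real n powr (-\<sigma>) * exp (- (((ln (real n) - u) / w)\<^sup>2) / 2))) sums
           (LINT x|std_normal_distribution. iexp (u * (x / w)) * dirichlet a (Complex \<sigma> (x / w)))"
proof -
  let ?M = std_normal_distribution
  interpret real_distribution ?M by (rule real_dist_normal_dist)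
  define c where "c = (\<lambda>n. a n * real n powr (-\<sigma>))"
  define f where "f = (\<lambda>n x. complex_of_real (c n) * iexp ((u - ln (real n)) / w * x))"
  have int: "integrable ?M (f n)" for n
    unfolding f_def by (intro integrable_mult_right integrable_iexp) auto
  have nf: "norm (f n x) = \<bar>c n\<bar>" for n x by (simp add: f_def norm_mult)
  have sm: "summable (\<lambda>n. \<bar>c n\<bar>)"
    using a \<sigma> by (simp add: dirichlet_abs_conv_def c_def abs_mult)
  have val: "integral\<^sup>L ?M (f n) = complex_of_real (a n * real n powr (-\<sigma>) * exp (- (((ln (real n) - u) / w)\<^sup>2) / 2))" for n
  proof -
    have "integral\<^sup>L ?M (f n) = of_real (c n) * char ?M ((u - ln (real n)) / w)"
      unfolding f_def char_def by simp
    also have "((u - ln (real n)) / w)\<^sup>2 = ((ln (real n) - u) / w)\<^sup>2"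
      by (simp add: power_divide power2_commute)
    then have "char ?M ((u - ln (real n)) / w) = complex_of_real (exp (- (((ln (real n) - u) / w)\<^sup>2) / 2))"
      by (simp add: char_std_normal_distribution)
    finally show ?thesis by (simp add: c_def)
  qed
  have "(\<lambda>n. integral\<^sup>L ?M (f n)) sums (LINT x|?M. (\<Sum>n. f n x))"
  proof (rule sums_integral[OF int])
    show "AE x in ?M. summable (\<lambda>n. norm (f n x))" using sm by (simp add: nf)
    show "summable (\<lambda>n. LINT x|?M. norm (f n x))" using sm prob_space by (simp add: nf)
  qed
  moreover have "(\<Sum>n. f n x) = iexp (u * (x / w)) * dirichlet a (Complex \<sigma> (x / w))" for x
  proof -
    have "f n x = iexp (u * (x / w)) * (of_real (a n) * (of_nat n :: complex) powr (- Complex \<sigma> (x / w)))" for n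
    proof (cases "n = 0")
      case False
      have "Complex \<sigma> (x / w) = of_real \<sigma> + \<i> * of_real (x / w)" by (simp add: complex_eq_iff)
      then have "(of_nat n :: complex) powr (- Complex \<sigma> (x / w)) = exp (of_real (- \<sigma> * ln (real n))) * iexp (- (x / w) * ln (real n))"
        using False by (simp add: powr_def Ln_of_nat algebra_simps flip: exp_add)
      also have "exp (complex_of_real (- \<sigma> * ln (real n))) = of_real (real n powr (-\<sigma>))"
        using False by (simp add: powr_def flip: exp_of_real)
      finally show ?thesis using w
        by (simp add: f_def c_def mult_ac flip: exp_add) (simp add: field_simps)
    qed (simp add: f_def c_def)
    then show ?thesis
      using sums_mult[OF dirichlet_sums[OF a, of "Complex \<sigma> (x / w)"], of "iexp (u * (x / w))"] \<sigma>
      by (simp add: sums_iff)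
  qed
  ultimately show ?thesis unfolding val by simp
qed

text \<open>At height x / w the linear growth of the derivative gives C (1 + |x| / w). As |x| has
  finite mean under the normal distribution and w \<le> 1, the average is O(1 / w), uniformly in
  u.\<close>

lemma mangoldt_gaussian_average:
  "\<exists>C>0. \<forall>u w. 2 \<le> u \<longrightarrow> 0 < w \<longrightarrow> w \<le> 1 \<longrightarrow>
     \<bar>\<Sum>n. (mangoldt n - 1) * (ln (real n) ^ k * real n powr (- (1 + 1 / u)) * exp (- (((ln (real n) - u) / w)\<^sup>2) / 2))\<bar> \<le> C / w"
proof -
  let ?M = std_normal_distribution
  interpret real_distribution ?M by (rule real_dist_normal_dist)
  obtain C where C: "C > 0" "\<And>s. 1 < Re s \<Longrightarrow> Re s \<le> 3/2 \<Longrightarrow> norm ((deriv ^^ k) mangoldt_rest s) \<le> C * (1 + \<bar>Im s\<bar>)"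
    using deriv_mangoldt_rest_bound[of k] by auto
  define m where "m = (LINT x|?M. \<bar>x\<bar>)"
  have intabs: "integrable ?M (\<lambda>x. \<bar>x\<bar>)"
    using integrable_norm[OF integrable_std_normal_distribution_moment[of 1]] by simp
  have m: "m \<ge> 0" unfolding m_def by (rule integral_nonneg_AE) auto
  show ?thesis
  proof (intro exI[of _ "C * (1 + m)"] conjI allI impI)
    show "C * (1 + m) > 0" using C m by simp
    fix u w :: real assume u: "2 \<le> u" and w: "0 < w" "w \<le> 1"
    define a where "a = (\<lambda>n. (- ln (real n)) ^ k * (mangoldt n - 1))"
    \<comment> \<open>For ln n near u the factor n^(-1/u) is about 1 / e, so moving off the line Re
      s = 1 costs only a constant.\<close>
    define \<sigma> where "\<sigma> = 1 + 1 / u"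
    have \<sigma>: "\<sigma> > 1" "\<sigma> \<le> 3/2" using u by (auto simp: \<sigma>_def field_simps)
    have ac: "dirichlet_abs_conv a"
      by (rule dirichlet_abs_conv_comparison[OF dirichlet_abs_conv_power_ln[OF dirichlet_abs_conv_mangoldt_minus_one, of k], of _ 1])
         (simp add: a_def abs_mult power_abs)
    define I where "I = (LINT x|?M. iexp (u * (x / w)) * dirichlet a (Complex \<sigma> (x / w)))"
    have s1: "(\<lambda>n. complex_of_real (a n * real n powr (-\<sigma>) * exp (- (((ln (real n) - u) / w)\<^sup>2) / 2))) sums I"
      unfolding I_def by (rule gaussian_average_dirichlet[OF ac \<sigma>(1) w(1)])
    have bd: "norm (iexp (u * (x / w)) * dirichlet a (Complex \<sigma> (x / w))) \<le> C * (1 + \<bar>x\<bar>) / w" for x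
    proof -
      have "dirichlet a (Complex \<sigma> (x / w)) = (deriv ^^ k) mangoldt_rest (Complex \<sigma> (x / w))"
        unfolding a_def using \<sigma> by (simp add: deriv_mangoldt_rest_eq)
      then have "norm (iexp (u * (x / w)) * dirichlet a (Complex \<sigma> (x / w))) \<le> C * (1 + \<bar>x / w\<bar>)"
        using C(2)[of "Complex \<sigma> (x / w)"] \<sigma> by (simp add: norm_mult)
      also have "1 + \<bar>x / w\<bar> \<le> (1 + \<bar>x\<bar>) / w" using w by (simp add: field_simps)
      finally show ?thesis using C by simp
    qed
    have "norm I \<le> (LINT x|?M. C * (1 + \<bar>x\<bar>) / w)"
    proof (cases "integrable ?M (\<lambda>x. iexp (u * (x / w)) * dirichlet a (Complex \<sigma> (x / w)))")
      case True
      have "norm I \<le> (LINT x|?M. norm (iexp (u * (x / w)) * dirichlet a (Complex \<sigma> (x / w))))"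
        unfolding I_def by (rule integral_norm_bound)
      also have "\<dots> \<le> (LINT x|?M. C * (1 + \<bar>x\<bar>) / w)"
        by (rule integral_mono) (use True intabs bd in auto)
      finally show ?thesis .
    next
      case False
      \<comment> \<open>A non-integrable function has integral 0 by convention, so this case
        satisfies the bound as well and integrability need not be established.\<close>
      then have "I = 0" unfolding I_def by (rule not_integrable_integral_eq)
      moreover have "(LINT x|?M. C * (1 + \<bar>x\<bar>) / w) \<ge> 0"
        using C w by (intro integral_nonneg_AE) auto
      ultimately show ?thesis by simp
    qed
    also have "(LINT x|?M. C * (1 + \<bar>x\<bar>) / w) = C * (1 + m) / w"
      using intabs prob_space by (simp add: m_def)
    finally have nI: "norm I \<le> C * (1 + m) / w" .
    have "(\<lambda>n. a n * real n powr (-\<sigma>) * exp (- (((ln (real n) - u) / w)\<^sup>2) / 2)) sums Re I"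
      using sums_Re[OF s1] by simp
    \<comment> \<open>This undoes the sign of (- ln n)^k, which comes from differentiating k
      times.\<close>
    from sums_mult[OF this, of "(-1) ^ k"]
    have s2: "(\<lambda>n. (-1) ^ k * (a n * real n powr (-\<sigma>) * exp (- (((ln (real n) - u) / w)\<^sup>2) / 2))) sums ((-1) ^ k * Re I)" .
    have eq: "(-1) ^ k * (a n * P * G) = (mangoldt n - 1) * (ln (real n) ^ k * P * G)" for n P G
    proof -
      have "(-1) ^ k * (- ln (real n)) ^ k = ln (real n) ^ k" by (simp flip: power_mult_distrib)
      then have "(-1) ^ k * (a n * P * G) = (ln (real n) ^ k) * ((mangoldt n - 1) * P * G)"
        unfolding a_def by (metis mult.assoc)
      then show ?thesis by (simp only: mult_ac)
    qed
    from s2 have "(\<lambda>n. (mangoldt n - 1) * (ln (real n) ^ k * real n powr (- (1 + 1 / u)) * exp (- (((ln (real n) - u) / w)\<^sup>2) / 2))) sums ((-1) ^ k * Re I)"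
      unfolding eq \<sigma>_def .
    then have "\<bar>\<Sum>n. (mangoldt n - 1) * (ln (real n) ^ k * real n powr (- (1 + 1 / u)) * exp (- (((ln (real n) - u) / w)\<^sup>2) / 2))\<bar> = \<bar>Re I\<bar>"
      by (simp add: sums_iff abs_mult power_abs)
    also have "\<dots> \<le> C * (1 + m) / w" using abs_Re_le_cmod[of I] nI by linarith
    finally show "\<bar>\<Sum>n. (mangoldt n - 1) * (ln (real n) ^ k * real n powr (- (1 + 1 / u)) * exp (- (((ln (real n) - u) / w)\<^sup>2) / 2))\<bar> \<le> C * (1 + m) / w" .
  qed
qed

section \<open>Sums against Gaussian weights\<close>

lemma power_le_fact_mult_exp:
  assumes "x \<ge> (0::real)"
  shows "x ^ m \<le> fact m * exp x"
proof -
  have "x ^ m /\<^sub>R fact m \<le> exp x"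
    using sum_le_suminf[of "\<lambda>n. x ^ n /\<^sub>R fact n" "{m}"] exp_converges[of x] assms by (simp add: sums_iff)
  then show ?thesis by (simp add: field_simps)
qed

text \<open>The sum is zeta at a real point, and (\<sigma> - 1) zeta(\<sigma>), the value of
  \<open>reg_zeta\<close>, is bounded for 1 < \<sigma> \<le> 2.\<close>

lemma sum_powr_le:
  "\<exists>E>0. \<forall>\<sigma>. 1 < \<sigma> \<longrightarrow> \<sigma> \<le> 2 \<longrightarrow> (\<Sum>n. real n powr (-\<sigma>)) \<le> E / (\<sigma> - 1)"
proof -
  obtain C where C: "C > 0" "\<And>s. Re s \<ge> 1 - 1/4 \<Longrightarrow> norm (reg_zeta s) \<le> 1 + C * norm (s - 1) * norm s powr (2 * (1/4))"
    using reg_zeta_growth[of "1/4"] by auto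
  define E where "E = 1 + C * 2 powr (1/2)"
  show ?thesis
  proof (intro exI[of _ E] conjI allI impI)
    show "E > 0" unfolding E_def using C by (simp add: add_pos_pos)
    fix \<sigma> :: real assume \<sigma>: "1 < \<sigma>" "\<sigma> \<le> 2"
    have d: "norm (complex_of_real \<sigma> - 1) = \<sigma> - 1"
      using \<sigma> by (metis abs_of_pos diff_gt_0_iff_gt norm_of_real of_real_1 of_real_diff)
    have "(\<lambda>n. 1 * real n powr (-\<sigma>) * cos (0 * ln (real n))) sums Re (zeta_series (Complex \<sigma> 0))"
      by (rule Re_dirichlet_sums[OF dirichlet_abs_conv_one \<sigma>(1)])
    then have "(\<Sum>n. real n powr (-\<sigma>)) = Re (zeta_series (of_real \<sigma>))" by (simp add: sums_iff complex_of_real_def)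
    also have "\<dots> \<le> norm (zeta_series (of_real \<sigma>))" by (rule complex_Re_le_cmod)
    also have "\<dots> = norm (reg_zeta (of_real \<sigma>)) / (\<sigma> - 1)"
      using reg_zeta_eq[of "of_real \<sigma>"] \<sigma> d by (simp add: norm_mult)
    also have "norm (reg_zeta (of_real \<sigma>)) \<le> 1 + C * norm (complex_of_real \<sigma> - 1) * norm (complex_of_real \<sigma>) powr (2 * (1/4))"
      using C(2)[of "of_real \<sigma>"] \<sigma> by simp
    also have "\<dots> \<le> 1 + C * 1 * 2 powr (2 * (1/4))"
      unfolding d using \<sigma> C(1) by (intro add_left_mono mult_mono powr_mono2) auto
    finally show "(\<Sum>n. real n powr (-\<sigma>)) \<le> E / (\<sigma> - 1)" using \<sigma> by (simp add: E_def divide_right_mono)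
  qed
qed

text \<open>Half of the excess 1 / u absorbs the logarithms at the price (K u)^j; the other half
  leaves a sum of order u.\<close>

lemma sum_ln_power_powr_le:
  "\<exists>E>0. \<forall>u\<ge>2. summable (\<lambda>n. ln (real n) ^ j * real n powr (- (1 + 1 / u))) \<and>
      (\<Sum>n. ln (real n) ^ j * real n powr (- (1 + 1 / u))) \<le> E * u ^ Suc j"
proof -
  obtain E where E: "E > 0" "\<And>\<sigma>. 1 < \<sigma> \<Longrightarrow> \<sigma> \<le> 2 \<Longrightarrow> (\<Sum>n. real n powr (-\<sigma>)) \<le> E / (\<sigma> - 1)"
    using sum_powr_le by auto
  \<comment> \<open>K \<ge> 2 j makes \<beta> j at most 1 / (2 u); the extra 2 keeps K positive for
    j = 0.\<close>
  define K where "K = 2 * (real j + 1)"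
  have K: "K > 0" by (simp add: K_def)
  show ?thesis
  proof (intro exI[of _ "2 * E * K ^ j"] conjI allI impI)
    show "2 * E * K ^ j > 0" using E K by simp
    fix u :: real assume u: "u \<ge> 2"
    define \<sigma> where "\<sigma> = 1 + 1 / (2 * u)"
    have \<sigma>: "\<sigma> > 1" "\<sigma> \<le> 2" using u by (auto simp: \<sigma>_def field_simps)
    have sm: "summable (\<lambda>n. (K * u) ^ j * real n powr (-\<sigma>))"
      using \<sigma> by (intro summable_mult) (simp add: summable_real_powr_iff)
    have le: "ln (real n) ^ j * real n powr (- (1 + 1 / u)) \<le> (K * u) ^ j * real n powr (-\<sigma>)" for n
    proof (cases "n = 0")
      case False
      define \<beta> where "\<beta> = 1 / (K * u)"
      have \<beta>: "\<beta> > 0" using K u by (simp add: \<beta>_def)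
      have "ln (real n) ^ j \<le> (real n powr \<beta> / \<beta>) ^ j"
        using ln_le_powr[OF \<beta>, of n] False by (intro power_mono) auto
      also have "\<dots> = real n powr (\<beta> * real j) * (K * u) ^ j"
        using False by (simp add: power_divide powr_power \<beta>_def power_mult_distrib mult_ac)
      also have "\<dots> \<le> real n powr (1 / (2 * u)) * (K * u) ^ j"
      proof (intro mult_right_mono powr_mono)
        have "2 * u * real j \<le> K * u" using u by (simp add: K_def)
        then show "\<beta> * real j \<le> 1 / (2 * u)" using K u by (simp add: \<beta>_def field_simps)
      qed (use False K u in auto)
      finally have "ln (real n) ^ j * real n powr (- (1 + 1 / u)) \<le> real n powr (1 / (2 * u)) * (K * u) ^ j * real n powr (- (1 + 1 / u))"
        by (intro mult_right_mono) auto
      also have "\<dots> = (K * u) ^ j * real n powr (1 / (2 * u) + (- (1 + 1 / u)))"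
        unfolding powr_add by simp
      also have "1 / (2 * u) + (- (1 + 1 / u)) = - \<sigma>" using u by (simp add: \<sigma>_def field_simps)
      finally show ?thesis .
    qed simp
    show sm': "summable (\<lambda>n. ln (real n) ^ j * real n powr (- (1 + 1 / u)))"
    proof (rule summable_comparison_test'[OF sm])
      fix n :: nat
      show "norm (ln (real n) ^ j * real n powr (- (1 + 1 / u))) \<le> (K * u) ^ j * real n powr (-\<sigma>)"
        using le[of n] by (cases "n = 0") (auto simp: abs_mult)
    qed
    have "(\<Sum>n. ln (real n) ^ j * real n powr (- (1 + 1 / u))) \<le> (\<Sum>n. (K * u) ^ j * real n powr (-\<sigma>))"
      by (rule suminf_le[OF le sm' sm])
    also have "\<dots> = (K * u) ^ j * (\<Sum>n. real n powr (-\<sigma>))"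
      using \<sigma> by (intro suminf_mult) (simp add: summable_real_powr_iff)
    also have "\<dots> \<le> (K * u) ^ j * (E / (\<sigma> - 1))"
      using E(2)[OF \<sigma>] K u by (intro mult_left_mono) auto
    also have "\<dots> = 2 * E * K ^ j * u ^ Suc j"
      using u by (simp add: \<sigma>_def power_mult_distrib)
    finally show "(\<Sum>n. ln (real n) ^ j * real n powr (- (1 + 1 / u))) \<le> 2 * E * K ^ j * u ^ Suc j" .
  qed
qed

text \<open>Up to sign, the weight of \<open>mangoldt n - 1\<close> in the averaged k-th derivative
  at Re s = 1 + 1 / u.\<close>

definition gauss_weight :: "nat \<Rightarrow> real \<Rightarrow> real \<Rightarrow> nat \<Rightarrow> real" where
  "gauss_weight k u w n = ln (real n) ^ k * real n powr (- (1 + 1 / u)) * exp (- (((ln (real n) - u) / w)\<^sup>2) / 2)"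

lemma gauss_weight_nonneg: "gauss_weight k u w n \<ge> 0"
  by (cases "n = 0") (auto simp: gauss_weight_def)

lemma gauss_weight_le: "gauss_weight k u w n \<le> ln (real n) ^ k * real n powr (- (1 + 1 / u))"
  unfolding gauss_weight_def by (cases "n = 0") (auto intro!: mult_left_le)

lemma summable_gauss_weight:
  assumes "u \<ge> 2"
  shows "summable (gauss_weight k u w)" "summable (\<lambda>n. mangoldt n * gauss_weight k u w n)"
proof -
  have sm: "summable (\<lambda>n. ln (real n) ^ j * real n powr (- (1 + 1 / u)))" for j
    using sum_ln_power_powr_le[of j] assms by auto
  show "summable (gauss_weight k u w)"
    by (rule summable_comparison_test'[OF sm[of k]]) (use gauss_weight_le gauss_weight_nonneg in auto)
  show "summable (\<lambda>n. mangoldt n * gauss_weight k u w n)"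
  proof (rule summable_comparison_test'[OF sm[of "Suc k"]])
    fix n :: nat
    show "norm (mangoldt n * gauss_weight k u w n) \<le> ln (real n) ^ Suc k * real n powr (- (1 + 1 / u))"
    proof (cases "n = 0")
      case False
      have "mangoldt n * gauss_weight k u w n \<le> ln (real n) * (ln (real n) ^ k * real n powr (- (1 + 1 / u)))"
        using False by (intro mult_mono mangoldt_le gauss_weight_le gauss_weight_nonneg) auto
      then show ?thesis by (simp add: abs_mult mangoldt_nonneg gauss_weight_nonneg mult.assoc)
    qed simp
  qed
qed

text \<open>There are about w e^u or more integers between e^u and e^(u + w); for each of them the
  Gaussian is at least e^(-1/2) and n^(-1 - 1/u) is of order e^-u.\<close>

lemma gauss_weight_sum_lower:
  assumes u: "u \<ge> 2" and w: "0 < w" "w \<le> 1" and big: "2 \<le> exp u * w"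
  shows "exp (-5) * u ^ k * w \<le> (\<Sum>n. gauss_weight k u w n)"
proof -
  define N where "N = {nat \<lceil>exp u\<rceil>..nat \<lfloor>exp (u + w)\<rfloor>}"
  have inN: "exp u \<le> real n" "real n \<le> exp (u + w)" if "n \<in> N" for n
  proof -
    have n: "nat \<lceil>exp u\<rceil> \<le> n" "n \<le> nat \<lfloor>exp (u + w)\<rfloor>" using that by (auto simp: N_def)
    from n(1) show "exp u \<le> real n" by linarith
    have "real n \<le> real (nat \<lfloor>exp (u + w)\<rfloor>)" by (rule of_nat_mono[OF n(2)])
    also have "\<dots> \<le> exp (u + w)" by simp
    finally show "real n \<le> exp (u + w)" .
  qed
  have pos: "\<lfloor>exp (u + w)\<rfloor> \<ge> 0" "\<lceil>exp u\<rceil> \<ge> 0" by (auto intro: less_trans[of "-1" 0])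
  have "w \<le> exp w - 1" using exp_ge_add_one_self[of w] by linarith
  then have "exp u * w \<le> exp u * (exp w - 1)" by (rule mult_left_mono) simp
  then have "exp u * w \<le> exp (u + w) - exp u" by (simp add: exp_add algebra_simps)
  moreover have "real (card N) \<ge> exp (u + w) - exp u - 1"
    unfolding N_def card_atLeastAtMost using pos by linarith
  \<comment> \<open>By \<open>big\<close> the rounding loss 1 is at most half of w e^u.\<close>
  ultimately have cN: "exp u * w / 2 \<le> real (card N)" using big by linarith
  have lower: "u ^ k * exp (- u - 4) \<le> gauss_weight k u w n" if "n \<in> N" for n
  proof -
    have n: "real n > 0" using inN(1)[OF that] exp_gt_zero[of u] by linarith
    have l: "u \<le> ln (real n)" "ln (real n) \<le> u + w"
      using inN[OF that] n by (simp_all add: ln_ge_iff ln_le_cancel_iff[of _ "exp _", simplified])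
    have "u ^ k \<le> ln (real n) ^ k" using l u by (intro power_mono) auto
    moreover have "exp (- u - 4 + 1/2) \<le> real n powr (- (1 + 1 / u))"
    proof -
      have "ln (real n) * (1 + 1 / u) \<le> (u + w) * (1 + 1 / u)"
        using l u by (intro mult_right_mono) auto
      also have "\<dots> = u + w + 1 + w / u" using u by (simp add: field_simps)
      also have "w / u \<le> 1 / 2" using w u by (intro frac_le) auto
      also have "u + w + 1 + 1 / 2 \<le> u + 4 - 1/2" using w by simp
      finally show ?thesis using n by (simp add: powr_def algebra_simps)
    qed
    moreover have "exp (- 1/2) \<le> exp (- (((ln (real n) - u) / w)\<^sup>2) / 2)"
    proof -
      have "((ln (real n) - u) / w)\<^sup>2 \<le> 1\<^sup>2" using l w by (intro power_mono) auto
      then show ?thesis by simp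
    qed
    ultimately have "u ^ k * exp (- u - 4 + 1/2) * exp (- 1/2) \<le> gauss_weight k u w n"
      unfolding gauss_weight_def using u l by (intro mult_mono) auto
    moreover have "exp (- u - 4 + 1/2) * exp (- 1/2) = exp (- u - 4)"
      unfolding exp_add[symmetric] by simp
    ultimately show ?thesis by (simp only: mult.assoc)
  qed
  have "exp (-5) * u ^ k * w \<le> exp (-4) / 2 * u ^ k * w"
  proof -
    have "exp (-5 :: real) = exp (-4) / exp 1" by (simp flip: exp_diff)
    also have "\<dots> \<le> exp (-4) / 2" using exp_ge_add_one_self[of 1] by (intro divide_left_mono) auto
    finally show ?thesis using u w by (intro mult_right_mono) auto
  qed
  also have "\<dots> = (exp u * w / 2) * (u ^ k * exp (- u - 4))"
    by (simp add: exp_diff exp_minus field_simps)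
  also have "\<dots> \<le> real (card N) * (u ^ k * exp (- u - 4))"
    using cN u by (intro mult_right_mono) auto
  also have "\<dots> \<le> (\<Sum>n\<in>N. gauss_weight k u w n)"
    using sum_mono[of N "\<lambda>_. u ^ k * exp (- u - 4)" "gauss_weight k u w"] lower by simp
  also have "\<dots> \<le> (\<Sum>n. gauss_weight k u w n)"
    by (rule sum_le_suminf[OF summable_gauss_weight(1)[OF u]]) (auto simp: N_def gauss_weight_nonneg)
  finally show ?thesis .
qed

text \<open>A prime power p^k \<le> exp (2 y) with k \<ge> 2 has p \<le> exp y, and k \<le> 4 y
  because p \<ge> 2 > exp (1/2); the pairs (p, k) are counted.\<close>

lemma card_proper_primepow_le:
  assumes N: "finite N" "\<And>n. n \<in> N \<Longrightarrow> primepow n \<and> \<not> prime n \<and> real n \<le> exp (2 * y)" and y: "y \<ge> 0"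
  shows "real (card N) \<le> (exp y + 1) * (4 * y + 1)"
proof -
  define P where "P = {..nat \<lfloor>exp y\<rfloor>} \<times> {..nat \<lfloor>4 * y\<rfloor>}"
  have "N \<subseteq> (\<lambda>(p, e). p ^ e) ` P"
  proof
    fix n assume "n \<in> N"
    then have n: "primepow n" "\<not> prime n" "real n \<le> exp (2 * y)" using N(2) by auto
    then obtain p e where pe: "prime p" "e > 0" "n = p ^ e" by (auto simp: primepow_def)
    have "e \<noteq> 1" using pe n by auto
    then have e: "e \<ge> 2" using pe by simp
    have p: "real p \<ge> 2" using prime_ge_2_nat[OF pe(1)] by simp
    have "real p ^ 2 \<le> real p ^ e" using e p by (intro power_increasing) auto
    also have "\<dots> \<le> exp y ^ 2" using n(3) pe by (simp add: exp_double)
    finally have "real p \<le> exp y" by (rule power2_le_imp_le) auto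
    then have 1: "p \<le> nat \<lfloor>exp y\<rfloor>" by (simp add: le_nat_floor)
    have "exp (real e * (1/2)) \<le> real p ^ e"
    proof -
      have "exp (1/2 :: real) \<le> real p"
      proof (rule power2_le_imp_le)
        have "exp (1/2 :: real) ^ 2 = exp 1" by (simp flip: exp_of_nat_mult)
        also have "\<dots> \<le> 2 ^ 2" using exp_le by simp
        also have "\<dots> \<le> real p ^ 2" using p by (intro power_mono) auto
        finally show "exp (1/2 :: real) ^ 2 \<le> real p ^ 2" .
      qed simp
      then have "exp (1/2 :: real) ^ e \<le> real p ^ e" by (intro power_mono) auto
      then show ?thesis by (simp only: exp_of_nat_mult)
    qed
    also have "\<dots> \<le> exp (2 * y)" using n(3) pe by simp
    finally have "real e \<le> 4 * y" by simp
    then have 2: "e \<le> nat \<lfloor>4 * y\<rfloor>" by (simp add: le_nat_floor)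
    show "n \<in> (\<lambda>(p, e). p ^ e) ` P" using 1 2 pe(3) by (auto simp: P_def)
  qed
  then have "card N \<le> card P" by (rule surj_card_le[rotated]) (simp add: P_def)
  also have "card P = (nat \<lfloor>exp y\<rfloor> + 1) * (nat \<lfloor>4 * y\<rfloor> + 1)" by (simp add: P_def card_cartesian_product)
  finally have "real (card N) \<le> real ((nat \<lfloor>exp y\<rfloor> + 1) * (nat \<lfloor>4 * y\<rfloor> + 1))" by (rule of_nat_mono)
  also have "\<dots> = (real (nat \<lfloor>exp y\<rfloor>) + 1) * (real (nat \<lfloor>4 * y\<rfloor>) + 1)"
    by (simp only: of_nat_mult of_nat_add of_nat_1)
  also have "\<dots> \<le> (exp y + 1) * (4 * y + 1)"
    using y by (intro mult_mono add_right_mono of_nat_floor) auto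
  finally show ?thesis .
qed

text \<open>The width \<delta> / sqrt u makes the Gaussian at most exp (-u/2) outside the window,
  which beats every power of u. Inside there are only proper prime powers, O(u exp (u/2)) of them,
  each contributing O(u^(k + 1) exp (-u)). Both parts are bounded in u.\<close>

lemma mangoldt_gauss_weight_upper:
  "\<exists>C>0. \<forall>u \<delta>. 2 \<le> u \<longrightarrow> 0 < \<delta> \<longrightarrow> \<delta> \<le> 1 \<longrightarrow> (\<forall>p. prime p \<longrightarrow> \<delta> \<le> \<bar>ln (real p) - u\<bar>) \<longrightarrow>
     (\<Sum>n. mangoldt n * gauss_weight k u (\<delta> / sqrt u) n) \<le> C"
proof -
  obtain E where E: "E > 0" "\<And>u. u \<ge> 2 \<Longrightarrow> summable (\<lambda>n. ln (real n) ^ Suc k * real n powr (- (1 + 1 / u)))"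
      "\<And>u. u \<ge> 2 \<Longrightarrow> (\<Sum>n. ln (real n) ^ Suc k * real n powr (- (1 + 1 / u))) \<le> E * u ^ Suc (Suc k)"
    using sum_ln_power_powr_le[of "Suc k"] by auto
  define D where "D = E + 10 * 2 ^ Suc k * exp (3/2)"
  show ?thesis
  proof (intro exI[of _ "D * (2 ^ (k + 2) * fact (k + 2))"] conjI allI impI)
    show "D * (2 ^ (k + 2) * fact (k + 2)) > 0" using E(1) by (simp add: D_def add_pos_pos)
    fix u \<delta> :: real
    assume u: "2 \<le> u" and \<delta>: "0 < \<delta>" "\<delta> \<le> 1" and gap: "\<forall>p. prime p \<longrightarrow> \<delta> \<le> \<bar>ln (real p) - u\<bar>"
    define w where "w = \<delta> / sqrt u"
    define N where "N = {n. primepow n \<and> \<bar>ln (real n) - u\<bar> < \<delta>}"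
    have Nn: "exp (u - 1) \<le> real n" "real n \<le> exp (u + 1)" "n > 1" if "n \<in> N" for n
    proof -
      show "n > 1" using that primepow_gt_Suc_0[of n] by (auto simp: N_def)
      then have n0: "real n > 0" by simp
      have "u - 1 \<le> ln (real n)" "ln (real n) \<le> u + 1" using that \<delta> by (auto simp: N_def)
      then have "exp (u - 1) \<le> exp (ln (real n))" "exp (ln (real n)) \<le> exp (u + 1)" by simp_all
      then show "exp (u - 1) \<le> real n" "real n \<le> exp (u + 1)" using n0 by simp_all
    qed
    have finN: "finite N"
    proof (rule finite_subset)
      show "N \<subseteq> {..nat \<lfloor>exp (u + 1)\<rfloor>}" using Nn(2) by (auto simp: le_nat_floor)
    qed simp
    have cardN: "real (card N) \<le> (exp ((u + 1) / 2) + 1) * (4 * ((u + 1) / 2) + 1)"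
    proof (rule card_proper_primepow_le[OF finN])
      fix n assume "n \<in> N"
      moreover have "2 * ((u + 1) / 2) = u + 1" by simp
      ultimately show "primepow n \<and> \<not> prime n \<and> real n \<le> exp (2 * ((u + 1) / 2))"
        using Nn(2)[of n] gap by (auto simp only: N_def mem_Collect_eq)
    qed (use u in auto)
    define M where "M = (u + 1) ^ Suc k * exp (1 - u)"
    have M: "M \<ge> 0" using u by (simp add: M_def)
    have pt: "mangoldt n * gauss_weight k u w n \<le>
        exp (- u / 2) * (ln (real n) ^ Suc k * real n powr (- (1 + 1 / u))) + (if n \<in> N then M else 0)" (is "?l \<le> ?r") for n
    proof (cases "primepow n")
      case True
      then have n1: "n > 1" using primepow_gt_Suc_0[of n] by simp
      have m1: "mangoldt n \<le> ln (real n)" using n1 by (intro mangoldt_le) auto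
      show ?thesis
      proof (cases "n \<in> N")
        case nN: True
        have l: "0 \<le> ln (real n)" "ln (real n) \<le> u + 1" using nN \<delta> n1 by (auto simp: N_def)
        have "?l \<le> ln (real n) * (ln (real n) ^ k * real n powr (- (1 + 1 / u)))"
          by (intro mult_mono m1 gauss_weight_le gauss_weight_nonneg l)
        also have "\<dots> = ln (real n) ^ Suc k * real n powr (- (1 + 1 / u))" by simp
        also have "\<dots> \<le> (u + 1) ^ Suc k * exp (1 - u)"
        proof (intro mult_mono power_mono l)
          have "real n powr (- (1 + 1 / u)) \<le> real n powr (- 1)" using n1 u by (intro powr_mono) auto
          also have "\<dots> \<le> exp (u - 1) powr (- 1)" using Nn(1)[OF nN] by (intro powr_mono2') auto
          also have "\<dots> = exp (1 - u)" by (simp add: powr_def)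
          finally show "real n powr (- (1 + 1 / u)) \<le> exp (1 - u)" .
        qed (use u in auto)
        also have "\<dots> \<le> ?r" using nN n1 by (simp add: M_def)
        finally show ?thesis .
      next
        case nN: False
        then have far: "\<delta> \<le> \<bar>ln (real n) - u\<bar>" using True by (auto simp: N_def)
        have "u = (\<delta> / w)\<^sup>2" using u \<delta> by (simp add: w_def power_divide)
        also have "\<dots> \<le> (\<bar>ln (real n) - u\<bar> / w)\<^sup>2"
          using far \<delta> u by (intro power_mono divide_right_mono) (auto simp: w_def)
        also have "\<dots> = ((ln (real n) - u) / w)\<^sup>2" by (simp add: power_divide)
        finally have ex: "exp (- (((ln (real n) - u) / w)\<^sup>2) / 2) \<le> exp (- u / 2)" by simp
        have "?l \<le> ln (real n) * (ln (real n) ^ k * real n powr (- (1 + 1 / u)) * exp (- u / 2))"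
          unfolding gauss_weight_def using n1 ex
          by (intro mult_mono m1 mult_nonneg_nonneg) auto
        also have "\<dots> = ?r" using nN by (simp add: mult_ac)
        finally show ?thesis .
      qed
    next
      case False
      then have "?l = 0" "n \<notin> N" by (auto simp: mangoldt_def N_def)
      then show ?thesis by (cases "n = 0") auto
    qed
    have s1: "summable (\<lambda>n. exp (- u / 2) * (ln (real n) ^ Suc k * real n powr (- (1 + 1 / u))))"
      by (intro summable_mult E(2) u)
    have s2: "(\<lambda>n. if n \<in> N then M else 0) sums (\<Sum>n\<in>N. M)" by (rule sums_If_finite_set[OF finN])
    have e1: "1 \<le> exp ((u + 1) / 2)" using u by simp
    have "(\<Sum>n. mangoldt n * gauss_weight k u w n)
        \<le> (\<Sum>n. exp (- u / 2) * (ln (real n) ^ Suc k * real n powr (- (1 + 1 / u))) + (if n \<in> N then M else 0))"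
      by (rule suminf_le[OF pt summable_gauss_weight(2)[OF u] summable_add[OF s1 sums_summable[OF s2]]])
    also have "\<dots> = exp (- u / 2) * (\<Sum>n. ln (real n) ^ Suc k * real n powr (- (1 + 1 / u))) + real (card N) * M"
      using suminf_add[OF s1 sums_summable[OF s2]] suminf_mult[OF E(2)[OF u], of "exp (- u / 2)"] s2
      by (simp add: sums_iff)
    also have "\<dots> \<le> exp (- u / 2) * (E * u ^ (k + 2)) + (2 * exp ((u + 1) / 2) * (5 * u)) * ((2 * u) ^ Suc k * exp (1 - u))"
    proof (intro add_mono mult_mono)
      show "(\<Sum>n. ln (real n) ^ Suc k * real n powr (- (1 + 1 / u))) \<le> E * u ^ (k + 2)" using E(3)[OF u] by simp
      show "0 \<le> (\<Sum>n. ln (real n) ^ Suc k * real n powr (- (1 + 1 / u)))"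
      proof (rule suminf_nonneg[OF E(2)[OF u]])
        show "0 \<le> ln (real n) ^ Suc k * real n powr (- (1 + 1 / u))" for n by (cases "n = 0") auto
      qed
      have "(exp ((u + 1) / 2) + 1) * (4 * ((u + 1) / 2) + 1) \<le> 2 * exp ((u + 1) / 2) * (5 * u)"
      proof (intro mult_mono)
        show "4 * ((u + 1) / 2) + 1 \<le> 5 * u" using u by (simp add: field_simps)
      qed (use u e1 in auto)
      with cardN show "real (card N) \<le> 2 * exp ((u + 1) / 2) * (5 * u)" by linarith
      show "M \<le> (2 * u) ^ Suc k * exp (1 - u)" unfolding M_def using u by (intro mult_right_mono power_mono) auto
    qed (use M u in auto)
    also have "\<dots> = D * (u ^ (k + 2) * exp (- u / 2))"
    proof -
      have "exp ((u + 1) / 2) * exp (1 - u) = exp (3/2) * exp (- u / 2)"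
        by (simp flip: exp_add add: field_simps)
      then have "(2 * exp ((u + 1) / 2) * (5 * u)) * ((2 * u) ^ Suc k * exp (1 - u)) = 10 * 2 ^ Suc k * (u ^ (k + 2)) * (exp (3/2) * exp (- u / 2))"
        by (simp add: power_mult_distrib mult_ac)
      then show ?thesis by (simp add: D_def algebra_simps)
    qed
    also have "u ^ (k + 2) * exp (- u / 2) \<le> 2 ^ (k + 2) * fact (k + 2)"
    proof -
      have "(u / 2) ^ (k + 2) \<le> fact (k + 2) * exp (u / 2)" using u by (intro power_le_fact_mult_exp) auto
      then have "u ^ (k + 2) \<le> 2 ^ (k + 2) * fact (k + 2) * exp (u / 2)"
        unfolding power_divide by (subst (asm) pos_divide_le_eq) (simp_all only: mult_ac zero_less_power zero_less_numeral)
      then have "u ^ (k + 2) * exp (- u / 2) \<le> 2 ^ (k + 2) * fact (k + 2) * exp (u / 2) * exp (- u / 2)"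
        by (intro mult_right_mono) auto
      also have "\<dots> = 2 ^ (k + 2) * fact (k + 2)" by (simp add: mult.assoc flip: exp_add)
      finally show ?thesis .
    qed
    finally show "(\<Sum>n. mangoldt n * gauss_weight k u (\<delta> / sqrt u) n) \<le> D * (2 ^ (k + 2) * fact (k + 2))"
      using E(1) by (simp add: w_def D_def mult_left_mono)
  qed
qed

section \<open>From prime-free windows to fibres of the prime counting function\<close>

text \<open>If no ln p is closer than \<delta> to u, the integers near exp u have no primes to
  balance them, so u^k w = O(1 / w + 1) and hence u^k w^2 = O(1). With w = \<delta> / sqrt u and k =
  2 A + 1 the left side is (\<delta> u^A)^2.\<close>

theorem prime_free_window:
  "\<exists>C>0. \<forall>u \<delta>. 2 \<le> u \<longrightarrow> 0 < \<delta> \<longrightarrow> \<delta> \<le> 1 \<longrightarrow> (\<forall>p. prime p \<longrightarrow> \<delta> \<le> \<bar>ln (real p) - u\<bar>) \<longrightarrow>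
     \<delta> * u ^ A \<le> C"
proof -
  define k where "k = Suc (2 * A)"
  obtain C1 where C1: "C1 > 0" "\<And>u w. 2 \<le> u \<Longrightarrow> 0 < w \<Longrightarrow> w \<le> 1 \<Longrightarrow>
     \<bar>\<Sum>n. (mangoldt n - 1) * gauss_weight k u w n\<bar> \<le> C1 / w"
    using mangoldt_gaussian_average[of k] unfolding gauss_weight_def by blast
  obtain C2 where C2: "C2 > 0" "\<And>u \<delta>. 2 \<le> u \<Longrightarrow> 0 < \<delta> \<Longrightarrow> \<delta> \<le> 1 \<Longrightarrow> \<forall>p. prime p \<longrightarrow> \<delta> \<le> \<bar>ln (real p) - u\<bar> \<Longrightarrow>
     (\<Sum>n. mangoldt n * gauss_weight k u (\<delta> / sqrt u) n) \<le> C2"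
    using mangoldt_gauss_weight_upper[of k] by blast
  define C3 where "C3 = (C1 + C2) * exp 5"
  have C3: "C3 > 0" using C1 C2 by (simp add: C3_def)
  define C4 where "C4 = max (sqrt C3) (2 * fact (Suc A))"
  show ?thesis
  proof (intro exI[of _ C4] conjI allI impI)
    show "C4 > 0" using C3 by (simp add: C4_def less_max_iff_disj)
    fix u \<delta> :: real
    assume u: "2 \<le> u" and \<delta>: "0 < \<delta>" "\<delta> \<le> 1" and gap: "\<forall>p. prime p \<longrightarrow> \<delta> \<le> \<bar>ln (real p) - u\<bar>"
    define w where "w = \<delta> / sqrt u"
    have su: "sqrt u \<ge> 1" using u by simp
    have w: "w > 0" "w \<le> 1" using \<delta> su u by (auto simp: w_def pos_divide_le_eq intro: order_trans)
    have \<delta>w: "\<delta> = w * sqrt u" using u by (simp add: w_def)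
    show "\<delta> * u ^ A \<le> C4"
    proof (cases "2 \<le> exp u * w")
      case True
      note sg = summable_gauss_weight[OF u, of k w]
      have "(\<Sum>n. (mangoldt n - 1) * gauss_weight k u w n) = (\<Sum>n. mangoldt n * gauss_weight k u w n) - (\<Sum>n. gauss_weight k u w n)"
        using suminf_diff[OF sg(2,1)] by (simp add: algebra_simps)
      then have "(\<Sum>n. gauss_weight k u w n) \<le> C1 / w + C2"
        using C1(2)[OF u w] C2(2)[OF u \<delta> gap] by (simp add: w_def)
      also have "C2 \<le> C2 / w" using C2 w by (simp add: field_simps)
      finally have "exp (-5) * u ^ k * w \<le> C1 / w + C2 / w"
        using gauss_weight_sum_lower[OF u w True, of k] by linarith
      then have "exp 5 * w * (exp (-5) * u ^ k * w) \<le> exp 5 * w * (C1 / w + C2 / w)"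
        using w by (intro mult_left_mono) auto
      also have "exp 5 * w * (C1 / w + C2 / w) = C3" using w by (simp add: C3_def field_simps)
      also have "exp 5 * w * (exp (-5) * u ^ k * w) = (\<delta> * u ^ A)\<^sup>2"
      proof -
        have uk: "u ^ k = u * (u ^ A)\<^sup>2" by (simp add: k_def mult.commute flip: power_mult)
        have ee: "exp 5 * exp (-5) = (1 :: real)" by (simp flip: exp_add)
        have "exp 5 * w * (exp (-5) * u ^ k * w) = (exp 5 * exp (-5)) * (w\<^sup>2 * u ^ k)"
          by (simp only: power2_eq_square mult_ac)
        also have "\<dots> = w\<^sup>2 * (sqrt u)\<^sup>2 * (u ^ A)\<^sup>2"
          using u by (simp add: ee uk)
        finally show ?thesis by (simp only: \<delta>w power_mult_distrib)
      qed
      finally have "\<delta> * u ^ A \<le> sqrt C3" by (rule real_le_rsqrt)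
      then show ?thesis by (simp add: C4_def)
    next
      case False
      \<comment> \<open>Here w is at most of the order of the spacing of the logarithms of integers
        near exp u, and \<delta> is small enough by itself.\<close>
      then have "w \<le> 2 * exp (- u)" by (simp add: exp_minus field_simps)
      then have "\<delta> * u ^ A \<le> (2 * exp (- u) * u) * u ^ A"
        unfolding \<delta>w using u w su by (intro mult_right_mono mult_mono real_le_lsqrt) (auto simp: power2_eq_square)
      also have "\<dots> = 2 * exp (- u) * u ^ Suc A" by simp
      also have "\<dots> \<le> 2 * exp (- u) * (fact (Suc A) * exp u)"
        using u by (intro mult_left_mono power_le_fact_mult_exp) auto
      also have "\<dots> = 2 * fact (Suc A)" by (simp add: exp_minus field_simps)
      also have "\<dots> \<le> C4" by (simp add: C4_def)
      finally show ?thesis .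
    qed
  qed
qed

lemma power_le_two_power: "(real j + 1) ^ A \<le> 2 ^ Suc A * fact A * 2 ^ j"
proof -
  have "((real j + 1) / 2) ^ A \<le> fact A * exp ((real j + 1) / 2)"
    by (rule power_le_fact_mult_exp) simp
  also have "exp ((real j + 1) / 2) = exp (1/2) ^ Suc j"
    unfolding exp_of_nat_mult[symmetric] by (simp add: field_simps)
  also have "\<dots> \<le> 2 ^ Suc j"
  proof (rule power_mono)
    show "exp (1/2) \<le> (2::real)"
    proof (rule power2_le_imp_le)
      have "exp (1/2 :: real) ^ 2 = exp 1" by (simp flip: exp_of_nat_mult)
      then show "exp (1/2 :: real) ^ 2 \<le> 2 ^ 2" using exp_le by simp
    qed simp
  qed simp
  finally have "(real j + 1) ^ A / 2 ^ A \<le> fact A * 2 ^ Suc j" by (simp add: power_divide)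
  then show ?thesis by (simp add: field_simps)
qed

lemma prime_counting_less:
  assumes "prime p" "x < p" "p \<le> y"
  shows "prime_counting x < prime_counting y"
  unfolding prime_counting_def
proof (rule psubset_card_mono)
  show "finite {p. prime p \<and> p \<le> y}" by (rule finite_subset[of _ "{..y}"]) auto
  show "{p. prime p \<and> p \<le> x} \<subset> {p. prime p \<and> p \<le> y}" 
  proof (rule psubsetI)
    show "{p. prime p \<and> p \<le> x} \<subseteq> {p. prime p \<and> p \<le> y}" using assms by auto
    have "p \<in> {p. prime p \<and> p \<le> y}" "p \<notin> {p. prime p \<and> p \<le> x}" using assms by auto
    then show "{p. prime p \<and> p \<le> x} \<noteq> {p. prime p \<and> p \<le> y}" by blast
  qed
qed

text \<open>If x and y are the extreme members of a fibre, no prime lies in (x, y], so the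
  logarithms of the primes avoid a neighbourhood of ln ((x + y) / 2) of width proportional to (y -
  x) / (x + y).\<close>

theorem prime_counting_fibre:
  "\<exists>C. \<forall>j k. real (card {m \<in> {2 ^ j..<2 ^ Suc j}. prime_counting m = k}) \<le> C * 2 ^ j / (real j + 1) ^ A"
proof -
  obtain C0 where C0: "C0 > 0" "\<And>u \<delta>. 2 \<le> u \<Longrightarrow> 0 < \<delta> \<Longrightarrow> \<delta> \<le> 1 \<Longrightarrow> \<forall>p. prime p \<longrightarrow> \<delta> \<le> \<bar>ln (real p) - u\<bar> \<Longrightarrow> \<delta> * u ^ A \<le> C0"
    using prime_free_window[of A] by blast
  define C where "C = 8 * C0 * 4 ^ A + 5 ^ A + 2 ^ Suc A * fact A"
  have C: "C > 0" unfolding C_def using C0(1) by (intro add_pos_pos) auto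
  show ?thesis
  proof (intro exI[of _ C] allI)
    fix j k :: nat
    define S where "S = {m \<in> {2 ^ j..<2 ^ Suc j}. prime_counting m = k}"
    define l where "l = real j + 1"
    have l: "l > 0" by (simp add: l_def)
    have finS: "finite S" by (simp add: S_def)
    have cS: "real (card S) * l ^ A \<le> C * 2 ^ j"
    proof (cases "j < 4")
      \<comment> \<open>Small blocks satisfy the bound trivially; j \<ge> 4 is what gives u \<ge> 2
        below.\<close>
      case True
      have "card S \<le> card {2 ^ j..<2 ^ Suc j :: nat}" by (rule card_mono) (auto simp: S_def)
      then have "real (card S) \<le> real (2 ^ j)" by (intro of_nat_mono) simp
      moreover have "l ^ A \<le> 5 ^ A" using True by (intro power_mono) (auto simp: l_def)
      ultimately have "real (card S) * l ^ A \<le> 2 ^ j * 5 ^ A" using l by (intro mult_mono) auto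
      also have "5 ^ A \<le> C" using C0(1) by (simp add: C_def)
      finally show ?thesis by (simp add: mult.commute)
    next
      case False
      show ?thesis
      proof (cases "S = {}")
        case True
        then show ?thesis using C by simp
      next
        case nonempty: False
        define x y where "x = Min S" and "y = Max S"
        have xy: "x \<in> S" "y \<in> S" "\<And>m. m \<in> S \<Longrightarrow> x \<le> m \<and> m \<le> y"
          using finS nonempty by (auto simp: x_def y_def)
        have "x \<le> y" using xy by auto
        have xb: "2 ^ j \<le> x" "y < 2 ^ Suc j" using xy by (auto simp: S_def)
        have "card S \<le> card {x..y}" by (rule card_mono) (use xy in auto)
        then have card: "real (card S) \<le> real y - real x + 1" using \<open>x \<le> y\<close> by simp
        have d: "(real y - real x) * l ^ A \<le> 8 * C0 * 4 ^ A * 2 ^ j"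
        proof (cases "x = y")
          case True
          then show ?thesis using C0(1) by simp
        next
          case False
          then have "x < y" using \<open>x \<le> y\<close> by simp
          have x0: "real x > 0" using xb(1) by (metis gr0I le_zero_eq of_nat_0_less_iff power_eq_0_iff zero_neq_numeral)
          have y0: "real y > 0" using x0 \<open>x < y\<close> by simp
          define u where "u = ln ((real x + real y) / 2)"
          \<comment> \<open>By ln t \<le> t - 1, the distance of u to ln p is at least 2 \<delta>
            for p \<le> x, and at least (y - x) / (2 y) \<ge> \<delta> for p > y.\<close>
          define \<delta> where "\<delta> = (real y - real x) / (2 * (real x + real y))"
          have \<delta>: "\<delta> > 0" "\<delta> \<le> 1" using x0 \<open>x < y\<close> by (auto simp: \<delta>_def field_simps)
          have gap: "\<delta> \<le> \<bar>ln (real p) - u\<bar>" if p: "prime p" for p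
          proof (cases "p \<le> x")
            case True
            have p0: "real p > 0" using prime_gt_0_nat[OF p] by simp
            have "ln (real p) \<le> ln (real x)" using True p0 by simp
            moreover have "ln (real x) - u = ln (2 * real x / (real x + real y))"
              using ln_div[of "real x" "(real x + real y) / 2"] x0 y0 by (simp add: u_def mult.commute)
            moreover have "\<dots> \<le> 2 * real x / (real x + real y) - 1"
              using x0 y0 by (intro ln_le_minus_one) auto
            moreover have "2 * real x / (real x + real y) - 1 = - (2 * \<delta>)"
              using x0 y0 by (simp add: \<delta>_def field_simps)
            ultimately show ?thesis using \<delta> by linarith
          next
            case False
            have "p > y"
            proof (rule ccontr)
              assume "\<not> p > y"
              then have "prime_counting x < prime_counting y" using False p by (intro prime_counting_less) auto
              then show False using xy by (auto simp: S_def)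
            qed
            then have "ln (real y) \<le> ln (real p)" using y0 by simp
            moreover have "u - ln (real y) = ln ((real x + real y) / (2 * real y))"
              using ln_div[of "(real x + real y) / 2" "real y"] x0 y0 by (simp add: u_def)
            moreover have "\<dots> \<le> (real x + real y) / (2 * real y) - 1"
              using x0 y0 by (intro ln_le_minus_one) auto
            moreover have "(real x + real y) / (2 * real y) - 1 = - ((real y - real x) / (2 * real y))"
              using x0 y0 by (simp add: field_simps)
            moreover have "\<delta> \<le> (real y - real x) / (2 * real y)"
              unfolding \<delta>_def using x0 y0 \<open>x < y\<close> by (intro divide_left_mono) auto
            ultimately show ?thesis by linarith
          qed
          have "real (2 ^ j) \<le> real x" using xb(1) by (rule of_nat_mono)
          moreover have "real x < real y" using \<open>x < y\<close> by simp
          ultimately have "real (2 ^ j) \<le> (real x + real y) / 2"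
            by (subst pos_le_divide_eq) (simp, linarith)
          then have "ln (real (2 ^ j)) \<le> u" unfolding u_def by (intro ln_mono) auto
          then have "real j * ln 2 \<le> u" by (simp add: ln_realpow)
          moreover have "real j * (1/2) \<le> real j * ln 2" using ln2_ge_two_thirds by (intro mult_left_mono) auto
          ultimately have u: "real j / 2 \<le> u" by simp
          have u2: "2 \<le> u" using u False \<open>\<not> j < 4\<close> by simp
          have "l / 4 \<le> u" using u \<open>\<not> j < 4\<close> by (simp add: l_def)
          then have "\<delta> * (l / 4) ^ A \<le> \<delta> * u ^ A" using l \<delta> by (intro mult_left_mono power_mono) auto
          also have "\<dots> \<le> C0" using C0(2)[OF u2 \<delta>] gap by blast
          finally have 1: "\<delta> * l ^ A \<le> C0 * 4 ^ A" by (simp add: power_divide field_simps)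
          have "real y < real (2 ^ Suc j)" using xb(2) by (rule of_nat_less_iff[THEN iffD2])
          then have "real x + real y \<le> 4 * 2 ^ j" using \<open>x < y\<close> by simp
          moreover have "real y - real x = 2 * \<delta> * (real x + real y)"
          proof -
            have "2 * (d / (2 * s)) * s = d" if "s > 0" for d s :: real using that by simp
            from this[of "real x + real y" "real y - real x"] show ?thesis using x0 y0 by (simp only: \<delta>_def)
          qed
          ultimately have "real y - real x \<le> 2 * \<delta> * (4 * 2 ^ j)" using \<delta> by (simp add: mult_left_mono)
          then have "(real y - real x) * l ^ A \<le> 2 * \<delta> * (4 * 2 ^ j) * l ^ A" using l by (intro mult_right_mono) auto
          also have "\<dots> = 8 * 2 ^ j * (\<delta> * l ^ A)" by simp
          also have "\<dots> \<le> 8 * 2 ^ j * (C0 * 4 ^ A)" using 1 by (intro mult_left_mono) auto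
          finally show ?thesis by (simp add: mult_ac)
        qed
        have "real (card S) * l ^ A \<le> (real y - real x + 1) * l ^ A" using card l by (intro mult_right_mono) auto
        also have "\<dots> = (real y - real x) * l ^ A + l ^ A" by (simp add: algebra_simps)
        \<comment> \<open>The extra l^A stems from the + 1 in the count y - x + 1 and is absorbed
          into 2^j.\<close>
        also have "\<dots> \<le> 8 * C0 * 4 ^ A * 2 ^ j + 2 ^ Suc A * fact A * 2 ^ j"
          using power_le_two_power[of j A] d by (simp add: l_def)
        also have "\<dots> \<le> C * 2 ^ j" by (simp add: C_def algebra_simps)
        finally show ?thesis .
      qed
    qed
    show "real (card {m \<in> {2 ^ j..<2 ^ Suc j}. prime_counting m = k}) \<le> C * 2 ^ j / (real j + 1) ^ A"
      using cS l unfolding S_def l_def by (simp add: pos_le_divide_eq)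
  qed
qed

section \<open>Fibres of the totient function\<close>

lemma real_div_le: "real (a div b) \<le> real a / real b"
proof -
  have "real (a div b) = of_int \<lfloor>real a / real b\<rfloor>" by (simp add: floor_divide_of_nat_eq)
  then show ?thesis by (simp only: of_int_floor_le)
qed

text \<open>For a fixed exponent, p^(e - 1) (p - 1) is strictly increasing in p.\<close>

lemma totient_primepow_inj:
  assumes "prime p" "prime q" "e > 0" "totient (p ^ e) = totient (q ^ e)"
  shows "p = q"
proof -
  have less: "totient (a ^ e) < totient (b ^ e)" if "prime a" "prime b" "a < b" for a b :: nat
  proof -
    have "a \<ge> 2" using that prime_ge_2_nat by auto
    have "a ^ (e - 1) * (a - 1) < b ^ (e - 1) * (b - 1)"
    proof (rule mult_le_less_imp_less)
      show "a ^ (e - 1) \<le> b ^ (e - 1)" using that by (intro power_mono) auto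
    qed (use that \<open>a \<ge> 2\<close> in auto)
    then show ?thesis using that assms(3) by (simp add: totient_prime_power)
  qed
  from less[of p q] less[of q p] assms show ?thesis by (metis less_irrefl linorder_less_linear)
qed

text \<open>The members are encoded by pairs (cofactor, exponent). The cofactor is at most 2^(j + 1)
  / y because the component exceeds y, and the exponent is at most j + 1 because 2^e \<le> p^e \<le>
  m.\<close>

lemma card_totient_fibre_large_primepow:
  fixes y j k :: nat
  assumes "y > 0"
  shows "card {m \<in> {1..<2 ^ Suc j}. totient m = k \<and> (\<exists>p. prime p \<and> p dvd m \<and> y < p ^ multiplicity p m)}
           \<le> (2 ^ Suc j div y) * Suc j"
proof -
  define S where "S = {m \<in> {1..<2 ^ Suc j}. totient m = k \<and> (\<exists>p. prime p \<and> p dvd m \<and> y < p ^ multiplicity p m)}"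
  \<comment> \<open>The prime is chosen separately for each m. Injectivity does not depend on how:
    equal cofactors and exponents force equal totients of the two components, hence equal
    primes.\<close>
  define pf where "pf = (\<lambda>m. SOME p. prime p \<and> p dvd m \<and> y < p ^ multiplicity p m)"
  have pf: "prime (pf m)" "pf m dvd m" "y < pf m ^ multiplicity (pf m) m" if "m \<in> S" for m
  proof -
    have "\<exists>p. prime p \<and> p dvd m \<and> y < p ^ multiplicity p m" using that by (auto simp: S_def)
    from someI_ex[OF this] show "prime (pf m)" "pf m dvd m" "y < pf m ^ multiplicity (pf m) m"
      unfolding pf_def by auto
  qed
  define e where "e = (\<lambda>m. multiplicity (pf m) m)"
  define c where "c = (\<lambda>m. m div pf m ^ e m)"
  have dec: "m = pf m ^ e m * c m" "\<not> pf m dvd c m" "e m > 0" "c m > 0" if "m \<in> S" for m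
  proof -
    have m0: "m > 0" using that by (auto simp: S_def)
    show 1: "m = pf m ^ e m * c m" unfolding c_def e_def by (simp add: multiplicity_dvd)
    show "\<not> pf m dvd c m" unfolding c_def e_def using m0 pf[OF that] by (intro multiplicity_decompose) auto
    show "e m > 0" unfolding e_def using m0 pf[OF that] by (simp add: prime_multiplicity_gt_zero_iff)
    show "c m > 0" using 1 m0 by (metis mult_is_0 neq0_conv)
  qed
  have inj: "inj_on (\<lambda>m. (c m, e m)) S"
  proof (rule inj_onI)
    fix m n assume mn: "m \<in> S" "n \<in> S" "(c m, e m) = (c n, e n)"
    have tot: "totient m = totient (pf m ^ e m) * totient (c m)" if "m \<in> S" for m
    proof -
      have "coprime (pf m ^ e m) (c m)"
        using dec(2)[OF that] pf(1)[OF that] by (simp add: prime_imp_coprime coprime_power_left_iff)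
      then show ?thesis using dec(1)[OF that] totient_mult_coprime by metis
    qed
    have "totient m = totient n" using mn by (simp add: S_def)
    then have "totient (pf m ^ e m) = totient (pf n ^ e m)"
      using tot[OF mn(1)] tot[OF mn(2)] mn(3) dec(4)[OF mn(2)] by simp
    then have "pf m = pf n"
      by (rule totient_primepow_inj[OF pf(1)[OF mn(1)] pf(1)[OF mn(2)] dec(3)[OF mn(1)]])
    then have "pf m ^ e m * c m = pf n ^ e n * c n" using mn(3) by simp
    then show "m = n" unfolding dec(1)[OF mn(1), symmetric] dec(1)[OF mn(2), symmetric] .
  qed
  have sub: "(\<lambda>m. (c m, e m)) ` S \<subseteq> {1..2 ^ Suc j div y} \<times> {1..Suc j}"
  proof (clarify)
    fix m assume m: "m \<in> S"
    have mX: "m < 2 ^ Suc j" using m by (auto simp: S_def)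
    have "c m * y \<le> c m * pf m ^ e m" using pf(3)[OF m] by (simp add: e_def)
    also have "\<dots> \<le> 2 ^ Suc j" using dec(1)[OF m] mX by (simp add: mult.commute)
    finally have 1: "c m \<le> 2 ^ Suc j div y" using assms by (simp add: less_eq_div_iff_mult_less_eq)
    have "2 ^ e m \<le> pf m ^ e m" using prime_ge_2_nat[OF pf(1)[OF m]] by (rule power_mono) simp
    also have "\<dots> \<le> m" using dec(1)[OF m] dec(4)[OF m] by (metis One_nat_def Suc_leI mult.right_neutral mult_le_mono2)
    also have "\<dots> < 2 ^ Suc j" by (rule mX)
    finally have 2: "e m < Suc j" by (rule power_less_imp_less_exp[rotated]) simp
    show "c m \<in> {1..2 ^ Suc j div y} \<and> e m \<in> {1..Suc j}"
      using 1 2 dec(3,4)[OF m] by auto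
  qed
  have "card S = card ((\<lambda>m. (c m, e m)) ` S)" by (rule card_image[OF inj, symmetric])
  also have "\<dots> \<le> card ({1..2 ^ Suc j div y} \<times> {1..Suc j})" by (rule card_mono[OF _ sub]) simp
  also have "\<dots> = (2 ^ Suc j div y) * Suc j" by simp
  finally show ?thesis by (simp add: S_def)
qed

text \<open>Such an m is the product of a list of r numbers between 1 and y, namely its prime power
  components padded with ones; lists are counted.\<close>

lemma card_few_small_primepows:
  fixes y r :: nat
  assumes "y > 0"
  defines "S \<equiv> {m. m > 0 \<and> card (prime_factors m) \<le> r \<and> (\<forall>p. prime p \<longrightarrow> p dvd m \<longrightarrow> p ^ multiplicity p m \<le> y)}"
  shows "finite S" "card S \<le> y ^ r"
proof -
  define A where "A = {xs. set xs \<subseteq> {1..y} \<and> length xs = r}"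
  have A: "finite A" "card A = y ^ r" unfolding A_def by (simp_all add: finite_lists_length_eq card_lists_length_eq)
  have sub: "S \<subseteq> prod_list ` A"
  proof
    fix m assume m: "m \<in> S"
    then have m0: "m > 0" and cm: "card (prime_factors m) \<le> r"
      and le: "\<And>p. prime p \<Longrightarrow> p dvd m \<Longrightarrow> p ^ multiplicity p m \<le> y" by (auto simp: S_def)
    obtain ps where ps: "set ps = prime_factors m" "distinct ps" using finite_distinct_list[of "prime_factors m"] by auto
    define xs where "xs = map (\<lambda>p. p ^ multiplicity p m) ps @ replicate (r - length ps) 1"
    have "length ps \<le> r" using ps cm by (metis distinct_card)
    then have "length xs = r" by (simp add: xs_def)
    moreover have "set xs \<subseteq> {1..y}"
    proof
      fix x assume "x \<in> set xs"
      then consider "x = 1" | p where "p \<in> prime_factors m" "x = p ^ multiplicity p m"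
        using ps by (auto simp: xs_def)
      then show "x \<in> {1..y}"
      proof cases
        case 1 then show ?thesis using assms(1) by simp
      next
        case 2
        then show ?thesis using le[of p] by (auto simp: in_prime_factors_iff prime_gt_0_nat Suc_le_eq)
      qed
    qed
    moreover have "prod_list xs = m"
    proof -
      have "prod_list xs = (\<Prod>p\<in>prime_factors m. p ^ multiplicity p m)"
        using prod.distinct_set_conv_list[OF ps(2), of "\<lambda>p. p ^ multiplicity p m"] ps(1) by (simp add: xs_def)
      then show ?thesis using prime_factorization_nat[OF m0] by simp
    qed
    ultimately show "m \<in> prod_list ` A" unfolding A_def by (intro image_eqI[of _ _ xs]) auto
  qed
  show "finite S" using sub A(1) finite_surj by blast
  show "card S \<le> y ^ r" using surj_card_le[OF A(1) sub] A(2) by simp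
qed

text \<open>Products over sets of prime factors are divisors, and a set is recovered as the set of
  prime factors of its product.\<close>

lemma two_power_le_card_divisors:
  assumes "m > (0::nat)"
  shows "2 ^ card (prime_factors m) \<le> card {d. d dvd m}"
proof -
  let ?f = "\<lambda>A. \<Prod>p\<in>A. p"
  have "inj_on ?f (Pow (prime_factors m))"
  proof (rule inj_onI)
    fix A B assume AB: "A \<in> Pow (prime_factors m)" "B \<in> Pow (prime_factors m)" "?f A = ?f B"
    have "prime_factors (?f A) = A" if "A \<in> Pow (prime_factors m)" for A
    proof -
      have fin: "finite A" using that finite_subset[of A "prime_factors m"] by auto
      show ?thesis
      proof (rule set_eqI)
        fix q
        show "q \<in> prime_factors (?f A) \<longleftrightarrow> q \<in> A"
        proof
          assume "q \<in> A"
          then show "q \<in> prime_factors (?f A)"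
            using that fin by (auto simp: in_prime_factors_iff intro!: dvd_prodI)
        next
          assume "q \<in> prime_factors (?f A)"
          then have q: "prime q" "q dvd ?f A" by auto
          then obtain p where p: "p \<in> A" "q dvd p" using fin by (auto simp: prime_dvd_prod_iff)
          moreover have "prime p" using p that by auto
          ultimately show "q \<in> A" using q primes_dvd_imp_eq by auto
        qed
      qed
    qed
    from this[OF AB(1)] this[OF AB(2)] AB(3) show "A = B" by metis
  qed
  moreover have "?f ` Pow (prime_factors m) \<subseteq> {d. d dvd m}"
  proof (clarify)
    fix A assume A: "A \<subseteq> prime_factors m"
    have "?f A dvd ?f (prime_factors m)" using A by (intro prod_dvd_prod_subset) auto
    also have "\<dots> dvd (\<Prod>p\<in>prime_factors m. p ^ multiplicity p m)"
      by (intro prod_dvd_prod) (auto simp: in_prime_factors_iff assms prime_multiplicity_gt_zero_iff intro!: dvd_power)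
    also have "\<dots> = m" using prime_factorization_nat[OF assms] by simp
    finally show "?f A dvd m" .
  qed
  ultimately have "card (Pow (prime_factors m)) \<le> card {d. d dvd m}"
    using assms by (intro card_inj_on_le[of ?f]) auto
  then show ?thesis by (simp add: card_Pow)
qed

lemma sum_inverse_below_two_power: "(\<Sum>d\<in>{1..<2 ^ L}. 1 / real d) \<le> real L"
proof (induction L)
  case (Suc L)
  have "{1..<2 ^ Suc L :: nat} = {1..<2 ^ L} \<union> {2 ^ L..<2 ^ Suc L}"
    by (subst ivl_disj_un) (auto simp: Suc_le_eq)
  then have "(\<Sum>d\<in>{1..<2 ^ Suc L}. 1 / real d) = (\<Sum>d\<in>{1..<2 ^ L}. 1 / real d) + (\<Sum>d\<in>{2 ^ L..<2 ^ Suc L}. 1 / real d)"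
    by (simp only:) (rule sum.union_disjoint; auto)
  also have "(\<Sum>d\<in>{2 ^ L..<2 ^ Suc L}. 1 / real d) \<le> (\<Sum>d\<in>{2 ^ L..<2 ^ Suc L :: nat}. 1 / 2 ^ L)"
  proof (rule sum_mono)
    fix d :: nat assume "d \<in> {2 ^ L..<2 ^ Suc L}"
    then have "real (2 ^ L) \<le> real d" by (intro of_nat_mono) auto
    moreover from this have "0 < real d" by (rule less_le_trans[rotated]) simp
    ultimately show "1 / real d \<le> 1 / 2 ^ L" by (intro divide_left_mono) auto
  qed
  also have "\<dots> = 1" by simp
  finally show ?case using Suc by simp
qed simp

text \<open>After exchanging the sums, d divides at most 2^L / d of the m, and the harmonic sum
  brings the factor L.\<close>

lemma sum_card_divisors_le: "(\<Sum>m\<in>{1..<2 ^ L :: nat}. real (card {d. d dvd m})) \<le> 2 ^ L * real L"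
proof -
  let ?I = "{1..<2 ^ L :: nat}"
  have "(\<Sum>m\<in>?I. real (card {d. d dvd m})) = (\<Sum>m\<in>?I. \<Sum>d\<in>?I. if d dvd m then 1 else 0)"
  proof (rule sum.cong)
    fix m assume m: "m \<in> ?I"
    have "{d. d dvd m} = {d \<in> ?I. d dvd m}" using m by (auto dest: dvd_imp_le intro!: Nat.gr0I simp: Suc_le_eq)
    then have "real (card {d. d dvd m}) = (\<Sum>d\<in>{d \<in> ?I. d dvd m}. 1)" by simp
    also have "\<dots> = (\<Sum>d\<in>?I. if d dvd m then 1 else 0)" by (rule sum.inter_filter) simp
    finally show "real (card {d. d dvd m}) = (\<Sum>d\<in>?I. if d dvd m then 1 else 0)" .
  qed simp
  also have "\<dots> = (\<Sum>d\<in>?I. \<Sum>m\<in>?I. if d dvd m then 1 else 0)" by (rule sum.swap)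
  also have "\<dots> \<le> (\<Sum>d\<in>?I. 2 ^ L * (1 / real d))"
  proof (rule sum_mono)
    fix d assume d: "d \<in> ?I"
    have "{m \<in> ?I. d dvd m} \<subseteq> (\<lambda>e. d * e) ` {1..2 ^ L div d}"
    proof
      fix m assume "m \<in> {m \<in> ?I. d dvd m}"
      then obtain e where e: "m = d * e" "m > 0" "m < 2 ^ L" by (auto elim!: dvdE simp: Suc_le_eq)
      then have "e \<le> 2 ^ L div d" using d by (simp add: less_eq_div_iff_mult_less_eq mult.commute)
      then show "m \<in> (\<lambda>e. d * e) ` {1..2 ^ L div d}" using e by (auto simp: Suc_le_eq)
    qed
    then have "card {m \<in> ?I. d dvd m} \<le> card {1..2 ^ L div d}" by (intro surj_card_le) auto
    then have "real (card {m \<in> ?I. d dvd m}) \<le> real (2 ^ L div d)" by simp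
    also have "\<dots> \<le> real (2 ^ L) / real d" by (rule real_div_le)
    finally have "(\<Sum>m\<in>{m \<in> ?I. d dvd m}. 1) \<le> 2 ^ L * (1 / real d)" by simp
    then show "(\<Sum>m\<in>?I. if d dvd m then 1 else 0) \<le> 2 ^ L * (1 / real d)"
      by (subst sum.inter_filter[symmetric]) simp_all
  qed
  also have "\<dots> = 2 ^ L * (\<Sum>d\<in>?I. 1 / real d)" by (simp add: sum_distrib_left)
  also have "\<dots> \<le> 2 ^ L * real L" by (intro mult_left_mono sum_inverse_below_two_power) auto
  finally show ?thesis .
qed

text \<open>Markov's inequality for the number of divisors.\<close>

lemma card_many_prime_factors:
  "2 ^ r * real (card {m \<in> {1..<2 ^ L :: nat}. r \<le> card (prime_factors m)}) \<le> 2 ^ L * real L"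
proof -
  let ?S = "{m \<in> {1..<2 ^ L :: nat}. r \<le> card (prime_factors m)}"
  have "2 ^ r * real (card ?S) = (\<Sum>m\<in>?S. 2 ^ r)" by simp
  also have "\<dots> \<le> (\<Sum>m\<in>?S. real (card {d. d dvd m}))"
  proof (rule sum_mono)
    fix m assume m: "m \<in> ?S"
    then have "(2::nat) ^ r \<le> 2 ^ card (prime_factors m)" by (intro power_increasing) auto
    also have "\<dots> \<le> card {d. d dvd m}" using m by (intro two_power_le_card_divisors) auto
    finally have "real (2 ^ r) \<le> real (card {d. d dvd m})" by (rule of_nat_mono)
    then show "2 ^ r \<le> real (card {d. d dvd m})" by simp
  qed
  also have "\<dots> \<le> (\<Sum>m\<in>{1..<2 ^ L :: nat}. real (card {d. d dvd m}))" by (rule sum_mono2) auto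
  also have "\<dots> \<le> 2 ^ L * real L" by (rule sum_card_divisors_le)
  finally show ?thesis .
qed

lemma bounded_quotient:
  fixes f :: "nat \<Rightarrow> real"
  assumes "f \<longlonglongrightarrow> 0"
  shows "\<exists>C>0. \<forall>n. f n \<le> C"
proof -
  have "Bseq f" using assms by (auto intro: convergent_imp_Bseq convergentI)
  then obtain K where "K > 0" "\<And>n. norm (f n) \<le> K" by (auto elim: BseqE)
  then show ?thesis by (intro exI[of _ K]) (auto intro: order_trans[OF abs_ge_self])
qed

text \<open>The thresholds y = L^(A + 1) and r = floor (sqrt L) make all three counts O(2^L / L^A):
  (2^L / y) L has exactly this size, y^r = exp (O(sqrt L ln L)) is far smaller, and in 2^L L / 2^r
  the factor 2^-r beats every power of L.\<close>

theorem totient_fibre: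
  "\<exists>C. \<forall>j k. real (card {m \<in> {2 ^ j..<2 ^ Suc j}. totient m = k}) \<le> C * 2 ^ j / (real j + 1) ^ A"
proof -
  define B where "B = real A + 1"
  have "(\<lambda>L. real L powr (B * (sqrt (real L) + 1)) / 2 ^ L) \<longlonglongrightarrow> 0"
    unfolding B_def by real_asymp
  then obtain C2 where C2: "C2 > 0" "\<And>L. real L powr (B * (sqrt (real L) + 1)) / 2 ^ L \<le> C2"
    using bounded_quotient by meson
  have "(\<lambda>L. real L powr B / 2 powr (sqrt (real L) - 1)) \<longlonglongrightarrow> 0"
    unfolding B_def by real_asymp
  then obtain C3 where C3: "C3 > 0" "\<And>L. real L powr B / 2 powr (sqrt (real L) - 1) \<le> C3"
    using bounded_quotient by meson
  show ?thesis
  proof (intro exI[of _ "2 + 2 * C2 + 2 * C3"] allI)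
    fix j k :: nat
    define L where "L = Suc j"
    define y where "y = L ^ Suc A"
    define r where "r = nat \<lfloor>sqrt (real L)\<rfloor>"
    have L: "real L \<ge> 1" by (simp add: L_def)
    have y0: "y > 0" by (simp add: y_def L_def)
    have r: "real r \<le> sqrt (real L)" "sqrt (real L) - 1 \<le> real r"
      by (simp_all add: r_def)
    define S where "S = {m \<in> {2 ^ j..<2 ^ Suc j}. totient m = k}"
    define S1 where "S1 = {m \<in> {1..<2 ^ Suc j}. totient m = k \<and> (\<exists>p. prime p \<and> p dvd m \<and> y < p ^ multiplicity p m)}"
    define S2 where "S2 = {m. m > 0 \<and> card (prime_factors m) \<le> r \<and> (\<forall>p. prime p \<longrightarrow> p dvd m \<longrightarrow> p ^ multiplicity p m \<le> y)}"
    define S3 where "S3 = {m \<in> {1..<2 ^ L :: nat}. r \<le> card (prime_factors m)}"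
    have fin: "finite S1" "finite S2" "finite S3"
      using card_few_small_primepows(1)[OF y0, of r] by (simp_all add: S1_def S2_def S3_def)
    have "S \<subseteq> S1 \<union> S2 \<union> S3"
    proof
      fix m assume "m \<in> S"
      then have m: "2 ^ j \<le> m" "m < 2 ^ Suc j" "totient m = k" by (auto simp: S_def)
      have "m > 0" using m(1) by (metis gr0I le_zero_eq power_eq_0_iff zero_neq_numeral)
      then show "m \<in> S1 \<union> S2 \<union> S3"
        using m by (auto simp: S1_def S2_def S3_def L_def not_less Suc_le_eq) 
    qed
    then have "card S \<le> card (S1 \<union> S2 \<union> S3)" using fin by (intro card_mono) auto
    also have "\<dots> \<le> card S1 + card S2 + card S3"
      by (meson add_le_mono1 card_Un_le order_trans)
    finally have cS: "real (card S) \<le> real (card S1) + real (card S2) + real (card S3)" by linarith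
    have "card S1 \<le> (2 ^ L div y) * L"
      unfolding S1_def L_def by (rule card_totient_fibre_large_primepow[OF y0])
    then have "real (card S1) \<le> real (2 ^ L div y) * real L" by (metis of_nat_mono of_nat_mult)
    also have "\<dots> \<le> (2 ^ L / real y) * real L"
      using real_div_le[of "2 ^ L" y] by (intro mult_right_mono) auto
    also have "\<dots> * real L ^ A = 2 ^ L" using L by (simp add: y_def)
    finally have 1: "real (card S1) * real L ^ A \<le> 2 * 2 ^ j"
      using L by (simp add: L_def mult_right_mono)
    have "real (card S2) \<le> real (y ^ r)" unfolding S2_def by (intro of_nat_mono card_few_small_primepows(2)[OF y0])
    then have "real (card S2) * real L ^ A \<le> real (y ^ r) * real L ^ A" by (intro mult_right_mono) auto
    also have "\<dots> = real L powr (B * real r + real A)"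
    proof -
      have "real (y ^ r) = real L powr (B * real r)"
      proof -
        have "real (y ^ r) = real L ^ (Suc A * r)" by (simp only: y_def of_nat_power power_mult)
        also have "\<dots> = real L powr real (Suc A * r)" by (rule powr_realpow[symmetric]) (use L in simp)
        also have "real (Suc A * r) = B * real r" by (simp add: B_def algebra_simps)
        finally show ?thesis .
      qed
      moreover have "real L ^ A = real L powr real A" using L by (simp add: powr_realpow)
      ultimately show ?thesis by (simp add: powr_add)
    qed
    also have "\<dots> \<le> real L powr (B * (sqrt (real L) + 1))"
    proof (rule powr_mono[OF _ L])
      have "B * real r \<le> B * sqrt (real L)" using r(1) by (intro mult_left_mono) (auto simp: B_def)
      then show "B * real r + real A \<le> B * (sqrt (real L) + 1)" by (simp add: B_def algebra_simps)
    qed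
    also have "\<dots> \<le> C2 * 2 ^ L" using C2(2)[of L] by (simp add: field_simps)
    finally have 2: "real (card S2) * real L ^ A \<le> 2 * C2 * 2 ^ j" by (simp add: L_def)
    have "2 powr (sqrt (real L) - 1) * (real (card S3) * real L ^ A) \<le> 2 powr (real r) * (real (card S3) * real L ^ A)"
      using r(2) by (intro mult_right_mono powr_mono) auto
    also have "\<dots> = (2 ^ r * real (card S3)) * real L ^ A" by (simp add: powr_realpow)
    also have "\<dots> \<le> (2 ^ L * real L) * real L ^ A"
      unfolding S3_def by (intro mult_right_mono card_many_prime_factors) auto
    also have "\<dots> = 2 ^ L * real L powr B"
    proof -
      have "real L powr B = real L powr real (Suc A)" by (simp add: B_def add.commute)
      also have "\<dots> = real L ^ Suc A" using L by (intro powr_realpow) auto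
      finally show ?thesis by simp
    qed
    also have "\<dots> \<le> 2 ^ L * (C3 * 2 powr (sqrt (real L) - 1))"
      using C3(2)[of L] by (intro mult_left_mono) (auto simp: pos_divide_le_eq)
    finally have "2 powr (sqrt (real L) - 1) * (real (card S3) * real L ^ A) \<le> 2 powr (sqrt (real L) - 1) * (2 * C3 * 2 ^ j)"
      by (simp add: L_def mult_ac)
    then have 3: "real (card S3) * real L ^ A \<le> 2 * C3 * 2 ^ j"
      by (rule mult_left_le_imp_le) simp
    have "real (card S) * real L ^ A \<le> (real (card S1) + real (card S2) + real (card S3)) * real L ^ A"
      using cS by (intro mult_right_mono) auto
    also have "\<dots> \<le> (2 + 2 * C2 + 2 * C3) * 2 ^ j" using 1 2 3 by (simp add: algebra_simps)
    finally show "real (card {m \<in> {2 ^ j..<2 ^ Suc j}. totient m = k}) \<le> (2 + 2 * C2 + 2 * C3) * 2 ^ j / (real j + 1) ^ A"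
      unfolding S_def[symmetric] by (simp add: pos_le_divide_eq L_def add.commute)
  qed
qed

section \<open>Dyadic decomposition of the operator\<close>

text \<open>Both signs of m share a block: the estimates work with absolute values, and no
  cancellation between m and -m enters.\<close>

definition dyadic_block :: "nat \<Rightarrow> int set" where
  "dyadic_block j = {m. 2 ^ j \<le> \<bar>m\<bar> \<and> \<bar>m\<bar> < 2 ^ Suc j}"

lemma finite_dyadic_block [simp]: "finite (dyadic_block j)"
  by (rule finite_subset[of _ "{- (2 ^ Suc j)..2 ^ Suc j}"]) (auto simp: dyadic_block_def)

lemma card_dyadic_fibre_le:
  "card {m \<in> dyadic_block j. R m} \<le> card {i \<in> {2 ^ j..<2 ^ Suc j}. R (int i)} + card {i \<in> {2 ^ j..<2 ^ Suc j}. R (- int i)}"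
proof -
  let ?U = "{i \<in> {2 ^ j..<2 ^ Suc j}. R (int i)}" and ?V = "{i \<in> {2 ^ j..<2 ^ Suc j}. R (- int i)}"
  have "{m \<in> dyadic_block j. R m} \<subseteq> int ` ?U \<union> (\<lambda>i. - int i) ` ?V"
  proof
    fix m assume m: "m \<in> {m \<in> dyadic_block j. R m}"
    have *: "nat \<bar>m\<bar> \<in> {2 ^ j..<2 ^ Suc j}"
      using m by (auto simp: dyadic_block_def le_nat_iff nat_less_iff)
    show "m \<in> int ` ?U \<union> (\<lambda>i. - int i) ` ?V"
    proof (cases "m \<ge> 0")
      case True
      then show ?thesis using m * by (intro UnI1 image_eqI[of _ _ "nat \<bar>m\<bar>"]) auto
    next
      case False
      then show ?thesis using m * by (intro UnI2 image_eqI[of _ _ "nat \<bar>m\<bar>"]) auto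
    qed
  qed
  then have "card {m \<in> dyadic_block j. R m} \<le> card (int ` ?U \<union> (\<lambda>i. - int i) ` ?V)" by (intro card_mono) auto
  also have "\<dots> \<le> card (int ` ?U) + card ((\<lambda>i. - int i) ` ?V)" by (rule card_Un_le)
  also have "\<dots> \<le> card ?U + card ?V" by (intro add_mono card_image_le) auto
  finally show ?thesis .
qed

lemma card_dyadic_block_le: "card (dyadic_block j) \<le> 2 * 2 ^ j"
proof -
  have eq: "{i \<in> {2 ^ j..<2 ^ Suc j :: nat}. True} = {2 ^ j..<2 ^ Suc j}" by auto
  show ?thesis using card_dyadic_fibre_le[of j "\<lambda>_. True"] unfolding eq by simp
qed

text \<open>A substitute for the triangle inequality in l^p. With T the right-hand side, each x j is
  at most T^(1/p) / ((j + 1) (j + 2)), and these reciprocals telescope to at most 1.\<close>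

lemma sum_powr_le_sum_weighted_powr:
  fixes x :: "nat \<Rightarrow> real"
  assumes x: "\<And>j. x j \<ge> 0" and p: "p > 0"
  shows "(\<Sum>j<J. x j) powr p \<le> (\<Sum>j<J. ((real j + 1) * (real j + 2) * x j) powr p)"
proof -
  define T where "T = (\<Sum>j<J. ((real j + 1) * (real j + 2) * x j) powr p)"
  have T: "T \<ge> 0" unfolding T_def by (intro sum_nonneg) auto
  have le: "x j \<le> T powr (1 / p) * (1 / (real j + 1) - 1 / (real j + 2))" if "j < J" for j
  proof -
    have "((real j + 1) * (real j + 2) * x j) powr p \<le> T"
      unfolding T_def using that by (intro member_le_sum) auto
    then have "(((real j + 1) * (real j + 2) * x j) powr p) powr (1 / p) \<le> T powr (1 / p)"
      using p by (intro powr_mono2) auto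
    then have "(real j + 1) * (real j + 2) * x j \<le> T powr (1 / p)"
      using p x[of j] by (simp add: powr_powr)
    then have "x j \<le> T powr (1 / p) / ((real j + 1) * (real j + 2))"
      by (subst pos_le_divide_eq) (auto simp: mult_ac)
    moreover have "1 / (real j + 1) - 1 / (real j + 2) = 1 / ((real j + 1) * (real j + 2))"
      by (simp add: field_simps)
    ultimately show ?thesis by simp
  qed
  have tel: "(\<Sum>j<J. 1 / (real j + 1) - 1 / (real j + 2)) = 1 - 1 / (real J + 1)"
    by (induction J) (auto simp: add.commute)
  have "(\<Sum>j<J. x j) \<le> (\<Sum>j<J. T powr (1 / p) * (1 / (real j + 1) - 1 / (real j + 2)))"
    using le by (intro sum_mono) auto
  also have "\<dots> = T powr (1 / p) * (1 - 1 / (real J + 1))" by (simp only: sum_distrib_left[symmetric] tel)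
  also have "\<dots> \<le> T powr (1 / p)" by (intro mult_left_le) auto
  finally have "(\<Sum>j<J. x j) powr p \<le> (T powr (1 / p)) powr p"
    using x p by (intro powr_mono2 sum_nonneg) auto
  also have "\<dots> = T" using p T by (simp add: powr_powr)
  finally show ?thesis by (simp add: T_def)
qed

lemma sum_sq_shift_le:
  fixes a :: "int \<Rightarrow> real"
  assumes "\<And>N. finite N \<Longrightarrow> (\<Sum>n\<in>N. (a n)\<^sup>2) \<le> 1" "finite N"
  shows "(\<Sum>n\<in>N. (a (n - c))\<^sup>2) \<le> 1"
proof -
  have "(\<Sum>n\<in>N. (a (n - c))\<^sup>2) = (\<Sum>n\<in>(\<lambda>n. n - c) ` N. (a n)\<^sup>2)"
    by (subst sum.reindex) (auto simp: inj_on_def)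
  then show ?thesis using assms by simp
qed

section \<open>Block estimates for normalised sequences\<close>

text \<open>\<open>a\<close> and \<open>b\<close> stand for |f| / ||f|| and |g| / ||g||. Their l^2
  bounds are stated for finite sums, which keeps infinite sums out of the block estimates.\<close>

locale normalized_pair =
  fixes a b :: "int \<Rightarrow> real" and P Q :: "int \<Rightarrow> int"
  assumes a0: "\<And>n. a n \<ge> 0" and b0: "\<And>n. b n \<ge> 0"
    and a1: "\<And>N. finite N \<Longrightarrow> (\<Sum>n\<in>N. (a n)\<^sup>2) \<le> 1"
    and b1: "\<And>N. finite N \<Longrightarrow> (\<Sum>n\<in>N. (b n)\<^sup>2) \<le> 1"
begin

definition kern :: "int \<Rightarrow> int \<Rightarrow> real" where
  "kern n m = a (n - P m) * b (n - Q m) / \<bar>of_int m\<bar>"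

definition block_sum :: "nat \<Rightarrow> int \<Rightarrow> real" where
  "block_sum j n = (\<Sum>m\<in>dyadic_block j. kern n m)"

lemma kern_nonneg: "kern n m \<ge> 0"
  by (simp add: kern_def a0 b0)

lemma block_sum_nonneg: "block_sum j n \<ge> 0"
  by (simp add: block_sum_def kern_nonneg sum_nonneg)

lemma b_le_1: "b n \<le> 1"
  using b1[of "{n}"] b0[of n] by (simp add: power_le_one_iff)

lemma dyadic_inverse: "m \<in> dyadic_block j \<Longrightarrow> x \<ge> 0 \<Longrightarrow> x / \<bar>real_of_int m\<bar> \<le> x / 2 ^ j"
proof -
  assume m: "m \<in> dyadic_block j" and x: "x \<ge> 0"
  have "real_of_int (2 ^ j) \<le> real_of_int \<bar>m\<bar>" using m unfolding dyadic_block_def of_int_le_iff by simp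
  moreover from this have "0 < \<bar>real_of_int m\<bar>" by (simp only: of_int_power of_int_numeral of_int_abs) (rule less_le_trans[rotated], assumption, simp)
  ultimately show ?thesis using x by (intro divide_left_mono) auto
qed

text \<open>For fixed m, the bound a b \<le> (a^2 + b^2) / 2 and translation invariance give at most
  2^-j, and the block has at most 2^(j + 1) members.\<close>

lemma sum_block_sum_le:
  assumes N: "finite N"
  shows "(\<Sum>n\<in>N. block_sum j n) \<le> 2"
proof -
  have "(\<Sum>n\<in>N. block_sum j n) = (\<Sum>m\<in>dyadic_block j. \<Sum>n\<in>N. kern n m)"
    unfolding block_sum_def by (rule sum.swap)
  also have "\<dots> \<le> (\<Sum>m\<in>dyadic_block j. 1 / 2 ^ j)"
  proof (rule sum_mono)
    fix m assume m: "m \<in> dyadic_block j"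
    have "(\<Sum>n\<in>N. kern n m) \<le> (\<Sum>n\<in>N. ((a (n - P m))\<^sup>2 + (b (n - Q m))\<^sup>2) / 2 / 2 ^ j)"
    proof (rule sum_mono)
      fix n
      have "kern n m \<le> a (n - P m) * b (n - Q m) / 2 ^ j"
        unfolding kern_def by (rule dyadic_inverse[OF m]) (simp add: a0 b0)
      also have "\<dots> \<le> ((a (n - P m))\<^sup>2 + (b (n - Q m))\<^sup>2) / 2 / 2 ^ j"
        using sum_squares_bound[of "a (n - P m)" "b (n - Q m)"] by (intro divide_right_mono) auto
      finally show "kern n m \<le> ((a (n - P m))\<^sup>2 + (b (n - Q m))\<^sup>2) / 2 / 2 ^ j" .
    qed
    also have "\<dots> = ((\<Sum>n\<in>N. (a (n - P m))\<^sup>2) + (\<Sum>n\<in>N. (b (n - Q m))\<^sup>2)) / 2 / 2 ^ j"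
      by (simp only: sum.distrib sum_divide_distrib[symmetric])
    also have "\<dots> \<le> (1 + 1) / 2 / 2 ^ j"
      by (intro divide_right_mono add_mono sum_sq_shift_le a1 b1 N) auto
    finally show "(\<Sum>n\<in>N. kern n m) \<le> 1 / 2 ^ j" by simp
  qed
  also have "\<dots> = real (card (dyadic_block j)) / 2 ^ j" by simp
  also have "\<dots> \<le> real (2 * 2 ^ j) / 2 ^ j"
    by (intro divide_right_mono of_nat_mono card_dyadic_block_le) auto
  finally show ?thesis by simp
qed

text \<open>The factor b is at most 1. Cauchy-Schwarz over the block leaves the sum of a(n - P m)^2,
  in which each value of P occurs at most \<eta> 2^j times and distinct values together contribute
  at most 1.\<close>

lemma block_sum_le:
  assumes \<eta>: "\<eta> \<ge> 0" and fib: "\<And>k. real (card {m \<in> dyadic_block j. P m = k}) \<le> \<eta> * 2 ^ j"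
  shows "block_sum j n \<le> sqrt (2 * \<eta>)"
proof -
  let ?I = "dyadic_block j"
  have "block_sum j n \<le> (\<Sum>m\<in>?I. a (n - P m) / 2 ^ j)"
    unfolding block_sum_def
  proof (rule sum_mono)
    fix m assume m: "m \<in> ?I"
    have "kern n m \<le> a (n - P m) * b (n - Q m) / 2 ^ j"
      unfolding kern_def by (rule dyadic_inverse[OF m]) (simp add: a0 b0)
    also have "\<dots> \<le> a (n - P m) * 1 / 2 ^ j"
      by (intro divide_right_mono mult_left_mono b_le_1 a0) auto
    finally show "kern n m \<le> a (n - P m) / 2 ^ j" by simp
  qed
  also have "\<dots> = (\<Sum>m\<in>?I. a (n - P m)) / 2 ^ j" by (simp add: sum_divide_distrib)
  finally have 1: "block_sum j n \<le> (\<Sum>m\<in>?I. a (n - P m)) / 2 ^ j" .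
  have "(\<Sum>m\<in>?I. (a (n - P m))\<^sup>2) = (\<Sum>k\<in>P ` ?I. \<Sum>m\<in>{m \<in> ?I. P m = k}. (a (n - P m))\<^sup>2)"
    by (rule sum.image_gen) simp
  also have "\<dots> = (\<Sum>k\<in>P ` ?I. real (card {m \<in> ?I. P m = k}) * (a (n - k))\<^sup>2)"
    by (intro sum.cong) auto
  also have "\<dots> \<le> (\<Sum>k\<in>P ` ?I. \<eta> * 2 ^ j * (a (n - k))\<^sup>2)"
    by (intro sum_mono mult_right_mono fib) auto
  also have "\<dots> = \<eta> * 2 ^ j * (\<Sum>k\<in>P ` ?I. (a (n - k))\<^sup>2)" by (simp add: sum_distrib_left)
  also have "(\<Sum>k\<in>P ` ?I. (a (n - k))\<^sup>2) = (\<Sum>k\<in>(\<lambda>k. n - k) ` P ` ?I. (a k)\<^sup>2)"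
    by (subst sum.reindex) (auto simp: inj_on_def)
  also have "\<eta> * 2 ^ j * \<dots> \<le> \<eta> * 2 ^ j * 1" using \<eta> by (intro mult_left_mono a1) auto
  finally have 2: "(\<Sum>m\<in>?I. (a (n - P m))\<^sup>2) \<le> \<eta> * 2 ^ j" by simp
  have "(\<Sum>m\<in>?I. a (n - P m))\<^sup>2 \<le> (\<Sum>m\<in>?I. (a (n - P m))\<^sup>2) * real (card ?I)"
    by (rule sum_squared_le_sum_of_squares)
  also have "\<dots> \<le> (\<eta> * 2 ^ j) * real (2 * 2 ^ j)"
    using \<eta> by (intro mult_mono 2 of_nat_mono card_dyadic_block_le) auto
  finally have 3: "(\<Sum>m\<in>?I. a (n - P m))\<^sup>2 \<le> 2 * \<eta> * (2 ^ j)\<^sup>2" by (simp add: power2_eq_square)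
  have "((\<Sum>m\<in>?I. a (n - P m)) / 2 ^ j)\<^sup>2 \<le> 2 * \<eta>"
    using 3 by (simp add: power_divide field_simps)
  then have "(\<Sum>m\<in>?I. a (n - P m)) / 2 ^ j \<le> sqrt (2 * \<eta>)" by (rule real_le_rsqrt)
  with 1 show ?thesis by linarith
qed

lemma sum_kern_le_block_sums:
  assumes "finite M" "0 \<notin> M"
  shows "\<exists>J. \<forall>n. (\<Sum>m\<in>M. kern n m) \<le> (\<Sum>j<J. block_sum j n)"
proof -
  define U where "U = (\<lambda>J. {m :: int. m \<noteq> 0 \<and> \<bar>m\<bar> < 2 ^ J})"
  have finU: "finite (U J)" for J
    by (rule finite_subset[of _ "{- (2 ^ J)..2 ^ J}"]) (auto simp: U_def)
  have sU: "(\<Sum>m\<in>U J. kern n m) = (\<Sum>j<J. block_sum j n)" for J n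
  proof (induction J)
    case 0
    have "U 0 = {}" by (auto simp: U_def)
    then show ?case by simp
  next
    case (Suc J)
    have "m \<in> U (Suc J) \<longleftrightarrow> m \<in> U J \<or> m \<in> dyadic_block J" for m
    proof -
      have "(1::int) \<le> 2 ^ J" by simp
      then show ?thesis by (auto simp: U_def dyadic_block_def)
    qed
    then have "U (Suc J) = U J \<union> dyadic_block J" by blast
    moreover have "U J \<inter> dyadic_block J = {}" by (auto simp: U_def dyadic_block_def)
    ultimately show ?case using Suc finU by (simp add: sum.union_disjoint block_sum_def)
  qed
  \<comment> \<open>A crude exponent: |m| < 2^|m|, and every |m| is at most the sum of all.\<close>
  define J where "J = (\<Sum>m\<in>M. nat \<bar>m\<bar>)"
  have "M \<subseteq> U J"
  proof
    fix m assume m: "m \<in> M"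
    have "nat \<bar>m\<bar> \<le> J" unfolding J_def using m assms by (intro member_le_sum) auto
    then have "(2::nat) ^ nat \<bar>m\<bar> \<le> 2 ^ J" by (intro power_increasing) auto
    moreover have "nat \<bar>m\<bar> < 2 ^ nat \<bar>m\<bar>" by (rule less_exp)
    ultimately have "nat \<bar>m\<bar> < 2 ^ J" by linarith
    then have "\<bar>m\<bar> < 2 ^ J" by (simp add: nat_less_iff)
    then show "m \<in> U J" using m assms by (auto simp: U_def)
  qed
  then have "(\<Sum>m\<in>M. kern n m) \<le> (\<Sum>j<J. block_sum j n)" for n
    unfolding sU[symmetric] by (intro sum_mono2 finU kern_nonneg)
  then show ?thesis by blast
qed

text \<open>On each block the power 1 + \<epsilon> splits into one factor, whose sum over n is at
  most 2, and an \<epsilon>-th power bounded by the supremum. The weights (j + 1) (j + 2) are the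
  price of adding up the blocks.\<close>

lemma sum_powr_kern_le:
  assumes \<epsilon>: "\<epsilon> > 0" and \<eta>: "\<And>j. \<eta> j \<ge> 0"
    and fib: "\<And>j k. real (card {m \<in> dyadic_block j. P m = k}) \<le> \<eta> j * 2 ^ j"
    and K: "\<And>J. (\<Sum>j<J. ((real j + 1) * (real j + 2)) powr (1 + \<epsilon>) * (2 * sqrt (2 * \<eta> j) powr \<epsilon>)) \<le> K"
    and N: "finite N" and M: "finite M" "0 \<notin> M"
  shows "(\<Sum>n\<in>N. (\<Sum>m\<in>M. kern n m) powr (1 + \<epsilon>)) \<le> K"
proof -
  obtain J where J: "\<And>n. (\<Sum>m\<in>M. kern n m) \<le> (\<Sum>j<J. block_sum j n)"
    using sum_kern_le_block_sums[OF M] by blast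
  let ?w = "\<lambda>j. (real j + 1) * (real j + 2)"
  have "(\<Sum>n\<in>N. (\<Sum>m\<in>M. kern n m) powr (1 + \<epsilon>)) \<le> (\<Sum>n\<in>N. \<Sum>j<J. (?w j * block_sum j n) powr (1 + \<epsilon>))"
  proof (rule sum_mono)
    fix n
    have "(\<Sum>m\<in>M. kern n m) powr (1 + \<epsilon>) \<le> (\<Sum>j<J. block_sum j n) powr (1 + \<epsilon>)"
      using J \<epsilon> by (intro powr_mono2 sum_nonneg kern_nonneg) auto
    also have "\<dots> \<le> (\<Sum>j<J. (?w j * block_sum j n) powr (1 + \<epsilon>))"
      using \<epsilon> by (intro sum_powr_le_sum_weighted_powr block_sum_nonneg) auto
    finally show "(\<Sum>m\<in>M. kern n m) powr (1 + \<epsilon>) \<le> (\<Sum>j<J. (?w j * block_sum j n) powr (1 + \<epsilon>))" .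
  qed
  also have "\<dots> = (\<Sum>j<J. \<Sum>n\<in>N. (?w j * block_sum j n) powr (1 + \<epsilon>))" by (rule sum.swap)
  also have "\<dots> \<le> (\<Sum>j<J. ?w j powr (1 + \<epsilon>) * (2 * sqrt (2 * \<eta> j) powr \<epsilon>))"
  proof (rule sum_mono)
    fix j
    have "(\<Sum>n\<in>N. (?w j * block_sum j n) powr (1 + \<epsilon>)) \<le> (\<Sum>n\<in>N. ?w j powr (1 + \<epsilon>) * (block_sum j n * sqrt (2 * \<eta> j) powr \<epsilon>))"
    proof (rule sum_mono)
      fix n
      have "(?w j * block_sum j n) powr (1 + \<epsilon>) = ?w j powr (1 + \<epsilon>) * (block_sum j n * block_sum j n powr \<epsilon>)"
        using block_sum_nonneg[of j n] by (simp add: powr_mult powr_add)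
      also have "\<dots> \<le> ?w j powr (1 + \<epsilon>) * (block_sum j n * sqrt (2 * \<eta> j) powr \<epsilon>)"
        using block_sum_nonneg[of j n] block_sum_le[OF \<eta> fib, of j n] \<epsilon>
        by (intro mult_left_mono powr_mono2) auto
      finally show "(?w j * block_sum j n) powr (1 + \<epsilon>) \<le> ?w j powr (1 + \<epsilon>) * (block_sum j n * sqrt (2 * \<eta> j) powr \<epsilon>)" .
    qed
    also have "\<dots> = ?w j powr (1 + \<epsilon>) * ((\<Sum>n\<in>N. block_sum j n) * sqrt (2 * \<eta> j) powr \<epsilon>)"
      by (simp only: sum_distrib_left sum_distrib_right)
    also have "\<dots> \<le> ?w j powr (1 + \<epsilon>) * (2 * sqrt (2 * \<eta> j) powr \<epsilon>)"
      by (intro mult_left_mono mult_right_mono sum_block_sum_le[OF N]) auto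
    finally show "(\<Sum>n\<in>N. (?w j * block_sum j n) powr (1 + \<epsilon>)) \<le> ?w j powr (1 + \<epsilon>) * (2 * sqrt (2 * \<eta> j) powr \<epsilon>)" .
  qed
  also have "\<dots> \<le> K" by (rule K)
  finally show ?thesis .
qed

text \<open>The bound for finite \<open>M\<close> passes to the limit along the finite sets. With
  \<open>N\<close> a singleton it bounds all finite sums over m at one n, which gives the
  summability.\<close>

lemma kern_summable_and_bound:
  assumes \<epsilon>: "\<epsilon> > 0" and bd: "\<And>N M. finite N \<Longrightarrow> finite M \<Longrightarrow> 0 \<notin> M \<Longrightarrow> (\<Sum>n\<in>N. (\<Sum>m\<in>M. kern n m) powr (1 + \<epsilon>)) \<le> K"
  shows "kern n summable_on (UNIV - {0})"
    and "finite N \<Longrightarrow> (\<Sum>n\<in>N. (\<Sum>\<^sub>\<infinity>m\<in>UNIV - {0}. kern n m) powr (1 + \<epsilon>)) \<le> K"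
proof -
  show sm: "kern n summable_on (UNIV - {0})" for n
  proof (rule nonneg_bdd_above_summable_on)
    show "bdd_above (sum (kern n) ` {F. F \<subseteq> UNIV - {0} \<and> finite F})"
    proof (rule bdd_aboveI)
      fix x assume "x \<in> sum (kern n) ` {F. F \<subseteq> UNIV - {0} \<and> finite F}"
      then obtain M where M: "finite M" "0 \<notin> M" "x = sum (kern n) M" by auto
      have x: "x \<ge> 0" using M by (simp add: sum_nonneg kern_nonneg)
      have "x powr (1 + \<epsilon>) \<le> K" using bd[of "{n}" M] M by simp
      then have "(x powr (1 + \<epsilon>)) powr (1 / (1 + \<epsilon>)) \<le> K powr (1 / (1 + \<epsilon>))"
        using \<epsilon> by (intro powr_mono2) auto
      then show "x \<le> K powr (1 / (1 + \<epsilon>))" using x \<epsilon> by (simp add: powr_powr)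
    qed
  qed (rule kern_nonneg)
  assume N: "finite N"
  have "((\<lambda>M. \<Sum>n\<in>N. (\<Sum>m\<in>M. kern n m) powr (1 + \<epsilon>)) \<longlongrightarrow> (\<Sum>n\<in>N. (\<Sum>\<^sub>\<infinity>m\<in>UNIV - {0}. kern n m) powr (1 + \<epsilon>)))
          (finite_subsets_at_top (UNIV - {0}))"
    by (intro tendsto_sum tendsto_powr2 infsum_tendsto[OF sm] tendsto_const)
       (use \<epsilon> in \<open>auto intro!: always_eventually sum_nonneg kern_nonneg\<close>)
  then show "(\<Sum>n\<in>N. (\<Sum>\<^sub>\<infinity>m\<in>UNIV - {0}. kern n m) powr (1 + \<epsilon>)) \<le> K"
  proof (rule tendsto_upperbound)
    show "\<forall>\<^sub>F M in finite_subsets_at_top (UNIV - {0}). (\<Sum>n\<in>N. (\<Sum>m\<in>M. kern n m) powr (1 + \<epsilon>)) \<le> K"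
      by (rule eventually_finite_subsets_at_top_weakI) (use bd N in auto)
  qed (rule finite_subsets_at_top_neq_bot)
qed

end

section \<open>From nonnegative kernels to the operator\<close>

lemma finite_sum_sq_le_infsum:
  assumes "f \<in> lp_space 2" "finite N"
  shows "(\<Sum>n\<in>N. (norm (f n))\<^sup>2) \<le> (lp_norm 2 f)\<^sup>2"
proof -
  have sq: "norm (f n) powr 2 = (norm (f n))\<^sup>2" for n by (simp add: powr_numeral)
  have sm: "(\<lambda>n. (norm (f n))\<^sup>2) summable_on UNIV" using assms(1) by (simp add: lp_space_def sq)
  have "(\<Sum>n\<in>N. (norm (f n))\<^sup>2) \<le> (\<Sum>\<^sub>\<infinity>n. (norm (f n))\<^sup>2)"
    by (rule finite_sum_le_infsum[OF sm assms(2)]) auto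
  also have "\<dots> = (lp_norm 2 f)\<^sup>2"
  proof -
    have "(\<Sum>\<^sub>\<infinity>n. (norm (f n))\<^sup>2) \<ge> 0" by (rule infsum_nonneg) auto
    then show ?thesis by (simp add: lp_norm_def sq powr_half_sqrt)
  qed
  finally show ?thesis .
qed

lemma lp_norm_nonneg: "lp_norm p f \<ge> 0"
  by (simp add: lp_norm_def)

text \<open>A saving of every power of j + 1, that is of the logarithm of m, with one constant for
  all blocks and all values.\<close>

definition small_fibres :: "(nat \<Rightarrow> nat) \<Rightarrow> bool" where
  "small_fibres h \<longleftrightarrow> (\<forall>A. \<exists>C. \<forall>j k. real (card {m \<in> {2 ^ j..<2 ^ Suc j}. h m = k}) \<le> C * 2 ^ j / (real j + 1) ^ A)"

text \<open>With l = j + 1 the block weight is at most 4 l^4, and the fibres contribute l^(-A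
  \<epsilon> / 2) \<le> l^-6, so a convergent l^-2 remains.\<close>

lemma weighted_fibre_sum_bounded:
  assumes C: "C \<ge> 0" and \<epsilon>: "0 < \<epsilon>" "\<epsilon> < 1" and A: "real A * \<epsilon> \<ge> 12"
  shows "\<exists>K. \<forall>J. (\<Sum>j<J. ((real j + 1) * (real j + 2)) powr (1 + \<epsilon>) * (2 * sqrt (2 * (C / (real j + 1) ^ A)) powr \<epsilon>)) \<le> K"
proof -
  define D where "D = 8 * sqrt (2 * C) powr \<epsilon>"
  have D: "D \<ge> 0" by (simp add: D_def)
  have le: "((real j + 1) * (real j + 2)) powr (1 + \<epsilon>) * (2 * sqrt (2 * (C / (real j + 1) ^ A)) powr \<epsilon>) \<le> D * (1 / real (Suc j) ^ 2)" for j
  proof -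
    define l where "l = real j + 1"
    have l: "l \<ge> 1" by (simp add: l_def)
    have "(l * (l + 1)) powr (1 + \<epsilon>) \<le> (l * (l + 1)) powr 2"
      using l \<epsilon> by (intro powr_mono) (auto intro: order_trans[OF l])
    also have "\<dots> \<le> (2 * l\<^sup>2) powr 2"
      using l by (intro powr_mono2) (auto simp: power2_eq_square)
    also have "\<dots> = 4 * l ^ 4" using l by (simp add: powr_numeral power_mult_distrib flip: power_mult)
    finally have 1: "(l * (l + 1)) powr (1 + \<epsilon>) \<le> 4 * l ^ 4" .
    have "sqrt (2 * (C / l ^ A)) powr \<epsilon> = sqrt (2 * C) powr \<epsilon> / sqrt (l ^ A) powr \<epsilon>"
      using C l by (simp add: real_sqrt_divide powr_divide)
    also have "sqrt (l ^ A) powr \<epsilon> = l powr (real A / 2 * \<epsilon>)"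
      using l by (simp add: powr_half_sqrt[symmetric] powr_powr flip: powr_realpow)
    also have "sqrt (2 * C) powr \<epsilon> / l powr (real A / 2 * \<epsilon>) \<le> sqrt (2 * C) powr \<epsilon> / l powr 6"
      using l A by (intro divide_left_mono powr_mono) auto
    also have "l powr 6 = l ^ 6" using l by (simp add: powr_numeral)
    finally have 2: "sqrt (2 * (C / l ^ A)) powr \<epsilon> \<le> sqrt (2 * C) powr \<epsilon> / l ^ 6" .
    have "(l * (l + 1)) powr (1 + \<epsilon>) * (2 * sqrt (2 * (C / l ^ A)) powr \<epsilon>) \<le> (4 * l ^ 4) * (2 * (sqrt (2 * C) powr \<epsilon> / l ^ 6))"
      using 1 2 l by (intro mult_mono mult_left_mono) auto
    also have "\<dots> = D * (1 / l ^ 2)" using l by (simp add: D_def field_simps flip: power_add)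
    finally show ?thesis by (simp add: l_def add.commute add.left_commute)
  qed
  have sm: "summable (\<lambda>j. D * (1 / real (Suc j) ^ 2))"
    using inverse_power_summable[of 2, where ?'a = real] by (intro summable_mult) (subst summable_Suc_iff, simp add: inverse_eq_divide)
  show ?thesis
  proof (intro exI allI)
    fix J
    have "(\<Sum>j<J. ((real j + 1) * (real j + 2)) powr (1 + \<epsilon>) * (2 * sqrt (2 * (C / (real j + 1) ^ A)) powr \<epsilon>))
        \<le> (\<Sum>j<J. D * (1 / real (Suc j) ^ 2))" by (rule sum_mono[OF le])
    also have "\<dots> \<le> (\<Sum>j. D * (1 / real (Suc j) ^ 2))" using D by (intro sum_le_suminf[OF sm]) auto
    finally show "(\<Sum>j<J. ((real j + 1) * (real j + 2)) powr (1 + \<epsilon>) * (2 * sqrt (2 * (C / (real j + 1) ^ A)) powr \<epsilon>))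
        \<le> (\<Sum>j. D * (1 / real (Suc j) ^ 2))" .
  qed
qed

text \<open>Bundles the three claims, so that enlarging the constant and exchanging the two sides
  are done once.\<close>

definition B_dis_bounded ::
  "real \<Rightarrow> real \<Rightarrow> (int \<Rightarrow> int) \<Rightarrow> (int \<Rightarrow> int) \<Rightarrow> (int \<Rightarrow> complex) \<Rightarrow> (int \<Rightarrow> complex) \<Rightarrow> bool" where
  "B_dis_bounded \<epsilon> C P Q f g \<longleftrightarrow>
     (\<forall>n. B_dis_summand P Q f g n summable_on (UNIV - {0})) \<and>
     B_dis P Q f g \<in> lp_space (1 + \<epsilon>) \<and>
     lp_norm (1 + \<epsilon>) (B_dis P Q f g) \<le> C * lp_norm 2 f * lp_norm 2 g"

lemma B_dis_bounded_mono:
  assumes "B_dis_bounded \<epsilon> C P Q f g" "C \<le> D"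
  shows "B_dis_bounded \<epsilon> D P Q f g"
proof -
  have "C * lp_norm 2 f * lp_norm 2 g \<le> D * lp_norm 2 f * lp_norm 2 g"
    using assms(2) by (intro mult_right_mono lp_norm_nonneg)
  with assms(1) show ?thesis by (auto simp: B_dis_bounded_def)
qed

lemma B_dis_bounded_commute:
  assumes "B_dis_bounded \<epsilon> C Q P g f"
  shows "B_dis_bounded \<epsilon> C P Q f g"
proof -
  have s: "B_dis_summand Q P g f = B_dis_summand P Q f g"
    by (simp add: B_dis_summand_def fun_eq_iff)
  then have "B_dis Q P g f = B_dis P Q f g" by (simp add: B_dis_def fun_eq_iff)
  with s assms show ?thesis by (simp add: B_dis_bounded_def mult_ac)
qed

lemma B_dis_bound:
  assumes h: "small_fibres h" and \<epsilon>: "0 < \<epsilon>" "\<epsilon> < 1"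
  shows "\<exists>C\<ge>0. \<forall>P Q f g. (\<forall>m. m \<noteq> 0 \<longrightarrow> P m = int (h (nat \<bar>m\<bar>))) \<longrightarrow> f \<in> lp_space 2 \<longrightarrow> g \<in> lp_space 2 \<longrightarrow>
           B_dis_bounded \<epsilon> C P Q f g"
proof -
  define A where "A = nat \<lceil>12 / \<epsilon>\<rceil>"
  have A: "real A * \<epsilon> \<ge> 12"
  proof -
    have "12 / \<epsilon> \<le> real A" unfolding A_def by (rule real_nat_ceiling_ge)
    then show ?thesis using \<epsilon> by (simp add: field_simps)
  qed
  obtain C0 where C0: "\<And>j k. real (card {m \<in> {2 ^ j..<2 ^ Suc j}. h m = k}) \<le> C0 * 2 ^ j / (real j + 1) ^ A"
    using h unfolding small_fibres_def by blast
  \<comment> \<open>The factor 2 accounts for the two signs of m; the absolute value makes the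
    constant nonnegative.\<close>
  define C where "C = 2 * \<bar>C0\<bar>"
  have C: "C \<ge> 0" by (simp add: C_def)
  obtain K where K: "\<And>J. (\<Sum>j<J. ((real j + 1) * (real j + 2)) powr (1 + \<epsilon>) * (2 * sqrt (2 * (C / (real j + 1) ^ A)) powr \<epsilon>)) \<le> K"
    using weighted_fibre_sum_bounded[OF C \<epsilon> A] by blast
  have K0: "K \<ge> 0" using K[of 0] by simp
  define p where "p = 1 + \<epsilon>"
  have p: "p > 1" "p > 0" using \<epsilon> by (auto simp: p_def)
  show ?thesis
    unfolding B_dis_bounded_def
  proof (intro exI[of _ "K powr (1 / p)"] conjI allI impI)
    show "K powr (1 / p) \<ge> 0" by simp
  next
    fix P Q :: "int \<Rightarrow> int" and f g :: "int \<Rightarrow> complex"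
    assume P: "\<forall>m. m \<noteq> 0 \<longrightarrow> P m = int (h (nat \<bar>m\<bar>))" and f: "f \<in> lp_space 2" and g: "g \<in> lp_space 2"
    define F G where "F = lp_norm 2 f" and "G = lp_norm 2 g"
    have FG: "F \<ge> 0" "G \<ge> 0" by (simp_all add: F_def G_def lp_norm_nonneg)
    \<comment> \<open>If a norm is 0, division by zero gives the zero sequence; the identities
      \<open>fa\<close> and \<open>gb\<close> still hold because the function itself then
      vanishes.\<close>
    define a b where "a = (\<lambda>n. norm (f n) / F)" and "b = (\<lambda>n. norm (g n) / G)"
    have fa: "norm (f n) = F * a n" for n
      using finite_sum_sq_le_infsum[OF f, of "{n}"] by (auto simp: a_def F_def)
    have gb: "norm (g n) = G * b n" for n
      using finite_sum_sq_le_infsum[OF g, of "{n}"] by (auto simp: b_def G_def)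
    have unit: "(\<Sum>n\<in>N. (norm (u n) / lp_norm 2 u)\<^sup>2) \<le> 1" if "u \<in> lp_space 2" "finite N" for u N
    proof (cases "lp_norm 2 u = 0")
      case False
      then show ?thesis using finite_sum_sq_le_infsum[OF that]
        by (simp add: power_divide flip: sum_divide_distrib)
    qed simp
    interpret normalized_pair a b P Q
      by unfold_locales (use FG unit f g in \<open>auto simp: a_def b_def F_def G_def\<close>)
    have fib: "real (card {m \<in> dyadic_block j. P m = k}) \<le> C / (real j + 1) ^ A * 2 ^ j" for j k
    proof -
      have "real (card {i \<in> {2 ^ j..<2 ^ Suc j}. P (int i) = k}) \<le> \<bar>C0\<bar> * 2 ^ j / (real j + 1) ^ A
          \<and> real (card {i \<in> {2 ^ j..<2 ^ Suc j}. P (- int i) = k}) \<le> \<bar>C0\<bar> * 2 ^ j / (real j + 1) ^ A"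
      proof -
        have pos: "i \<noteq> 0" if "i \<in> {2 ^ j..<2 ^ Suc j}" for i :: nat
          using that by (metis atLeastLessThan_iff le_zero_eq power_eq_0_iff zero_neq_numeral)
        \<comment> \<open>For negative k both sets on the left are empty, so \<open>nat k\<close>
          serves for every k.\<close>
        have "{i \<in> {2 ^ j..<2 ^ Suc j}. P (int i) = k} \<subseteq> {i \<in> {2 ^ j..<2 ^ Suc j}. h i = nat k}"
             "{i \<in> {2 ^ j..<2 ^ Suc j}. P (- int i) = k} \<subseteq> {i \<in> {2 ^ j..<2 ^ Suc j}. h i = nat k}"
          using P pos by auto
        then have "card {i \<in> {2 ^ j..<2 ^ Suc j}. P (int i) = k} \<le> card {i \<in> {2 ^ j..<2 ^ Suc j}. h i = nat k}"
             "card {i \<in> {2 ^ j..<2 ^ Suc j}. P (- int i) = k} \<le> card {i \<in> {2 ^ j..<2 ^ Suc j}. h i = nat k}"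
          by (auto intro!: card_mono)
        moreover have "C0 * 2 ^ j / (real j + 1) ^ A \<le> \<bar>C0\<bar> * 2 ^ j / (real j + 1) ^ A"
          by (intro divide_right_mono mult_right_mono) auto
        ultimately show ?thesis using C0[of j "nat k"] by linarith
      qed
      moreover have "real (card {m \<in> dyadic_block j. P m = k}) \<le>
          real (card {i \<in> {2 ^ j..<2 ^ Suc j}. P (int i) = k}) + real (card {i \<in> {2 ^ j..<2 ^ Suc j}. P (- int i) = k})"
        using card_dyadic_fibre_le[of j "\<lambda>m. P m = k"] by linarith
      moreover have "C / (real j + 1) ^ A * 2 ^ j = \<bar>C0\<bar> * 2 ^ j / (real j + 1) ^ A + \<bar>C0\<bar> * 2 ^ j / (real j + 1) ^ A"
        by (simp add: C_def)
      ultimately show ?thesis by linarith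
    qed
    have bd: "(\<Sum>n\<in>N. (\<Sum>m\<in>M. kern n m) powr (1 + \<epsilon>)) \<le> K" if "finite N" "finite M" "0 \<notin> M" for N M
      by (rule sum_powr_kern_le[OF \<epsilon>(1) _ fib K that]) (use C in auto)
    have sm: "kern n summable_on (UNIV - {0})" for n
      by (rule kern_summable_and_bound(1)[OF \<epsilon>(1)]) (rule bd)
    have total: "(\<Sum>n\<in>N. (\<Sum>\<^sub>\<infinity>m\<in>UNIV - {0}. kern n m) powr (1 + \<epsilon>)) \<le> K" if "finite N" for N
      by (rule kern_summable_and_bound(2)[OF \<epsilon>(1) _ that]) (rule bd)
    define S where "S = (\<lambda>n. \<Sum>\<^sub>\<infinity>m\<in>UNIV - {0}. kern n m)"
    have S0: "S n \<ge> 0" for n unfolding S_def by (rule infsum_nonneg) (rule kern_nonneg)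
    have nB: "norm (B_dis_summand P Q f g n m) = F * G * kern n m" for n m
      by (simp add: B_dis_summand_def kern_def norm_mult norm_divide fa gb)
    have sn: "(\<lambda>m. norm (B_dis_summand P Q f g n m)) summable_on (UNIV - {0})" for n
      unfolding nB by (rule summable_on_cmult_right[OF sm])
    show "B_dis_summand P Q f g n summable_on (UNIV - {0})" for n
      by (rule abs_summable_summable[OF sn])
    have nBd: "norm (B_dis P Q f g n) \<le> F * G * S n" for n
    proof -
      have "norm (B_dis P Q f g n) \<le> (\<Sum>\<^sub>\<infinity>m\<in>UNIV - {0}. norm (B_dis_summand P Q f g n m))"
        unfolding B_dis_def by (rule norm_infsum_bound[OF sn])
      also have "\<dots> = F * G * S n" unfolding nB S_def by (rule infsum_cmult_right[OF sm])
      finally show ?thesis .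
    qed
    have fin: "(\<Sum>n\<in>N. norm (B_dis P Q f g n) powr p) \<le> (F * G) powr p * K" if N: "finite N" for N
    proof -
      have "(\<Sum>n\<in>N. norm (B_dis P Q f g n) powr p) \<le> (\<Sum>n\<in>N. (F * G) powr p * S n powr p)"
      proof (rule sum_mono)
        fix n
        have "norm (B_dis P Q f g n) powr p \<le> (F * G * S n) powr p" using nBd p by (intro powr_mono2) auto
        then show "norm (B_dis P Q f g n) powr p \<le> (F * G) powr p * S n powr p"
          using FG S0 by (simp add: powr_mult)
      qed
      also have "\<dots> = (F * G) powr p * (\<Sum>n\<in>N. S n powr p)" by (simp add: sum_distrib_left)
      also have "\<dots> \<le> (F * G) powr p * K"
        using total[OF N] by (intro mult_left_mono) (auto simp: S_def p_def)
      finally show ?thesis .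
    qed
    have sB: "(\<lambda>n. norm (B_dis P Q f g n) powr p) summable_on UNIV"
      by (rule nonneg_bdd_above_summable_on) (use fin in \<open>auto intro!: bdd_aboveI\<close>)
    then show "B_dis P Q f g \<in> lp_space (1 + \<epsilon>)" by (simp add: lp_space_def p_def)
    have "(\<Sum>\<^sub>\<infinity>n. norm (B_dis P Q f g n) powr p) \<le> (F * G) powr p * K"
      by (rule infsum_le_finite_sums[OF sB fin])
    then have "lp_norm p (B_dis P Q f g) \<le> ((F * G) powr p * K) powr (1 / p)"
      unfolding lp_norm_def using p by (intro powr_mono2 infsum_nonneg) auto
    also have "\<dots> = K powr (1 / p) * F * G"
      using p K0 FG by (simp add: powr_mult powr_powr)
    finally show "lp_norm (1 + \<epsilon>) (B_dis P Q f g) \<le> K powr (1 / p) * lp_norm 2 f * lp_norm 2 g"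
      by (simp add: p_def F_def G_def)
  qed
qed

theorem corollary1p5:
  fixes \<epsilon> :: real
  assumes "0 < \<epsilon>" and "\<epsilon> < 1"
  shows "\<exists>C::real. \<forall>P Q :: int \<Rightarrow> int.
           totient_or_prime_counting P \<or> totient_or_prime_counting Q \<longrightarrow>
           (\<forall>f \<in> lp_space 2. \<forall>g \<in> lp_space 2.
              (\<forall>n. B_dis_summand P Q f g n summable_on (UNIV - {0})) \<and>
              B_dis P Q f g \<in> lp_space (1 + \<epsilon>) \<and>
              lp_norm (1 + \<epsilon>) (B_dis P Q f g) \<le> C * lp_norm 2 f * lp_norm 2 g)"
proof -
  have t: "small_fibres totient" unfolding small_fibres_def by (intro allI totient_fibre)
  have c: "small_fibres prime_counting" unfolding small_fibres_def by (intro allI prime_counting_fibre)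
  obtain C1 where C1: "C1 \<ge> 0" "\<forall>P Q f g. (\<forall>m. m \<noteq> 0 \<longrightarrow> P m = int (totient (nat \<bar>m\<bar>))) \<longrightarrow> f \<in> lp_space 2 \<longrightarrow> g \<in> lp_space 2 \<longrightarrow> B_dis_bounded \<epsilon> C1 P Q f g"
    using B_dis_bound[OF t assms] by blast
  obtain C2 where C2: "C2 \<ge> 0" "\<forall>P Q f g. (\<forall>m. m \<noteq> 0 \<longrightarrow> P m = int (prime_counting (nat \<bar>m\<bar>))) \<longrightarrow> f \<in> lp_space 2 \<longrightarrow> g \<in> lp_space 2 \<longrightarrow> B_dis_bounded \<epsilon> C2 P Q f g"
    using B_dis_bound[OF c assms] by blast
  \<comment> \<open>As both constants are nonnegative, their sum dominates each of them.\<close>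
  have left: "B_dis_bounded \<epsilon> (C1 + C2) P Q f g"
    if P: "totient_or_prime_counting P" and fg: "f \<in> lp_space 2" "g \<in> lp_space 2" for P Q f g
    using P unfolding totient_or_prime_counting_def
  proof
    assume "\<forall>m. m \<noteq> 0 \<longrightarrow> P m = int (totient (nat \<bar>m\<bar>))"
    then have "B_dis_bounded \<epsilon> C1 P Q f g" using C1(2) fg by blast
    then show ?thesis by (rule B_dis_bounded_mono) (use C2(1) in simp)
  next
    assume "\<forall>m. m \<noteq> 0 \<longrightarrow> P m = int (prime_counting (nat \<bar>m\<bar>))"
    then have "B_dis_bounded \<epsilon> C2 P Q f g" using C2(2) fg by blast
    then show ?thesis by (rule B_dis_bounded_mono) (use C1(1) in simp)
  qed
  show ?thesis
    unfolding B_dis_bounded_def[symmetric]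
  proof (intro exI[of _ "C1 + C2"] allI impI ballI)
    fix P Q f g
    assume PQ: "totient_or_prime_counting P \<or> totient_or_prime_counting Q" and fg: "f \<in> lp_space 2" "g \<in> lp_space 2"
    from PQ show "B_dis_bounded \<epsilon> (C1 + C2) P Q f g"
    proof
      assume "totient_or_prime_counting P"
      then show ?thesis using fg by (rule left)
    next
      assume "totient_or_prime_counting Q"
      \<comment> \<open>Exchanging P with Q and f with g leaves the summand unchanged.\<close>
      from left[OF this fg(2,1), of P] show ?thesis by (rule B_dis_bounded_commute)
    qed
  qed
qed

end
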